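(* Let $\nu\in\{3,4\}$ and consider AB$\nu$. Assume the inverse inequality $\|GV_h\|_\Omega\le C_Gh^{-1}\|V_h\|_\Omega$ for all $V_h\in\mathcal V_h$ and $0<\delta\le C_\delta h$, $\tau\le c_{\mathrm{AB}}C_G^{-1}h$ with $c_{\mathrm{AB}}>0$ sufficiently small. Assume also $0<\delta\le1$, the approximation estimate $$\|Y-\Pi_hY\|_\Omega+h\|G(Y-\Pi_hY)\|_\Omega\lesssim h^r\|Y\|_{H^r(\Omega)}$$ for $Y=U(t),\partial_tU(t),\partial_t^2U(t)$, and that $U,F$ are regular enough that the norms below are finite. Let $U_h^n\in\mathcal V_h$ satisfy $U_h^j=\Pi_hU(t^j)$ for $0\le j<\nu$ and $(A_\tau U_h^n,T_\delta W)_\Omega=(\mathcal M_\tau F(t^n),T_\delta W)_\Omega$ for all $W\in\mathcal V_h$, $\nu\le n\le N$. Then $$\begin{aligned}\max_{\nu\le n\le N}\|T_\delta(U_h^n-U(t^n))\|_\Omega\lesssim{}&(h^r+\delta h^{r-1})\|U\|_{L^\infty(0,T;H^r(\Omega))}\\&+\bigl((1+T^{1/2})\delta^{1/2}h^{r-1}+\delta^{-1/2}h^r\bigr)\mathcal N_{r,2}(U)\\&+(1+T^{1/2})\tau^\nu\mathcal C^\sharp_{T,\nu+2}(U,F)\\&+\tau^{1/2}(h^r+\tau h^{r-1})\|\partial_tU\|_{L^2(0,T;H^r(\Omega))}\\&+\tau^{1/2}h^{r-1}\|U\|_{L^2(0,T;H^r(\Omega))}+\tau^{\nu+1/2}\mathcal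 C^\sharp_{T,\nu+2}(U,F).\end{aligned}$$
   Context: Setting. $\Omega\subset\mathbb R^d$ is a Lipschitz domain, $\mathcal H=[L^2(\Omega)]^{n_{\rm sys}}$ with inner product $(\cdot,\cdot)_\Omega$ and norm $\|\cdot\|_\Omega$; $\mathcal V\subset[H^1(\Omega)]^{n_{\rm sys}}$ is dense in $\mathcal H$; $G:\mathcal V\to\mathcal H$ is a time-independent linear first-order differential operator with $(GU,V)_\Omega=-(U,GV)_\Omega$ for all $U,V\in\mathcal V$. $U$ is the exact solution of $\partial_tU+GU=F$ on $(0,T)$, $U(0)=U_0$. $\mathcal V_h\subset\mathcal V$ is a conforming finite element space of componentwise polynomial degree at most $k$ on a shape-regular mesh of mesh size $h$; $\Pi_h:\mathcal H\to\mathcal V_h$ is the $L^2$-orthogonal projection; $s\ge1$ is the spatial Sobolev regularity index, $r=\min(s,k+1)$. $\tau>0$, $t^n=n\tau$ ($0\le n\le N$), $t^N\le T$, $\delta>0$. AB$\nu$: $D_\tau^-V^n=\tau^{-1}(V^n-V^{n-1})$ and $\mathcal M_\tau V^n=\sum_{j=0}^{\nu}b_jV^{n-j}$ (also for sampled functions) with AB3: $(b_0,\dots,b_3)=(0,\frac{23}{12},-\frac{16}{12},\frac5{12})$; AB4: $(b_0,\dots,b_4)=(0,\frac{55}{24},-\frac{59}{24},\frac{37}{24},-\frac9{24})$. The first computed index is $\nu$. $T_\delta=\mathrm{Id}+\delta G$, $A_\tau=D_\tau^-+G\mathcal M_\tau$. $$\mathcal N_{r,2}(U)=\sum_{j=0}^2\|\partial_t^jU\|_{L^2(0,T;H^r(\Omega))}+\sum_{j=0}^1\|\partial_t^jU\|_{L^\infty(0,T;H^r(\Omega))},$$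 $$\mathcal C^\sharp_{T,\nu+2}(U,F)=\|\partial_t^\nu(F-GU)\|_{L^2(0,T;\mathcal H)}+\|\partial_t^\nu(F-GU)\|_{L^\infty(0,T;\mathcal H)}+\|\partial_t^{\nu+1}(F-GU)\|_{L^2(0,T;\mathcal H)}.$$ Conventions: $a\lesssim b$ means $a\le Cb$ with $C>0$ independent of $h$, $\tau$ and $N$; "$c_{\mathrm{AB}}$ sufficiently small" means below a positive threshold independent of $h$, $\tau$, $N$. *)

theory Defs
  imports "HOL-Analysis.Analysis" "HOL-Probability.Essential_Supremum"
begin

text \<open>
  Dimensions are types: \<^typ>\<open>real^'d\<close> is the physical space and \<^typ>\<open>real^'m\<close> the space of
  system values. Elements of \<open>L\<^sup>2(\<Omega>)\<close> are represented by functions on the whole space; only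
  their values on \<open>\<Omega>\<close>, up to null sets, matter.
\<close>


subsection \<open>Lipschitz domains\<close>

text \<open>
  Lipschitz domains are bounded. Near each boundary point the domain is, in suitable orthonormal coordinates, the strict epigraph
  of a Lipschitz function: \<open>e\<close> is the direction of the last coordinate and
  \<open>y - (y \<bullet> e) e\<close> collects the remaining ones.
\<close>

definition lipschitz_domain :: "(real^'d) set \<Rightarrow> bool" where
  "lipschitz_domain \<Omega> \<longleftrightarrow>
     open \<Omega> \<and> connected \<Omega> \<and> bounded \<Omega> \<and> \<Omega> \<noteq> {} \<and>
     (\<forall>x\<in>frontier \<Omega>. \<exists>e \<gamma> L \<rho>. norm e = 1 \<and> \<rho> > 0 \<and> L-lipschitz_on UNIV (\<gamma> :: real^'d \<Rightarrow> real) \<and>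
        \<Omega> \<inter> ball x \<rho> = {y \<in> ball x \<rho>. \<gamma> (y - (y \<bullet> e) *\<^sub>R e) < y \<bullet> e})"


subsection \<open>The space \<open>L\<^sup>2(\<Omega>)\<close>\<close>

definition l2_space :: "(real^'d) set \<Rightarrow> (real^'d \<Rightarrow> real^'m) set" where
  "l2_space \<Omega> = {u. u \<in> borel_measurable (lebesgue_on \<Omega>) \<and>
                    integrable (lebesgue_on \<Omega>) (\<lambda>x. (norm (u x))\<^sup>2)}"

definition l2_inner :: "(real^'d) set \<Rightarrow> (real^'d \<Rightarrow> real^'m) \<Rightarrow> (real^'d \<Rightarrow> real^'m) \<Rightarrow> real" where
  "l2_inner \<Omega> u v = (LINT x|lebesgue_on \<Omega>. u x \<bullet> v x)"

definition l2_norm :: "(real^'d) set \<Rightarrow> (real^'d \<Rightarrow> real^'m) \<Rightarrow> real" where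
  "l2_norm \<Omega> u = sqrt (l2_inner \<Omega> u u)"

definition l2_dense :: "(real^'d) set \<Rightarrow> (real^'d \<Rightarrow> real^'m) set \<Rightarrow> bool" where
  "l2_dense \<Omega> V \<longleftrightarrow> (\<forall>u\<in>l2_space \<Omega>. \<forall>\<epsilon>>0. \<exists>v\<in>V. l2_norm \<Omega> (\<lambda>x. u x - v x) < \<epsilon>)"

text \<open>
  A linear space of functions, closed under modification on null sets, so that it stands for a
  linear space of equivalence classes.
\<close>

definition ae_subspace :: "(real^'d) set \<Rightarrow> (real^'d \<Rightarrow> real^'m) set \<Rightarrow> bool" where
  "ae_subspace \<Omega> V \<longleftrightarrow>
     (\<lambda>x. 0) \<in> V \<and>
     (\<forall>u\<in>V. \<forall>v\<in>V. (\<lambda>x. u x + v x) \<in> V) \<and>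
     (\<forall>a. \<forall>u\<in>V. (\<lambda>x. a *\<^sub>R u x) \<in> V) \<and>
     (\<forall>u\<in>V. \<forall>v\<in>l2_space \<Omega>. (AE x in lebesgue_on \<Omega>. v x = u x) \<longrightarrow> v \<in> V)"


subsection \<open>Weak derivatives and Sobolev spaces\<close>

definition partial_deriv :: "'d \<Rightarrow> (real^'d \<Rightarrow> real) \<Rightarrow> real^'d \<Rightarrow> real" where
  "partial_deriv i f x = frechet_derivative f (at x) (axis i 1)"

fun partial_derivs :: "'d list \<Rightarrow> (real^'d \<Rightarrow> real) \<Rightarrow> real^'d \<Rightarrow> real" where
  "partial_derivs [] f = f"
| "partial_derivs (i # is) f = partial_deriv i (partial_derivs is f)"

definition test_function :: "(real^'d) set \<Rightarrow> (real^'d \<Rightarrow> real) \<Rightarrow> bool" where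
  "test_function \<Omega> f \<longleftrightarrow>
     (\<forall>is x. partial_derivs is f differentiable (at x)) \<and>
     compact (closure {x. f x \<noteq> 0}) \<and> closure {x. f x \<noteq> 0} \<subseteq> \<Omega>"

definition midx_order :: "('d::finite \<Rightarrow> nat) \<Rightarrow> nat" where
  "midx_order \<alpha> = sum \<alpha> UNIV"

text \<open>
  \<open>g\<close> is a weak derivative of multi-index order \<open>\<alpha>\<close> of \<open>u\<close>. The classical derivative of a
  test function is taken along every list of directions that contains direction \<open>i\<close> exactly
  \<open>\<alpha> i\<close> times; the ordering is immaterial for smooth functions.
\<close>

definition weak_deriv ::
  "(real^'d) set \<Rightarrow> ('d \<Rightarrow> nat) \<Rightarrow> (real^'d \<Rightarrow> real^'m) \<Rightarrow> (real^'d \<Rightarrow> real^'m) \<Rightarrow> bool" where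
  "weak_deriv \<Omega> \<alpha> u g \<longleftrightarrow>
     (\<forall>f is. test_function \<Omega> f \<and> (\<forall>i. count_list is i = \<alpha> i) \<longrightarrow>
        (LINT x|lebesgue_on \<Omega>. partial_derivs is f x *\<^sub>R u x) =
        (- 1) ^ midx_order \<alpha> *\<^sub>R (LINT x|lebesgue_on \<Omega>. f x *\<^sub>R g x))"

definition wD :: "(real^'d) set \<Rightarrow> ('d \<Rightarrow> nat) \<Rightarrow> (real^'d \<Rightarrow> real^'m) \<Rightarrow> (real^'d \<Rightarrow> real^'m)" where
  "wD \<Omega> \<alpha> u = (SOME g. g \<in> l2_space \<Omega> \<and> weak_deriv \<Omega> \<alpha> u g)"

text \<open>
  Sobolev--Slobodeckij spaces \<open>[H\<^sup>r(\<Omega>)]\<^sup>m\<close> of real order \<open>r \<ge> 0\<close>; for fractional part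
  \<open>\<theta> > 0\<close> the derivatives of top integer order have a finite Gagliardo seminorm. At \<open>x = y\<close>
  the quotient is \<open>0\<close>, which only concerns a null set.
\<close>

definition gagliardo_quot ::
  "(real^'d) set \<Rightarrow> real \<Rightarrow> ('d \<Rightarrow> nat) \<Rightarrow> (real^'d \<Rightarrow> real^'m) \<Rightarrow> (real^'d) \<times> (real^'d) \<Rightarrow> real" where
  "gagliardo_quot \<Omega> \<theta> \<alpha> u = (\<lambda>(x, y).
     (norm (wD \<Omega> \<alpha> u x - wD \<Omega> \<alpha> u y))\<^sup>2 / norm (x - y) powr (real CARD('d) + 2 * \<theta>))"

definition sobolev_space :: "(real^'d) set \<Rightarrow> real \<Rightarrow> (real^'d \<Rightarrow> real^'m) set" where
  "sobolev_space \<Omega> r = {u \<in> l2_space \<Omega>.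
     (\<forall>\<alpha>. midx_order \<alpha> \<le> nat \<lfloor>r\<rfloor> \<longrightarrow> (\<exists>g\<in>l2_space \<Omega>. weak_deriv \<Omega> \<alpha> u g)) \<and>
     (frac r \<noteq> 0 \<longrightarrow> (\<forall>\<alpha>. midx_order \<alpha> = nat \<lfloor>r\<rfloor> \<longrightarrow>
        integrable (lebesgue_on (\<Omega> \<times> \<Omega>)) (gagliardo_quot \<Omega> (frac r) \<alpha> u)))}"

definition sobolev_norm :: "(real^'d) set \<Rightarrow> real \<Rightarrow> (real^'d \<Rightarrow> real^'m) \<Rightarrow> real" where
  "sobolev_norm \<Omega> r u = sqrt (
     (\<Sum>\<alpha> | midx_order \<alpha> \<le> nat \<lfloor>r\<rfloor>. (l2_norm \<Omega> (wD \<Omega> \<alpha> u))\<^sup>2) +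
     (if frac r = 0 then 0
      else (\<Sum>\<alpha> | midx_order \<alpha> = nat \<lfloor>r\<rfloor>.
              LINT z|lebesgue_on (\<Omega> \<times> \<Omega>). gagliardo_quot \<Omega> (frac r) \<alpha> u z)))"


subsection \<open>The spatial operator\<close>

definition first_order_operator ::
  "(real^'d) set \<Rightarrow> (real^'d \<Rightarrow> real^'m) set \<Rightarrow> ((real^'d \<Rightarrow> real^'m) \<Rightarrow> (real^'d \<Rightarrow> real^'m)) \<Rightarrow> bool" where
  "first_order_operator \<Omega> V G \<longleftrightarrow>
     (\<exists>(A :: 'd \<Rightarrow> real^'d \<Rightarrow> real^'m^'m) B.
        (\<forall>i. A i \<in> borel_measurable (lebesgue_on \<Omega>)) \<and> B \<in> borel_measurable (lebesgue_on \<Omega>) \<and>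
        (\<forall>u\<in>V. AE x in lebesgue_on \<Omega>.
           G u x = (\<Sum>i\<in>UNIV. A i x *v wD \<Omega> (\<lambda>j. if j = i then 1 else 0) u x) + B x *v u x))"

definition stab_test ::
  "((real^'d \<Rightarrow> real^'m) \<Rightarrow> (real^'d \<Rightarrow> real^'m)) \<Rightarrow> real \<Rightarrow> (real^'d \<Rightarrow> real^'m) \<Rightarrow> (real^'d \<Rightarrow> real^'m)" where
  "stab_test G \<delta> u = (\<lambda>x. u x + \<delta> *\<^sub>R G u x)"


subsection \<open>Meshes and finite element spaces\<close>

text \<open>
  Elements are convex polytopes, which covers simplices and parallelotopes; hanging nodes are
  not excluded.
\<close>

definition fe_mesh :: "(real^'d) set \<Rightarrow> (real^'d) set set \<Rightarrow> bool" where
  "fe_mesh \<Omega> Th \<longleftrightarrow> finite Th \<and> (\<forall>K\<in>Th. polytope K \<and> interior K \<noteq> {}) \<and>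
     pairwise (\<lambda>K K'. interior K \<inter> interior K' = {}) Th \<and> \<Union>Th = closure \<Omega>"

definition mesh_size :: "(real^'d) set set \<Rightarrow> real" where
  "mesh_size Th = Max (diameter ` Th)"

text \<open>Every element \<open>K\<close> contains a ball of diameter \<open>diameter K / \<kappa>\<close>.\<close>

definition shape_regular :: "real \<Rightarrow> (real^'d) set set \<Rightarrow> bool" where
  "shape_regular \<kappa> Th \<longleftrightarrow> (\<forall>K\<in>Th. \<exists>x. cball x (diameter K / (2 * \<kappa>)) \<subseteq> K)"

definition poly_field :: "nat \<Rightarrow> (real^'d \<Rightarrow> real^'m) \<Rightarrow> bool" where
  "poly_field k p \<longleftrightarrow>
     (\<exists>c. \<forall>x. p x = (\<Sum>\<alpha> | midx_order \<alpha> \<le> k. (\<Prod>i\<in>UNIV. x $ i ^ \<alpha> i) *\<^sub>R c \<alpha>))"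

text \<open>The span of finitely many basis functions in \<open>V\<close>, piecewise polynomial on the mesh.\<close>

definition conforming_fe_space ::
  "(real^'d \<Rightarrow> real^'m) set \<Rightarrow> nat \<Rightarrow> (real^'d) set set \<Rightarrow> (real^'d \<Rightarrow> real^'m) set \<Rightarrow> bool" where
  "conforming_fe_space V k Th Vh \<longleftrightarrow>
     Vh \<subseteq> V \<and>
     (\<exists>(M::nat) \<phi>. Vh = {\<lambda>x. \<Sum>i<M. c i *\<^sub>R \<phi> i x | c. True}) \<and>
     (\<forall>v\<in>Vh. \<forall>K\<in>Th. \<exists>p. poly_field k p \<and> (\<forall>x\<in>interior K. v x = p x))"

definition l2_proj ::
  "(real^'d) set \<Rightarrow> (real^'d \<Rightarrow> real^'m) set \<Rightarrow> (real^'d \<Rightarrow> real^'m) \<Rightarrow> (real^'d \<Rightarrow> real^'m)" where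
  "l2_proj \<Omega> Vh u = (SOME p. p \<in> Vh \<and> (\<forall>w\<in>Vh. l2_inner \<Omega> (\<lambda>x. u x - p x) w = 0))"

definition approx_estimate ::
  "(real^'d) set \<Rightarrow> ((real^'d \<Rightarrow> real^'m) \<Rightarrow> (real^'d \<Rightarrow> real^'m)) \<Rightarrow> (real^'d \<Rightarrow> real^'m) set \<Rightarrow>
   real \<Rightarrow> real \<Rightarrow> real \<Rightarrow> (real^'d \<Rightarrow> real^'m) \<Rightarrow> bool" where
  "approx_estimate \<Omega> G Vh h r C Y \<longleftrightarrow>
     (let e = (\<lambda>x. Y x - l2_proj \<Omega> Vh Y x)
      in l2_norm \<Omega> e + h * l2_norm \<Omega> (G e) \<le> C * h powr r * sobolev_norm \<Omega> r Y)"


subsection \<open>Functions of time with values in function spaces\<close>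

text \<open>
  Strong measurability of a map into the separable space \<open>L\<^sup>2(\<Omega>)\<close>, expressed through weak
  measurability (Pettis).
\<close>

definition time_measurable :: "(real^'d) set \<Rightarrow> real \<Rightarrow> (real \<Rightarrow> (real^'d \<Rightarrow> real^'m)) \<Rightarrow> bool" where
  "time_measurable \<Omega> T u \<longleftrightarrow>
     (AE t in lebesgue_on {0<..<T}. u t \<in> l2_space \<Omega>) \<and>
     (\<forall>\<phi>\<in>l2_space \<Omega>. (\<lambda>t. l2_inner \<Omega> (u t) \<phi>) \<in> borel_measurable (lebesgue_on {0<..<T}))"

text \<open>
  Membership in \<open>L\<^sup>2(0,T;X)\<close> and \<open>L\<^sup>\<infinity>(0,T;X)\<close> for \<open>X \<subseteq> L\<^sup>2(\<Omega>)\<close> with norm \<open>nX\<close>, and the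
  corresponding norms.
\<close>

definition L2_time_space ::
  "(real^'d) set \<Rightarrow> real \<Rightarrow> (real^'d \<Rightarrow> real^'m) set \<Rightarrow> ((real^'d \<Rightarrow> real^'m) \<Rightarrow> real) \<Rightarrow>
   (real \<Rightarrow> (real^'d \<Rightarrow> real^'m)) set" where
  "L2_time_space \<Omega> T X nX = {u. time_measurable \<Omega> T u \<and>
     (AE t in lebesgue_on {0<..<T}. u t \<in> X) \<and>
     (\<lambda>t. nX (u t)) \<in> borel_measurable (lebesgue_on {0<..<T}) \<and>
     integrable (lebesgue_on {0<..<T}) (\<lambda>t. (nX (u t))\<^sup>2)}"

definition Linf_time_space ::
  "(real^'d) set \<Rightarrow> real \<Rightarrow> (real^'d \<Rightarrow> real^'m) set \<Rightarrow> ((real^'d \<Rightarrow> real^'m) \<Rightarrow> real) \<Rightarrow>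
   (real \<Rightarrow> (real^'d \<Rightarrow> real^'m)) set" where
  "Linf_time_space \<Omega> T X nX = {u. time_measurable \<Omega> T u \<and>
     (AE t in lebesgue_on {0<..<T}. u t \<in> X) \<and>
     (\<lambda>t. nX (u t)) \<in> borel_measurable (lebesgue_on {0<..<T}) \<and>
     esssup (lebesgue_on {0<..<T}) (\<lambda>t. ereal (nX (u t))) < \<infinity>}"

definition L2_time_norm ::
  "real \<Rightarrow> ((real^'d \<Rightarrow> real^'m) \<Rightarrow> real) \<Rightarrow> (real \<Rightarrow> (real^'d \<Rightarrow> real^'m)) \<Rightarrow> real" where
  "L2_time_norm T nX u = sqrt (LINT t|lebesgue_on {0<..<T}. (nX (u t))\<^sup>2)"

definition Linf_time_norm ::
  "real \<Rightarrow> ((real^'d \<Rightarrow> real^'m) \<Rightarrow> real) \<Rightarrow> (real \<Rightarrow> (real^'d \<Rightarrow> real^'m)) \<Rightarrow> real" where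
  "Linf_time_norm T nX u =
     real_of_ereal (esssup (lebesgue_on {0<..<T}) (\<lambda>t. ereal (nX (u t))))"

text \<open>
  \<open>u\<close> is the absolutely continuous representative of an element of \<open>W\<^sup>1\<^sup>,\<^sup>1(0,T;L\<^sup>2(\<Omega>))\<close> with
  (almost everywhere defined) derivative \<open>g\<close>: \<open>u(t) - u(s)\<close> is the integral of \<open>g\<close> over
  \<open>[s,t]\<close> in \<open>L\<^sup>2(\<Omega>)\<close>, which is tested here against all elements of \<open>L\<^sup>2(\<Omega>)\<close>.
  If \<open>g\<close> is itself continuous, it is the classical derivative.
\<close>

definition has_time_deriv ::
  "(real^'d) set \<Rightarrow> real \<Rightarrow> (real \<Rightarrow> (real^'d \<Rightarrow> real^'m)) \<Rightarrow> (real \<Rightarrow> (real^'d \<Rightarrow> real^'m)) \<Rightarrow> bool" where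
  "has_time_deriv \<Omega> T u g \<longleftrightarrow>
     (\<forall>t\<in>{0..T}. u t \<in> l2_space \<Omega>) \<and>
     time_measurable \<Omega> T g \<and>
     integrable (lebesgue_on {0<..<T}) (\<lambda>t. l2_norm \<Omega> (g t)) \<and>
     (\<forall>\<phi>\<in>l2_space \<Omega>. \<forall>s t. 0 \<le> s \<and> s \<le> t \<and> t \<le> T \<longrightarrow>
        l2_inner \<Omega> (\<lambda>x. u t x - u s x) \<phi> = (LINT \<sigma>|lebesgue_on {s<..<t}. l2_inner \<Omega> (g \<sigma>) \<phi>))"

definition time_derivs ::
  "(real^'d) set \<Rightarrow> real \<Rightarrow> nat \<Rightarrow> (real \<Rightarrow> (real^'d \<Rightarrow> real^'m)) \<Rightarrow>
   (nat \<Rightarrow> real \<Rightarrow> (real^'d \<Rightarrow> real^'m)) \<Rightarrow> bool" where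
  "time_derivs \<Omega> T m u D \<longleftrightarrow> D 0 = u \<and> (\<forall>j<m. has_time_deriv \<Omega> T (D j) (D (Suc j)))"

definition rhs_minus_G ::
  "((real^'d \<Rightarrow> real^'m) \<Rightarrow> (real^'d \<Rightarrow> real^'m)) \<Rightarrow> (real \<Rightarrow> (real^'d \<Rightarrow> real^'m)) \<Rightarrow> (real \<Rightarrow> (real^'d \<Rightarrow> real^'m)) \<Rightarrow>
   real \<Rightarrow> (real^'d \<Rightarrow> real^'m)" where
  "rhs_minus_G G F U = (\<lambda>t x. F t x - G (U t) x)"

definition exact_solution ::
  "(real^'d) set \<Rightarrow> (real^'d \<Rightarrow> real^'m) set \<Rightarrow> ((real^'d \<Rightarrow> real^'m) \<Rightarrow> (real^'d \<Rightarrow> real^'m)) \<Rightarrow> real \<Rightarrow>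
   (real \<Rightarrow> (real^'d \<Rightarrow> real^'m)) \<Rightarrow> (real^'d \<Rightarrow> real^'m) \<Rightarrow> (real \<Rightarrow> (real^'d \<Rightarrow> real^'m)) \<Rightarrow> bool" where
  "exact_solution \<Omega> V G T F U0 U \<longleftrightarrow>
     (\<forall>t\<in>{0..T}. U t \<in> V \<and> F t \<in> l2_space \<Omega>) \<and>
     has_time_deriv \<Omega> T U (rhs_minus_G G F U) \<and>
     (AE x in lebesgue_on \<Omega>. U 0 x = U0 x)"

text \<open>In the following two norms \<open>DU j\<close> and \<open>DR j\<close> are the \<open>j\<close>-th time derivatives of \<open>U\<close> and
  of \<open>F - G U\<close>.\<close>

definition norm_N2 ::
  "(real^'d) set \<Rightarrow> real \<Rightarrow> real \<Rightarrow> (nat \<Rightarrow> real \<Rightarrow> (real^'d \<Rightarrow> real^'m)) \<Rightarrow> real" where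
  "norm_N2 \<Omega> T r DU =
     (\<Sum>j\<le>2. L2_time_norm T (sobolev_norm \<Omega> r) (DU j)) +
     (\<Sum>j\<le>1. Linf_time_norm T (sobolev_norm \<Omega> r) (DU j))"

definition norm_Csharp ::
  "(real^'d) set \<Rightarrow> real \<Rightarrow> nat \<Rightarrow> (nat \<Rightarrow> real \<Rightarrow> (real^'d \<Rightarrow> real^'m)) \<Rightarrow> real" where
  "norm_Csharp \<Omega> T \<nu> DR =
     L2_time_norm T (l2_norm \<Omega>) (DR \<nu>) + Linf_time_norm T (l2_norm \<Omega>) (DR \<nu>) +
     L2_time_norm T (l2_norm \<Omega>) (DR (\<nu> + 1))"

definition regular_data ::
  "(real^'d) set \<Rightarrow> real \<Rightarrow> real \<Rightarrow> nat \<Rightarrow> (nat \<Rightarrow> real \<Rightarrow> (real^'d \<Rightarrow> real^'m)) \<Rightarrow>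
   (nat \<Rightarrow> real \<Rightarrow> (real^'d \<Rightarrow> real^'m)) \<Rightarrow> bool" where
  "regular_data \<Omega> T r \<nu> DU DR \<longleftrightarrow>
     (\<forall>j\<le>2. DU j \<in> L2_time_space \<Omega> T (sobolev_space \<Omega> r) (sobolev_norm \<Omega> r)) \<and>
     (\<forall>j\<le>1. DU j \<in> Linf_time_space \<Omega> T (sobolev_space \<Omega> r) (sobolev_norm \<Omega> r)) \<and>
     DR \<nu> \<in> L2_time_space \<Omega> T (l2_space \<Omega>) (l2_norm \<Omega>) \<and>
     DR \<nu> \<in> Linf_time_space \<Omega> T (l2_space \<Omega>) (l2_norm \<Omega>) \<and>
     DR (\<nu> + 1) \<in> L2_time_space \<Omega> T (l2_space \<Omega>) (l2_norm \<Omega>)"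


subsection \<open>Adams--Bashforth time stepping\<close>

definition ab_coeff :: "nat \<Rightarrow> nat \<Rightarrow> real" where
  "ab_coeff \<nu> j =
     (if \<nu> = 3 then [0, 23/12, - 16/12, 5/12] ! j
      else [0, 55/24, - 59/24, 37/24, - 9/24] ! j)"

text \<open>For \<open>n \<ge> \<nu>\<close>, the only indices used, no truncated subtraction occurs below.\<close>

definition ab_mean :: "nat \<Rightarrow> (nat \<Rightarrow> (real^'d \<Rightarrow> real^'m)) \<Rightarrow> nat \<Rightarrow> (real^'d \<Rightarrow> real^'m)" where
  "ab_mean \<nu> v n = (\<lambda>x. \<Sum>j\<le>\<nu>. ab_coeff \<nu> j *\<^sub>R v (n - j) x)"

definition back_diff :: "real \<Rightarrow> (nat \<Rightarrow> (real^'d \<Rightarrow> real^'m)) \<Rightarrow> nat \<Rightarrow> (real^'d \<Rightarrow> real^'m)" where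
  "back_diff \<tau> v n = (\<lambda>x. (1 / \<tau>) *\<^sub>R (v n x - v (n - 1) x))"

definition ab_operator ::
  "((real^'d \<Rightarrow> real^'m) \<Rightarrow> (real^'d \<Rightarrow> real^'m)) \<Rightarrow> nat \<Rightarrow> real \<Rightarrow> (nat \<Rightarrow> (real^'d \<Rightarrow> real^'m)) \<Rightarrow> nat \<Rightarrow>
   (real^'d \<Rightarrow> real^'m)" where
  "ab_operator G \<nu> \<tau> v n = (\<lambda>x. back_diff \<tau> v n x + G (ab_mean \<nu> v n) x)"

definition ab_scheme ::
  "(real^'d) set \<Rightarrow> ((real^'d \<Rightarrow> real^'m) \<Rightarrow> (real^'d \<Rightarrow> real^'m)) \<Rightarrow> (real^'d \<Rightarrow> real^'m) set \<Rightarrow>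
   nat \<Rightarrow> real \<Rightarrow> real \<Rightarrow> nat \<Rightarrow> (real \<Rightarrow> (real^'d \<Rightarrow> real^'m)) \<Rightarrow> (real \<Rightarrow> (real^'d \<Rightarrow> real^'m)) \<Rightarrow>
   (nat \<Rightarrow> (real^'d \<Rightarrow> real^'m)) \<Rightarrow> bool" where
  "ab_scheme \<Omega> G Vh \<nu> \<tau> \<delta> N F U Uh \<longleftrightarrow>
     (\<forall>n\<le>N. Uh n \<in> Vh) \<and>
     (\<forall>j<\<nu>. AE x in lebesgue_on \<Omega>. Uh j x = l2_proj \<Omega> Vh (U (real j * \<tau>)) x) \<and>
     (\<forall>n\<in>{\<nu>..N}. \<forall>W\<in>Vh.
        l2_inner \<Omega> (ab_operator G \<nu> \<tau> Uh n) (stab_test G \<delta> W) =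
        l2_inner \<Omega> (ab_mean \<nu> (\<lambda>j. F (real j * \<tau>)) n) (stab_test G \<delta> W))"

end

theory Submission
  imports Defs
begin

text \<open>
  The error splits into a discrete part \<open>\<theta>\<close> and the projection error \<open>\<eta>\<close> of the exact
  solution. Write \<open>D\<close> for the backward difference quotient and \<open>M\<close> for the Adams--Bashforth mean.
  The discrete part satisfies the scheme with the projection and consistency errors as data. It
  is tested with \<open>M \<theta> + \<delta> D \<theta>\<close>. As \<open>G\<close> is skew, what remains on the left is the pairing of
  \<open>D \<theta>\<close> with \<open>M \<theta>\<close> in the energy inner product, whose norm is that of \<open>\<theta> + \<delta> G \<theta>\<close>, and the dissipation
  \<open>\<delta> (norm (D \<theta> + G (M \<theta>)))\<^sup>2\<close> (\<open>energy_identity\<close>).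

  The pairing is not nonnegative, since the method is explicit. Expanding \<open>M\<close> in powers of the backward
  difference shows that it telescopes up to the square of a difference of order \<open>\<nu> - 1\<close> with positive
  sign and one of order \<open>\<nu>\<close> with negative sign (\<open>ab_dissipation\<close>). The inverse inequality and the
  restriction on the time step make the latter a small multiple of the former, at the expense of
  the data (\<open>X_step\<close>, \<open>ab_stability\<close>). Thus the error is controlled without exponential growth in time.

  On the right, \<open>\<eta>\<close> is orthogonal to the discrete space, so that \<open>G\<close> can be moved from
  \<open>\<eta>\<close> to the dissipated quantity. One term is summed by parts in time, and the rest is absorbed or bounded by
  the largest error (\<open>residual_bound\<close>, \<open>error_bound\<close>). The consistency error is bounded by Taylor
  expansion of scalar products (\<open>consistency\<close>), and the projection error at the grid points by duality,
  since approximation holds at almost every time only (\<open>increment_bounds\<close>, \<open>cell_bounds\<close>).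

  These arguments take place in a real inner product space. Square integrable functions modulo null sets
  form such a space, and \<open>G\<close> descends to a skew operator on it (\<open>galerkin\<close>).
\<close>

section \<open>Backward differences and the Adams--Bashforth mean\<close>

text \<open>
  Sequences start at index \<open>0\<close>, and truncated subtraction repeats the value at \<open>0\<close>. For sequences
  that vanish at \<open>0\<close> this agrees with extending them by zero to negative indices, so that differences
  of all orders commute with the scheme.
\<close>

definition bdiff :: "(nat \<Rightarrow> 'a::ab_group_add) \<Rightarrow> nat \<Rightarrow> 'a" where
  "bdiff f n = f n - f (n - 1)"

definition abm :: "nat \<Rightarrow> (nat \<Rightarrow> 'a::real_vector) \<Rightarrow> nat \<Rightarrow> 'a" where
  "abm \<nu> f n = (\<Sum>j\<le>\<nu>. ab_coeff \<nu> j *\<^sub>R f (n - j))"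

lemma abm3: "abm 3 f n = (23/12) *\<^sub>R f (n-1) - (16/12) *\<^sub>R f (n-2) + (5/12) *\<^sub>R f (n-3)"
  by (simp add: abm_def ab_coeff_def numeral_eq_Suc)

lemma abm4: "abm 4 f n = (55/24) *\<^sub>R f (n-1) - (59/24) *\<^sub>R f (n-2) + (37/24) *\<^sub>R f (n-3) - (9/24) *\<^sub>R f (n-4)"
  by (simp add: abm_def ab_coeff_def numeral_eq_Suc)

text \<open>
  The quadratic form that telescopes when the increment of a sequence is paired with its
  Adams--Bashforth mean. Its coefficients come from writing the mean as a polynomial in the
  backward difference (\<open>abm_bdiff\<close>) and summing each product \<open>d \<bullet> (bdiff ^^ i) X\<close> by parts.
\<close>

definition ab_energy :: "nat \<Rightarrow> (nat \<Rightarrow> 'a::real_inner) \<Rightarrow> nat \<Rightarrow> real" where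
  "ab_energy \<nu> X n =
     (let x = X n; d = bdiff X n; e = (bdiff ^^ 2) X n; c = (bdiff ^^ 3) X n in
      if \<nu> = 3 then (1/2) * (x \<bullet> x) - (1/24) * (d \<bullet> d) - (5/12) * (d \<bullet> e) - (5/24) * (e \<bullet> e)
      else (1/2) * (x \<bullet> x) - (1/24) * (d \<bullet> d) - (1/24) * (d \<bullet> e) + (1/6) * (e \<bullet> e)
           - (3/8) * (d \<bullet> c) - (3/8) * (e \<bullet> c) - (3/16) * (c \<bullet> c))"

lemma lag_bdiff:
  fixes f :: "nat \<Rightarrow> 'a::real_vector"
  shows "f (n-1) = f n - bdiff f n" "f (n-2) = f n - 2 *\<^sub>R bdiff f n + (bdiff ^^ 2) f n"
    "f (n-3) = f n - 3 *\<^sub>R bdiff f n + 3 *\<^sub>R (bdiff ^^ 2) f n - (bdiff ^^ 3) f n"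
    "f (n-4) = f n - 4 *\<^sub>R bdiff f n + 6 *\<^sub>R (bdiff ^^ 2) f n - 4 *\<^sub>R (bdiff ^^ 3) f n + (bdiff ^^ 4) f n"
proof -
  have lag: "g (n - Suc k) = g (n - k) - bdiff g (n - k)" for g :: "nat \<Rightarrow> 'a" and k
    by (simp add: bdiff_def)
  have p: "(bdiff ^^ 2) f = bdiff (bdiff f)" "(bdiff ^^ 3) f = bdiff (bdiff (bdiff f))"
    "(bdiff ^^ 4) f = bdiff (bdiff (bdiff (bdiff f)))"
    by (simp_all add: numeral_eq_Suc)
  have n: "(1::nat) = Suc 0" "(2::nat) = Suc (Suc 0)" "(3::nat) = Suc (Suc (Suc 0))" "(4::nat) = Suc (Suc (Suc (Suc 0)))"
    by simp_all
  have e: "(2::real) = 1 + 1" "(3::real) = 1 + 1 + 1" "(4::real) = 1 + 1 + 1 + 1" "(6::real) = 1 + 1 + 1 + 1 + 1 + 1"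
    by simp_all
  have s: "2 *\<^sub>R x = x + x" "3 *\<^sub>R x = x + x + x" "4 *\<^sub>R x = x + x + x + x" "6 *\<^sub>R x = x + x + x + x + x + x"
    for x :: 'a
    unfolding e scaleR_left.add scaleR_one by simp_all
  show "f (n-1) = f n - bdiff f n" "f (n-2) = f n - 2 *\<^sub>R bdiff f n + (bdiff ^^ 2) f n"
    "f (n-3) = f n - 3 *\<^sub>R bdiff f n + 3 *\<^sub>R (bdiff ^^ 2) f n - (bdiff ^^ 3) f n"
    "f (n-4) = f n - 4 *\<^sub>R bdiff f n + 6 *\<^sub>R (bdiff ^^ 2) f n - 4 *\<^sub>R (bdiff ^^ 3) f n + (bdiff ^^ 4) f n"
    unfolding p s unfolding n lag diff_zero by (simp_all add: algebra_simps)
qed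

lemma ab_reexpansion:
  fixes x d e c g :: "'a::real_vector"
  shows "(23/12) *\<^sub>R (x - d) - (16/12) *\<^sub>R (x - 2 *\<^sub>R d + e) + (5/12) *\<^sub>R (x - 3 *\<^sub>R d + 3 *\<^sub>R e - c)
     = x - (1/2) *\<^sub>R d - (1/12) *\<^sub>R e - (5/12) *\<^sub>R c" (is ?A)
    and "(55/24) *\<^sub>R (x - d) - (59/24) *\<^sub>R (x - 2 *\<^sub>R d + e) + (37/24) *\<^sub>R (x - 3 *\<^sub>R d + 3 *\<^sub>R e - c)
      - (9/24) *\<^sub>R (x - 4 *\<^sub>R d + 6 *\<^sub>R e - 4 *\<^sub>R c + g)
     = x - (1/2) *\<^sub>R d - (1/12) *\<^sub>R e - (1/24) *\<^sub>R c - (3/8) *\<^sub>R g" (is ?B)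
proof -
  have s: "(a *\<^sub>R x + b *\<^sub>R d + p *\<^sub>R e + q *\<^sub>R c + r *\<^sub>R g) = (a' *\<^sub>R x + b' *\<^sub>R d + p' *\<^sub>R e + q' *\<^sub>R c + r' *\<^sub>R g)"
    if "a = a'" "b = b'" "p = p'" "q = q'" "r = r'" for a b p q r a' b' p' q' r' 
    using that by simp
  have "(23/12) *\<^sub>R (x - d) - (16/12) *\<^sub>R (x - 2 *\<^sub>R d + e) + (5/12) *\<^sub>R (x - 3 *\<^sub>R d + 3 *\<^sub>R e - c)
    = (23/12 - 16/12 + 5/12) *\<^sub>R x + (-23/12 + 2*16/12 - 3*5/12) *\<^sub>R d + (-16/12 + 3 * 5/12) *\<^sub>R e + (- 5/12) *\<^sub>R c + 0 *\<^sub>R g"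
    unfolding scaleR_left.add scaleR_left.diff by (simp add: scaleR_add_right scaleR_diff_right)
  then show ?A by simp
  have "(55/24) *\<^sub>R (x - d) - (59/24) *\<^sub>R (x - 2 *\<^sub>R d + e) + (37/24) *\<^sub>R (x - 3 *\<^sub>R d + 3 *\<^sub>R e - c)
      - (9/24) *\<^sub>R (x - 4 *\<^sub>R d + 6 *\<^sub>R e - 4 *\<^sub>R c + g)
    = (55/24 - 59/24 + 37/24 - 9/24) *\<^sub>R x + (-55/24 + 2*59/24 - 3*37/24 + 4*9/24) *\<^sub>R d + (-59/24 + 3 * 37/24 - 6*9/24) *\<^sub>R e
      + (- 37/24 + 4*9/24) *\<^sub>R c + (-9/24) *\<^sub>R g"
    unfolding scaleR_left.add scaleR_left.diff by (simp add: scaleR_add_right scaleR_diff_right)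
  then show ?B by simp
qed

lemma abm_bdiff:
  "abm 3 f n = f n - (1/2) *\<^sub>R bdiff f n - (1/12) *\<^sub>R (bdiff ^^ 2) f n - (5/12) *\<^sub>R (bdiff ^^ 3) f n"
  "abm 4 f n = f n - (1/2) *\<^sub>R bdiff f n - (1/12) *\<^sub>R (bdiff ^^ 2) f n - (1/24) *\<^sub>R (bdiff ^^ 3) f n
     - (3/8) *\<^sub>R (bdiff ^^ 4) f n"
  unfolding abm3 abm4 lag_bdiff ab_reexpansion by simp_all

lemma bdiff_shift:
  "bdiff f (n - 1) = bdiff f n - (bdiff ^^ 2) f n"
  "(bdiff ^^ 2) f (n - 1) = (bdiff ^^ 2) f n - (bdiff ^^ 3) f n"
  "(bdiff ^^ 3) f (n - 1) = (bdiff ^^ 3) f n - (bdiff ^^ 4) f n"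
  by (simp_all add: numeral_eq_Suc bdiff_def)

text \<open>
  The square that remains with the good sign is the first nonvanishing dissipation term of the
  method on the imaginary axis; the one with the bad sign is one difference order higher. On sequences
  produced by a scheme with small time step a further difference costs a small factor, so the good
  term wins. That the good term of order two (AB3) or three (AB4) has a positive coefficient is
  the reason why these two methods are stable for skew operators.
\<close>

lemma ab3_identity:
  fixes X :: "nat \<Rightarrow> 'a::real_inner"
  shows "bdiff X n \<bullet> abm 3 X n = ab_energy 3 X n - ab_energy 3 X (n - 1)
    + (3/8) * (norm ((bdiff ^^ 2) X n))\<^sup>2 - (5/24) * (norm ((bdiff ^^ 3) X n))\<^sup>2"
proof -
  define x d e c where "x = X n" "d = bdiff X n" "e = (bdiff ^^ 2) X n" "c = (bdiff ^^ 3) X n"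
  have c: "d \<bullet> x = x \<bullet> d" "e \<bullet> x = x \<bullet> e" "c \<bullet> x = x \<bullet> c" "e \<bullet> d = d \<bullet> e" "c \<bullet> d = d \<bullet> c" "c \<bullet> e = e \<bullet> c"
    by (simp_all add: inner_commute)
  show ?thesis
    unfolding ab_energy_def Let_def abm_bdiff bdiff_shift lag_bdiff(1)[of X] power2_norm_eq_inner
    by (simp add: inner_diff_left inner_diff_right c flip: x_d_e_c_def)
      (simp add: field_simps)
qed

lemma ab4_identity:
  fixes X :: "nat \<Rightarrow> 'a::real_inner"
  shows "bdiff X n \<bullet> abm 4 X n = ab_energy 4 X n - ab_energy 4 X (n - 1)
    + (13/24) * (norm ((bdiff ^^ 3) X n))\<^sup>2 - (3/16) * (norm ((bdiff ^^ 4) X n))\<^sup>2"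
proof -
  define x d e c g where "x = X n" "d = bdiff X n" "e = (bdiff ^^ 2) X n" "c = (bdiff ^^ 3) X n" "g = (bdiff ^^ 4) X n"
  have c: "d \<bullet> x = x \<bullet> d" "e \<bullet> x = x \<bullet> e" "c \<bullet> x = x \<bullet> c" "e \<bullet> d = d \<bullet> e" "c \<bullet> d = d \<bullet> c" "c \<bullet> e = e \<bullet> c"
    "g \<bullet> x = x \<bullet> g" "g \<bullet> d = d \<bullet> g" "g \<bullet> e = e \<bullet> g" "g \<bullet> c = c \<bullet> g"
    by (simp_all add: inner_commute)
  show ?thesis
    unfolding ab_energy_def Let_def abm_bdiff bdiff_shift lag_bdiff(1)[of X] power2_norm_eq_inner
    by (simp add: inner_diff_left inner_diff_right c flip: x_d_e_c_g_def)
      (simp add: field_simps)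
qed

text \<open>
  The smaller coefficient of the good term and the larger one of the bad term serve both methods.
\<close>

lemma ab_dissipation:
  fixes X :: "nat \<Rightarrow> 'a::real_inner"
  assumes "\<nu> \<in> {3, 4}"
  shows "ab_energy \<nu> X n - ab_energy \<nu> X (n - 1)
    + (3/8) * (norm ((bdiff ^^ (\<nu> - 1)) X n))\<^sup>2 - (5/24) * (norm ((bdiff ^^ \<nu>) X n))\<^sup>2
    \<le> bdiff X n \<bullet> abm \<nu> X n"
proof -
  have "\<nu> = 3 \<or> \<nu> = 4" using assms by auto
  then show ?thesis
  proof
    assume "\<nu> = 3" then show ?thesis using ab3_identity[of X n] by simp
  next
    assume n: "\<nu> = 4"
    have "0 \<le> (norm ((bdiff ^^ 3) X n))\<^sup>2" "0 \<le> (norm ((bdiff ^^ 4) X n))\<^sup>2" by auto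
    then have "(3/8) * (norm ((bdiff ^^ 3) X n))\<^sup>2 - (5/24) * (norm ((bdiff ^^ 4) X n))\<^sup>2
        \<le> (13/24) * (norm ((bdiff ^^ 3) X n))\<^sup>2 - (3/16) * (norm ((bdiff ^^ 4) X n))\<^sup>2"
      by linarith
    then show ?thesis using ab4_identity[of X n] n by simp
  qed
qed

lemma ab_energy_lower:
  fixes X :: "nat \<Rightarrow> 'a::real_inner"
  assumes D: "\<And>i. norm (bdiff X (n - i)) \<le> D"
  shows "(1/2) * (norm (X n))\<^sup>2 - 21 * D\<^sup>2 \<le> ab_energy \<nu> X n"
proof -
  define x d e c where "x = X n" "d = bdiff X n" "e = (bdiff ^^ 2) X n" "c = (bdiff ^^ 3) X n"
  have nd: "norm d \<le> D" using D[of 0] by (simp add: x_d_e_c_def)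
  have e: "(bdiff ^^ 2) X (n - i) = bdiff X (n - i) - bdiff X (n - Suc i)" for i
    by (simp add: numeral_2_eq_2 bdiff_def)
  have ne: "norm ((bdiff ^^ 2) X (n - i)) \<le> 2 * D" for i
    unfolding e using D[of i] D[of "Suc i"] norm_triangle_ineq4[of "bdiff X (n - i)" "bdiff X (n - Suc i)"] by linarith
  have nc: "norm c \<le> 4 * D"
    using bdiff_shift(2)[of X n] ne[of 0] ne[of 1]
      norm_triangle_ineq4[of "(bdiff ^^ 2) X n" "(bdiff ^^ 2) X (n - 1)"]
    by (simp add: x_d_e_c_def)
  have ne0: "norm e \<le> 2 * D" using ne[of 0] by (simp add: x_d_e_c_def)
  have sq: "v \<bullet> v \<le> (k * D)\<^sup>2" if "norm v \<le> k * D" for v :: 'a and k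
    unfolding power2_norm_eq_inner[symmetric] using that by (simp add: power_mono)
  have 1: "d \<bullet> d \<le> D\<^sup>2" "e \<bullet> e \<le> 4 * D\<^sup>2" "c \<bullet> c \<le> 16 * D\<^sup>2"
    using sq[of d 1] sq[of e 2] sq[of c 4] nd ne0 nc by (simp_all add: power_mult_distrib)
  have y: "2 * (u \<bullet> v) \<le> u \<bullet> u + v \<bullet> v" for u v :: 'a
    using inner_ge_zero[of "u - v"] by (simp add: inner_diff_left inner_diff_right inner_commute)
  have 2: "2 * (d \<bullet> e) \<le> d \<bullet> d + e \<bullet> e" "2 * (d \<bullet> c) \<le> d \<bullet> d + c \<bullet> c" "2 * (e \<bullet> c) \<le> e \<bullet> e + c \<bullet> c"
    by (rule y)+
  have 3: "0 \<le> d \<bullet> d" "0 \<le> e \<bullet> e" "0 \<le> c \<bullet> c" by auto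
  have A: "(1/2) * (x \<bullet> x) - 21 * D\<^sup>2 \<le> (1/2) * (x \<bullet> x) - (1/24) * (d \<bullet> d) - (5/12) * (d \<bullet> e) - (5/24) * (e \<bullet> e)"
    using 1 2 3 by linarith
  have B: "(1/2) * (x \<bullet> x) - 21 * D\<^sup>2 \<le> (1/2) * (x \<bullet> x) - (1/24) * (d \<bullet> d) - (1/24) * (d \<bullet> e) + (1/6) * (e \<bullet> e)
           - (3/8) * (d \<bullet> c) - (3/8) * (e \<bullet> c) - (3/16) * (c \<bullet> c)"
    using 1 2 3 by linarith
  show ?thesis
    unfolding ab_energy_def Let_def x_d_e_c_def[symmetric] power2_norm_eq_inner
    using A B by (cases "\<nu> = 3") (simp_all only: if_True if_False refl)
qed

lemma ab_coeff_bounds: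
  assumes "\<nu> \<in> {3, 4}"
  shows "ab_coeff \<nu> 0 = 0" "(\<Sum>j\<in>{1..\<nu>}. \<bar>ab_coeff \<nu> j\<bar>) \<le> 7" "(\<Sum>j\<in>{1..\<nu>}. (ab_coeff \<nu> j)\<^sup>2) \<le> 14"
proof -
  have "\<nu> = 3 \<or> \<nu> = 4" using assms by auto
  then show "ab_coeff \<nu> 0 = 0" "(\<Sum>j\<in>{1..\<nu>}. \<bar>ab_coeff \<nu> j\<bar>) \<le> 7" "(\<Sum>j\<in>{1..\<nu>}. (ab_coeff \<nu> j)\<^sup>2) \<le> 14"
    by (auto simp: ab_coeff_def numeral_eq_Suc power2_eq_square)
qed

lemma abm_from_1:
  assumes "\<nu> \<in> {3, 4}"
  shows "abm \<nu> f n = (\<Sum>j\<in>{1..\<nu>}. ab_coeff \<nu> j *\<^sub>R f (n - j))"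
proof -
  have "{..\<nu>} = insert 0 {1..\<nu>}" by auto
  then show ?thesis unfolding abm_def using ab_coeff_bounds(1)[OF assms] by simp
qed

lemma norm_abm_le:
  fixes f :: "nat \<Rightarrow> 'a::real_normed_vector"
  assumes "\<nu> \<in> {3, 4}"
  shows "norm (abm \<nu> f n) \<le> (\<Sum>j\<in>{1..\<nu>}. \<bar>ab_coeff \<nu> j\<bar> * norm (f (n - j)))"
  unfolding abm_from_1[OF assms] by (rule sum_norm_le) simp

lemma norm_abm_le_max:
  fixes f :: "nat \<Rightarrow> 'a::real_normed_vector"
  assumes "\<nu> \<in> {3, 4}" and M: "\<And>j. 1 \<le> j \<Longrightarrow> j \<le> \<nu> \<Longrightarrow> norm (f (n - j)) \<le> M"
  shows "norm (abm \<nu> f n) \<le> 7 * M"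
proof -
  have M0: "0 \<le> M" using order_trans[OF norm_ge_zero M[of 1]] assms(1) by auto
  have "norm (abm \<nu> f n) \<le> (\<Sum>j\<in>{1..\<nu>}. \<bar>ab_coeff \<nu> j\<bar> * M)"
    by (rule order_trans[OF norm_abm_le[OF assms(1)]]) (intro sum_mono mult_left_mono M, auto)
  also have "\<dots> \<le> 7 * M"
    unfolding sum_distrib_right[symmetric] by (rule mult_right_mono[OF ab_coeff_bounds(2)[OF assms(1)] M0])
  finally show ?thesis .
qed

lemma norm_abm_sq_le:
  fixes f :: "nat \<Rightarrow> 'a::real_normed_vector"
  assumes "\<nu> \<in> {3, 4}"
  shows "(norm (abm \<nu> f n))\<^sup>2 \<le> 14 * (\<Sum>j\<in>{1..\<nu>}. (norm (f (n - j)))\<^sup>2)"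
proof -
  have "(norm (abm \<nu> f n))\<^sup>2 \<le> (\<Sum>j\<in>{1..\<nu>}. \<bar>ab_coeff \<nu> j\<bar> * norm (f (n - j)))\<^sup>2"
    by (intro power_mono norm_abm_le[OF assms]) auto
  also have "\<dots> \<le> (\<Sum>j\<in>{1..\<nu>}. \<bar>ab_coeff \<nu> j\<bar>\<^sup>2) * (\<Sum>j\<in>{1..\<nu>}. (norm (f (n - j)))\<^sup>2)"
    by (rule Cauchy_Schwarz_ineq_sum)
  also have "\<dots> \<le> 14 * (\<Sum>j\<in>{1..\<nu>}. (norm (f (n - j)))\<^sup>2)"
    using ab_coeff_bounds(3)[OF assms] by (intro mult_right_mono) (auto intro: sum_nonneg)
  finally show ?thesis .
qed

lemma sum_lag_le:
  fixes a :: "nat \<Rightarrow> real"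
  assumes "1 \<le> j" "j \<le> \<nu>" "\<And>k. 0 \<le> a k"
  shows "(\<Sum>n\<in>{\<nu>..m}. a (n - j)) \<le> (\<Sum>k<m. a k)"
proof -
  have "(\<Sum>n\<in>{\<nu>..m}. a (n - j)) = sum a ((\<lambda>n. n - j) ` {\<nu>..m})"
    using assms by (subst sum.reindex) (auto simp: inj_on_def)
  also have "\<dots> \<le> (\<Sum>k<m. a k)" using assms by (intro sum_mono2) auto
  finally show ?thesis .
qed

lemma sum_abm_sq_le:
  fixes f :: "nat \<Rightarrow> 'a::real_normed_vector"
  assumes "\<nu> \<in> {3, 4}"
  shows "(\<Sum>n\<in>{\<nu>..m}. (norm (abm \<nu> f n))\<^sup>2) \<le> 56 * (\<Sum>k<m. (norm (f k))\<^sup>2)"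
proof -
  have "(\<Sum>n\<in>{\<nu>..m}. (norm (abm \<nu> f n))\<^sup>2) \<le> (\<Sum>n\<in>{\<nu>..m}. 14 * (\<Sum>j\<in>{1..\<nu>}. (norm (f (n - j)))\<^sup>2))"
    by (intro sum_mono norm_abm_sq_le assms)
  also have "\<dots> = 14 * (\<Sum>j\<in>{1..\<nu>}. \<Sum>n\<in>{\<nu>..m}. (norm (f (n - j)))\<^sup>2)"
    unfolding sum_distrib_left[symmetric] by (simp only: sum.swap[of _ "{1..\<nu>}"])
  also have "\<dots> \<le> 14 * (\<Sum>j\<in>{1..\<nu>}. \<Sum>k<m. (norm (f k))\<^sup>2)"
    by (intro mult_left_mono sum_mono sum_lag_le) auto
  also have "\<dots> = 14 * (real \<nu> * (\<Sum>k<m. (norm (f k))\<^sup>2))" by simp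
  also have "\<dots> \<le> 14 * (4 * (\<Sum>k<m. (norm (f k))\<^sup>2))"
    using assms by (intro mult_left_mono mult_right_mono) (auto intro: sum_nonneg)
  finally show ?thesis by simp
qed

lemma sq_add_le: "(a + b)\<^sup>2 \<le> 2 * a\<^sup>2 + 2 * (b::real)\<^sup>2"
  using zero_le_power2[of "a - b"] by (simp add: power2_eq_square algebra_simps)

lemma bdiff_pow_zero:
  assumes "\<And>j. j < \<nu> \<Longrightarrow> f j = 0" "j < \<nu>"
  shows "(bdiff ^^ q) f j = 0"
  using assms(2) by (induction q arbitrary: j) (auto simp: assms(1) bdiff_def)

lemma sum_start:
  fixes f :: "nat \<Rightarrow> 'a::real_normed_vector"
  assumes "\<And>j. j < \<nu> \<Longrightarrow> f j = 0"
  shows "(\<Sum>k<m. (norm (f k))\<^sup>2) \<le> (\<Sum>n\<in>{\<nu>..m}. (norm (f n))\<^sup>2)"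
proof -
  have "(\<Sum>k<m. (norm (f k))\<^sup>2) = (\<Sum>k\<in>{\<nu>..<m}. (norm (f k))\<^sup>2)"
    by (rule sum.mono_neutral_right) (auto simp: assms)
  also have "\<dots> \<le> (\<Sum>n\<in>{\<nu>..m}. (norm (f n))\<^sup>2)" by (intro sum_mono2) auto
  finally show ?thesis .
qed

lemma sum_bdiff_sq_le:
  fixes f :: "nat \<Rightarrow> 'a::real_normed_vector"
  assumes z: "\<And>j. j < \<nu> \<Longrightarrow> f j = 0" and "1 \<le> \<nu>"
  shows "(\<Sum>n\<in>{\<nu>..m}. (norm ((bdiff ^^ q) f n))\<^sup>2) \<le> 4 ^ q * (\<Sum>n\<in>{\<nu>..m}. (norm (f n))\<^sup>2)"
proof (induction q)
  case (Suc q)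
  let ?g = "(bdiff ^^ q) f"
  have "(norm (bdiff ?g n))\<^sup>2 \<le> 2 * (norm (?g n))\<^sup>2 + 2 * (norm (?g (n - 1)))\<^sup>2" for n
    unfolding bdiff_def by (rule order_trans[OF power_mono[OF norm_triangle_ineq4] sq_add_le]) simp
  then have "(\<Sum>n\<in>{\<nu>..m}. (norm (bdiff ?g n))\<^sup>2) \<le> (\<Sum>n\<in>{\<nu>..m}. 2 * (norm (?g n))\<^sup>2 + 2 * (norm (?g (n - 1)))\<^sup>2)"
    by (intro sum_mono)
  also have "\<dots> = 2 * (\<Sum>n\<in>{\<nu>..m}. (norm (?g n))\<^sup>2) + 2 * (\<Sum>n\<in>{\<nu>..m}. (norm (?g (n - 1)))\<^sup>2)"
    by (simp add: sum.distrib sum_distrib_left)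
  also have "(\<Sum>n\<in>{\<nu>..m}. (norm (?g (n - 1)))\<^sup>2) \<le> (\<Sum>n\<in>{\<nu>..m}. (norm (?g n))\<^sup>2)"
    by (rule order_trans[OF sum_lag_le sum_start]) (use assms in \<open>auto simp: bdiff_pow_zero[OF z]\<close>)
  finally show ?case using Suc by simp
qed simp

section \<open>Stability of the multistep recursion\<close>

text \<open>
  Stability for any recursion whose increments are small compared with its Adams--Bashforth means,
  at every difference order and up to a remainder \<open>R\<close>. Summing \<open>ab_dissipation\<close> leaves two
  obstacles. The bad dissipation term is absorbed by the good one, because \<open>step\<close> at order \<open>\<nu> - 1\<close> bounds a
  difference of order \<open>\<nu>\<close> by \<open>\<kappa>\<close> times differences of order \<open>\<nu> - 1\<close>. The
  energy at the final index \<open>m\<close> is only bounded below up to increments; these are at most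
  \<open>7 \<kappa>\<close> times the largest norm, which is attained at \<open>m\<close>, and \<open>\<kappa> \<le> 1/100\<close> makes
  \<open>21 \<cdot> 98 \<kappa>\<^sup>2\<close> smaller than \<open>1/4\<close>.
\<close>

lemma ab_stability:
  fixes X :: "nat \<Rightarrow> 'a::real_inner" and R :: "nat \<Rightarrow> 'b::real_normed_vector"
  assumes \<nu>: "\<nu> \<in> {3, 4}"
    and X0: "\<And>j. j < \<nu> \<Longrightarrow> X j = 0" and R0: "\<And>j. j < \<nu> \<Longrightarrow> R j = 0"
    and step: "\<And>q n. n \<le> m \<Longrightarrow>
      norm ((bdiff ^^ Suc q) X n) \<le> \<kappa> * norm (abm \<nu> ((bdiff ^^ q) X) n) + \<sigma> * norm ((bdiff ^^ q) R n)"
    and \<kappa>: "0 \<le> \<kappa>" "\<kappa> \<le> 1/100" and \<sigma>: "0 \<le> \<sigma>"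
    and max: "\<And>n. n \<le> m \<Longrightarrow> norm (X n) \<le> norm (X m)" and m: "\<nu> \<le> m"
  shows "(1/4) * (norm (X m))\<^sup>2
    \<le> (\<Sum>n\<in>{\<nu>..m}. bdiff X n \<bullet> abm \<nu> X n) + 70 * \<sigma>\<^sup>2 * (\<Sum>n\<in>{\<nu>..m}. (norm (R n))\<^sup>2)"
proof -
  define S where "S q = (\<Sum>n\<in>{\<nu>..m}. (norm ((bdiff ^^ q) X n))\<^sup>2)" for q
  define Q where "Q = (\<Sum>n\<in>{\<nu>..m}. (norm (R n))\<^sup>2)"
  have \<nu>1: "1 \<le> \<nu>" and \<nu>s: "Suc (\<nu> - 1) = \<nu>" using \<nu> by auto
  have Q0: "0 \<le> Q" unfolding Q_def by (intro sum_nonneg) auto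
  have S0: "0 \<le> S q" for q unfolding S_def by (intro sum_nonneg) auto
  have \<kappa>2: "\<kappa>\<^sup>2 \<le> 1/10000" using power_mono[OF \<kappa>(2) \<kappa>(1), of 2] by (simp add: power2_eq_square)
  have two: "(\<kappa> * a + \<sigma> * b)\<^sup>2 \<le> 2 * \<kappa>\<^sup>2 * a\<^sup>2 + 2 * \<sigma>\<^sup>2 * b\<^sup>2" for a b
    using sq_add_le[of "\<kappa> * a" "\<sigma> * b"] by (simp add: power_mult_distrib)

  have "S \<nu> \<le> (\<Sum>n\<in>{\<nu>..m}. 2 * \<kappa>\<^sup>2 * (norm (abm \<nu> ((bdiff ^^ (\<nu>-1)) X) n))\<^sup>2 + 2 * \<sigma>\<^sup>2 * (norm ((bdiff ^^ (\<nu>-1)) R n))\<^sup>2)"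
    unfolding S_def
  proof (intro sum_mono)
    fix n assume "n \<in> {\<nu>..m}"
    then have "norm ((bdiff ^^ \<nu>) X n) \<le> \<kappa> * norm (abm \<nu> ((bdiff ^^ (\<nu>-1)) X) n) + \<sigma> * norm ((bdiff ^^ (\<nu>-1)) R n)"
      using step[of n "\<nu> - 1"] unfolding \<nu>s by simp
    then have "(norm ((bdiff ^^ \<nu>) X n))\<^sup>2 \<le> (\<kappa> * norm (abm \<nu> ((bdiff ^^ (\<nu>-1)) X) n) + \<sigma> * norm ((bdiff ^^ (\<nu>-1)) R n))\<^sup>2"
      by (intro power_mono) auto
    then show "(norm ((bdiff ^^ \<nu>) X n))\<^sup>2 \<le> 2 * \<kappa>\<^sup>2 * (norm (abm \<nu> ((bdiff ^^ (\<nu>-1)) X) n))\<^sup>2 + 2 * \<sigma>\<^sup>2 * (norm ((bdiff ^^ (\<nu>-1)) R n))\<^sup>2"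
      by (rule order_trans[OF _ two])
  qed
  also have "\<dots> = 2 * \<kappa>\<^sup>2 * (\<Sum>n\<in>{\<nu>..m}. (norm (abm \<nu> ((bdiff ^^ (\<nu>-1)) X) n))\<^sup>2) + 2 * \<sigma>\<^sup>2 * (\<Sum>n\<in>{\<nu>..m}. (norm ((bdiff ^^ (\<nu>-1)) R n))\<^sup>2)"
    by (simp add: sum.distrib sum_distrib_left)
  also have "\<dots> \<le> 2 * \<kappa>\<^sup>2 * (56 * S (\<nu>-1)) + 2 * \<sigma>\<^sup>2 * (64 * Q)"
  proof (intro add_mono mult_left_mono)
    show "(\<Sum>n\<in>{\<nu>..m}. (norm (abm \<nu> ((bdiff ^^ (\<nu>-1)) X) n))\<^sup>2) \<le> 56 * S (\<nu>-1)"
      unfolding S_def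
      by (rule order_trans[OF sum_abm_sq_le[OF \<nu>]], intro mult_left_mono sum_start) (auto simp: bdiff_pow_zero[OF X0])
    have "4 ^ (\<nu> - 1) * Q \<le> 64 * Q" using \<nu> Q0 by (intro mult_right_mono) auto
    with sum_bdiff_sq_le[where f=R and \<nu>=\<nu> and q="\<nu>-1" and m=m, OF R0 \<nu>1]
    show "(\<Sum>n\<in>{\<nu>..m}. (norm ((bdiff ^^ (\<nu>-1)) R n))\<^sup>2) \<le> 64 * Q"
      unfolding Q_def by linarith
  qed auto
  finally have S\<nu>: "S \<nu> \<le> 112 * \<kappa>\<^sup>2 * S (\<nu>-1) + 128 * \<sigma>\<^sup>2 * Q" by simp
  have "112 * \<kappa>\<^sup>2 * S (\<nu>-1) \<le> 1 * S (\<nu>-1)" using \<kappa>2 S0 by (intro mult_right_mono) auto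
  with S\<nu> have S\<nu>': "(5/24) * S \<nu> \<le> (3/8) * S (\<nu>-1) + (80/3) * \<sigma>\<^sup>2 * Q" using S0[of "\<nu>-1"] by linarith

  \<comment> \<open>A common bound for all increments up to index \<open>m\<close>, as required by \<open>ab_energy_lower\<close>.\<close>
  define D where "D = 7 * \<kappa> * norm (X m) + \<sigma> * sqrt Q"
  have D: "norm (bdiff X n) \<le> D" if n: "n \<le> m" for n
  proof -
    have "norm (abm \<nu> X n) \<le> 7 * norm (X m)" using n by (intro norm_abm_le_max \<nu> max) auto
    then have 1: "\<kappa> * norm (abm \<nu> X n) \<le> 7 * \<kappa> * norm (X m)" using mult_left_mono[OF _ \<kappa>(1)] by fastforce
    have "norm (R n) \<le> sqrt Q"
    proof (cases "n < \<nu>")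
      case False
      then have "(norm (R n))\<^sup>2 \<le> Q" unfolding Q_def using n by (intro member_le_sum) auto
      then show ?thesis by (simp add: real_le_rsqrt)
    qed (simp add: R0 Q0)
    then have "\<sigma> * norm (R n) \<le> \<sigma> * sqrt Q" using \<sigma> by (rule mult_left_mono)
    with 1 step[OF n, of 0] show ?thesis unfolding D_def by simp
  qed
  have "D\<^sup>2 \<le> 98 * \<kappa>\<^sup>2 * (norm (X m))\<^sup>2 + 2 * \<sigma>\<^sup>2 * Q"
    unfolding D_def by (rule order_trans[OF sq_add_le]) (simp add: power_mult_distrib Q0)
  moreover have "2058 * \<kappa>\<^sup>2 * (norm (X m))\<^sup>2 \<le> (1/4) * (norm (X m))\<^sup>2" using \<kappa>2 by (intro mult_right_mono) auto
  ultimately have D2: "21 * D\<^sup>2 \<le> (1/4) * (norm (X m))\<^sup>2 + 42 * \<sigma>\<^sup>2 * Q" by linarith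

  have E: "(1/2) * (norm (X m))\<^sup>2 - 21 * D\<^sup>2 \<le> ab_energy \<nu> X m"
    by (rule ab_energy_lower) (simp add: D)
  have E0: "ab_energy \<nu> X (\<nu> - 1) = 0"
    using bdiff_pow_zero[where f=X and \<nu>=\<nu> and j="\<nu>-1", OF X0]
      bdiff_pow_zero[where f=X and \<nu>=\<nu> and j="\<nu>-1" and q=1, OF X0] X0[of "\<nu> - 1"] \<nu>1
    by (simp add: ab_energy_def Let_def)
  have tel: "(\<Sum>n\<in>{\<nu>..m}. ab_energy \<nu> X n - ab_energy \<nu> X (n - 1)) = ab_energy \<nu> X m - ab_energy \<nu> X (\<nu> - 1)"
    using m
  proof (induction m rule: dec_induct)
    case (step k) then show ?case using \<nu>1 by (simp add: atLeastAtMostSuc_conv)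
  qed simp
  have "ab_energy \<nu> X m + (3/8) * S (\<nu>-1) - (5/24) * S \<nu>
     = (\<Sum>n\<in>{\<nu>..m}. ab_energy \<nu> X n - ab_energy \<nu> X (n - 1)
    + (3/8) * (norm ((bdiff ^^ (\<nu> - 1)) X n))\<^sup>2 - (5/24) * (norm ((bdiff ^^ \<nu>) X n))\<^sup>2)"
    unfolding sum_subtractf sum.distrib using tel E0
    by (simp add: S_def sum_distrib_left sum_subtractf)
  also have "\<dots> \<le> (\<Sum>n\<in>{\<nu>..m}. bdiff X n \<bullet> abm \<nu> X n)"
    by (intro sum_mono ab_dissipation \<nu>)
  finally show ?thesis using S\<nu>' D2 E mult_nonneg_nonneg[OF zero_le_power2[of \<sigma>] Q0] unfolding Q_def[symmetric] by linarith
qed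

section \<open>Galerkin setting for a skew operator\<close>

lemma bdiff_pow_Suc: "(bdiff ^^ Suc q) f n = (bdiff ^^ q) f n - (bdiff ^^ q) f (n - 1)"
  by (simp add: bdiff_def)

text \<open>
  \<open>H\<close> plays the role of the ambient Hilbert space, which need not be the whole type, \<open>V\<close> that of the
  domain of \<open>G\<close>, and \<open>Vh\<close> that of the discrete space. Linearity of \<open>G\<close> on \<open>V\<close> follows from
  skewness, since \<open>V\<close> is dense.
\<close>

locale skew_galerkin =
  fixes H V Vh :: "'a::real_inner set" and G :: "'a \<Rightarrow> 'a"
  assumes subspace_H: "subspace H" and subspace_V: "subspace V" and V_H: "V \<subseteq> H"
    and G_H: "\<And>v. v \<in> V \<Longrightarrow> G v \<in> H"
    and skew: "\<And>u v. u \<in> V \<Longrightarrow> v \<in> V \<Longrightarrow> G u \<bullet> v = - (u \<bullet> G v)"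
    and dense: "\<And>x e. x \<in> H \<Longrightarrow> 0 < e \<Longrightarrow> \<exists>v\<in>V. norm (x - v) < e"
    and subspace_Vh: "subspace Vh" and Vh_V: "Vh \<subseteq> V"
    and ex_proj: "\<And>x. \<exists>p\<in>Vh. \<forall>w\<in>Vh. (x - p) \<bullet> w = 0"
begin

abbreviation proj_error_le :: "'a \<Rightarrow> real \<Rightarrow> real \<Rightarrow> bool" where
  "proj_error_le x A B \<equiv> \<forall>p\<in>Vh. (\<forall>w\<in>Vh. (x - p) \<bullet> w = 0) \<longrightarrow> norm (x - p) \<le> A \<and> norm (G (x - p)) \<le> B"

lemma Vh_in_V: "w \<in> Vh \<Longrightarrow> w \<in> V" using Vh_V by auto
lemma V_in_H: "v \<in> V \<Longrightarrow> v \<in> H" using V_H by auto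

lemma norm_le_by_duality:
  assumes x: "x \<in> H" and M: "\<And>v. v \<in> V \<Longrightarrow> \<bar>x \<bullet> v\<bar> \<le> M * norm v" and M0: "0 \<le> M"
  shows "norm x \<le> M"
proof (cases "norm x = 0")
  case False
  have "norm x * norm x \<le> M * norm x + e" if e: "0 < e" for e
  proof -
    define e' where "e' = e / (M + norm x)"
    have p: "0 < M + norm x" using M0 False by (simp add: add_nonneg_pos)
    then have "0 < e'" unfolding e'_def using e by simp
    then obtain v where v: "v \<in> V" "norm (x - v) < e'" using dense[OF x] by blast
    have nv: "norm v \<le> norm x + e'" using v norm_triangle_ineq4[of x "x - v"] by simp
    have "norm x * norm x = x \<bullet> v + x \<bullet> (x - v)"
      by (simp add: inner_diff_right norm_eq_sqrt_inner)
    also have "\<dots> \<le> M * norm v + norm x * norm (x - v)"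
      using M[OF v(1)] norm_cauchy_schwarz[of x "x - v"] by linarith
    also have "\<dots> \<le> M * (norm x + e') + norm x * e'"
      using nv v(2) M0 by (intro add_mono mult_left_mono) auto
    also have "\<dots> = M * norm x + e' * (M + norm x)" by (simp add: algebra_simps)
    also have "\<dots> = M * norm x + e" unfolding e'_def using p by simp
    finally show ?thesis .
  qed
  then have "norm x * norm x \<le> M * norm x" by (rule field_le_epsilon)
  then show ?thesis using False by simp
qed (use M0 in simp)

lemma eq_0_by_duality: "x \<in> H \<Longrightarrow> (\<And>v. v \<in> V \<Longrightarrow> x \<bullet> v = 0) \<Longrightarrow> x = 0"
  using norm_le_by_duality[of x 0] by simp

lemma G_add: assumes "u \<in> V" "v \<in> V" shows "G (u + v) = G u + G v"
proof -
  note [simp] = assms subspace_add[OF subspace_V assms]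
  have "G (u + v) - (G u + G v) = 0"
  proof (rule eq_0_by_duality)
    show "G (u + v) - (G u + G v) \<in> H"
      by (intro subspace_diff[OF subspace_H] subspace_add[OF subspace_H] G_H) simp_all
    show "(G (u + v) - (G u + G v)) \<bullet> w = 0" if "w \<in> V" for w
      using that by (simp add: inner_diff_left inner_add_left skew)
  qed
  then show ?thesis by simp
qed

lemma G_scale: assumes "u \<in> V" shows "G (a *\<^sub>R u) = a *\<^sub>R G u"
proof -
  note [simp] = assms subspace_scale[OF subspace_V assms]
  have "G (a *\<^sub>R u) - a *\<^sub>R G u = 0"
  proof (rule eq_0_by_duality)
    show "G (a *\<^sub>R u) - a *\<^sub>R G u \<in> H"
      by (intro subspace_diff[OF subspace_H] subspace_scale[OF subspace_H] G_H) simp_all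
    show "(G (a *\<^sub>R u) - a *\<^sub>R G u) \<bullet> w = 0" if "w \<in> V" for w
      using that by (simp add: inner_diff_left skew)
  qed
  then show ?thesis by simp
qed

lemma G_0: "G 0 = 0"
  using G_scale[OF subspace_0[OF subspace_V], of 0] by simp

lemma G_diff: assumes "u \<in> V" "v \<in> V" shows "G (u - v) = G u - G v"
  using G_add[OF assms(1) subspace_scale[OF subspace_V assms(2), of "-1"]] G_scale[OF assms(2), of "-1"]
  by simp

lemma skew_self: "u \<in> V \<Longrightarrow> G u \<bullet> u = 0"
  using skew[of u u] by (simp add: inner_commute)

lemma bdiff_in: "subspace S \<Longrightarrow> (\<And>n. f n \<in> S) \<Longrightarrow> bdiff f n \<in> S"
  by (simp add: bdiff_def subspace_diff)

lemma bdiff_pow_in: "subspace S \<Longrightarrow> (\<And>n. f n \<in> S) \<Longrightarrow> (bdiff ^^ q) f n \<in> S"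
  by (induction q arbitrary: n) (auto intro: bdiff_in)

lemma abm_in: "subspace S \<Longrightarrow> (\<And>n. f n \<in> S) \<Longrightarrow> abm \<nu> f n \<in> S"
  unfolding abm_def by (intro subspace_sum subspace_scale) auto

lemma G_sum:
  assumes "finite I" "\<And>i. i \<in> I \<Longrightarrow> f i \<in> V"
  shows "G (\<Sum>i\<in>I. f i) = (\<Sum>i\<in>I. G (f i))"
  using assms
proof (induction I rule: finite_induct)
  case (insert i I)
  then show ?case using G_add[of "f i" "\<Sum>i\<in>I. f i"] subspace_sum[OF subspace_V, of I f] by simp
qed (simp add: G_0)

lemma G_abm: "(\<And>n. f n \<in> V) \<Longrightarrow> G (abm \<nu> f n) = abm \<nu> (\<lambda>k. G (f k)) n"
  unfolding abm_def by (subst G_sum) (auto simp: G_scale subspace_scale[OF subspace_V])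

lemma G_bdiff_pow: "(\<And>n. f n \<in> V) \<Longrightarrow> G ((bdiff ^^ q) f n) = (bdiff ^^ q) (\<lambda>k. G (f k)) n"
proof (induction q arbitrary: n)
  case (Suc q)
  then show ?case unfolding bdiff_pow_Suc
    using G_diff[OF bdiff_pow_in[OF subspace_V] bdiff_pow_in[OF subspace_V], of f f q n q "n - 1"]
    by simp
qed simp

end

lemma abm_bdiff_commute: "abm \<nu> (bdiff f) n = abm \<nu> f n - abm \<nu> f (n - 1)"
  unfolding abm_def bdiff_def sum_subtractf[symmetric]
  by (intro sum.cong) (auto simp: scaleR_diff_right diff_commute)

lemma abm_Pair: "abm \<nu> (\<lambda>k. (f k, a *\<^sub>R g k)) n = (abm \<nu> f n, a *\<^sub>R abm \<nu> g n)"
  unfolding abm_def by (simp add: scaleR_sum_right sum_prod[symmetric] mult.commute)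

lemma bdiff_pow_Pair:
  fixes f g :: "nat \<Rightarrow> 'a::real_vector"
  shows "(bdiff ^^ q) (\<lambda>k. (f k, a *\<^sub>R g k)) n = ((bdiff ^^ q) f n, a *\<^sub>R (bdiff ^^ q) g n)"
  by (induction q arbitrary: n) (simp_all only: bdiff_pow_Suc, simp_all add: scaleR_diff_right)

lemma sum_by_parts:
  fixes a b :: "nat \<Rightarrow> 'a::real_inner"
  assumes "b (\<nu> - 1) = 0" "\<nu> \<le> m"
  shows "(\<Sum>n\<in>{\<nu>..m}. a n \<bullet> bdiff b n) = a m \<bullet> b m - (\<Sum>n\<in>{\<nu>..<m}. (a (Suc n) - a n) \<bullet> b n)"
  using assms(2)
proof (induction m rule: dec_induct)
  case base then show ?case using assms(1) by (simp add: bdiff_def)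
next
  case (step k)
  then show ?case by (simp add: atLeastAtMostSuc_conv atLeastLessThanSuc bdiff_def inner_diff_left inner_diff_right)
qed

lemma sum_le_sqrt_card:
  fixes y :: "nat \<Rightarrow> real"
  assumes "finite A" "card A \<le> N" "\<And>k. k \<in> A \<Longrightarrow> 0 \<le> y k" "real N * \<tau> \<le> T" "0 < \<tau>"
    and "(\<Sum>k\<in>A. (y k)\<^sup>2) \<le> \<tau> * d\<^sup>2" "0 \<le> d"
  shows "(\<Sum>k\<in>A. y k) \<le> sqrt T * d"
proof -
  have "(\<Sum>k\<in>A. y k)\<^sup>2 \<le> real (card A) * (\<Sum>k\<in>A. (y k)\<^sup>2)"
    using Cauchy_Schwarz_ineq_sum[of "\<lambda>_. 1" y A] by simp
  also have "\<dots> \<le> real N * (\<tau> * d\<^sup>2)"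
    using assms by (intro mult_mono) (auto intro: sum_nonneg)
  also have "\<dots> \<le> T * d\<^sup>2" using mult_right_mono[OF assms(4), of "d\<^sup>2"] by (simp add: mult.assoc)
  finally have "(\<Sum>k\<in>A. y k) \<le> sqrt (T * d\<^sup>2)" by (rule real_le_rsqrt)
  then show ?thesis using assms(7) by (simp add: real_sqrt_mult)
qed

section \<open>Energy estimate for the stabilized scheme\<close>

text \<open>
  The error equation. \<open>\<theta>\<close> is the discrete error, \<open>\<eta>\<close> the projection error and \<open>\<rho>\<close> the
  consistency error of the time discretization. Orthogonality of \<open>\<eta>\<close> to \<open>Vh\<close> will be
  essential: it removes terms that the dissipation of the scheme does not control. \<open>K\<close> bounds
  \<open>\<delta> G\<close> on \<open>Vh\<close>; passing to the energy norm and testing cost one factor \<open>1 + K\<close> each, which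
  the restriction of the time step has to pay for.
\<close>

locale stabilized_ab = skew_galerkin H V Vh G for H V Vh :: "'a::real_inner set" and G +
  fixes \<nu> N :: nat and \<tau> \<delta> K :: real and \<theta> \<eta> \<rho> :: "nat \<Rightarrow> 'a"
  assumes \<nu>: "\<nu> \<in> {3, 4}" and \<tau>: "0 < \<tau>" and \<delta>: "0 < \<delta>" and K: "0 \<le> K"
    and inverse: "\<And>W. W \<in> Vh \<Longrightarrow> \<delta> * norm (G W) \<le> K * norm W"
    and cfl: "\<And>W. W \<in> Vh \<Longrightarrow> \<tau> * (1 + K)\<^sup>2 * norm (G W) \<le> 1/100 * norm W"
    and \<theta>: "\<And>n. \<theta> n \<in> Vh" and \<theta>0: "\<And>j. j < \<nu> \<Longrightarrow> \<theta> j = 0"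
    and \<eta>: "\<And>n. \<eta> n \<in> V" and \<eta>_orth: "\<And>n W. W \<in> Vh \<Longrightarrow> \<eta> n \<bullet> W = 0"
    and scheme: "\<And>n W. \<nu> \<le> n \<Longrightarrow> n \<le> N \<Longrightarrow> W \<in> Vh \<Longrightarrow>
      ((1/\<tau>) *\<^sub>R bdiff \<theta> n + G (abm \<nu> \<theta> n)) \<bullet> (W + \<delta> *\<^sub>R G W) =
      (\<rho> n + (1/\<tau>) *\<^sub>R bdiff \<eta> n + G (abm \<nu> \<eta> n)) \<bullet> (W + \<delta> *\<^sub>R G W)"
begin

definition residual :: "nat \<Rightarrow> 'a" where
  "residual n = (if n < \<nu> then 0 else \<rho> n + (1/\<tau>) *\<^sub>R bdiff \<eta> n + G (abm \<nu> \<eta> n))"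

text \<open>
  Its norm is that of \<open>\<theta> n + \<delta> G (\<theta> n)\<close>, as \<open>G\<close> is skew. The inner product of
  such pairs is the one in which the stabilized scheme dissipates energy.
\<close>

definition X :: "nat \<Rightarrow> 'a \<times> 'a" where "X n = (\<theta> n, \<delta> *\<^sub>R G (\<theta> n))"

lemma \<theta>V: "\<theta> n \<in> V" using \<theta> Vh_V by auto

text \<open>
  Testing with the increment itself: the inverse inequality turns the scheme into an explicit
  recursion with a small amplification factor.
\<close>

lemma one_step:
  assumes d: "d \<in> Vh" and m: "m \<in> Vh"
    and eq: "\<And>W. W \<in> Vh \<Longrightarrow> ((1/\<tau>) *\<^sub>R d + G m - r) \<bullet> (W + \<delta> *\<^sub>R G W) = 0"
  shows "norm d \<le> \<tau> * (1 + K) * (norm (G m) + norm r)"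
proof (cases "norm d = 0")
  case False
  have "(1/\<tau>) * (d \<bullet> (d + \<delta> *\<^sub>R G d)) = (r - G m) \<bullet> (d + \<delta> *\<^sub>R G d)"
    using eq[OF d] by (simp add: inner_diff_left inner_add_left)
  moreover have "d \<bullet> (d + \<delta> *\<^sub>R G d) = norm d * norm d"
    using skew_self[OF Vh_in_V[OF d]] by (simp add: inner_add_right inner_commute norm_eq_sqrt_inner)
  ultimately have "(1/\<tau>) * (norm d * norm d) \<le> norm (r - G m) * norm (d + \<delta> *\<^sub>R G d)"
    using norm_cauchy_schwarz[of "r - G m" "d + \<delta> *\<^sub>R G d"] by simp
  also have "\<dots> \<le> (norm (G m) + norm r) * ((1 + K) * norm d)"
  proof (rule mult_mono)
    show "norm (r - G m) \<le> norm (G m) + norm r" using norm_triangle_ineq4[of r "G m"] by simp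
    show "norm (d + \<delta> *\<^sub>R G d) \<le> (1 + K) * norm d"
      using norm_triangle_ineq[of d "\<delta> *\<^sub>R G d"] inverse[OF d] \<delta> by (simp add: algebra_simps)
  qed auto
  finally have "norm d * norm d \<le> (\<tau> * (1 + K) * (norm (G m) + norm r)) * norm d"
    using \<tau> by (simp add: field_simps)
  then show ?thesis using False by simp
qed (use \<tau> K in simp)

lemma one_step_energy:
  assumes d: "d \<in> Vh" and m: "m \<in> Vh"
    and eq: "\<And>W. W \<in> Vh \<Longrightarrow> ((1/\<tau>) *\<^sub>R d + G m - r) \<bullet> (W + \<delta> *\<^sub>R G W) = 0"
  shows "norm (d, \<delta> *\<^sub>R G d) \<le> 1/100 * norm (m, \<delta> *\<^sub>R G m) + \<tau> * (1 + K)\<^sup>2 * norm r"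
proof -
  have "norm (d, \<delta> *\<^sub>R G d) \<le> norm d + norm (\<delta> *\<^sub>R G d)"
    unfolding norm_Pair by (rule sqrt_sum_squares_le_sum) auto
  also have "\<dots> \<le> (1 + K) * norm d" using inverse[OF d] \<delta> by (simp add: algebra_simps)
  also have "\<dots> \<le> (1 + K) * (\<tau> * (1 + K) * (norm (G m) + norm r))"
    using one_step[OF assms] K by (intro mult_left_mono) auto
  also have "\<dots> = \<tau> * (1 + K)\<^sup>2 * norm (G m) + \<tau> * (1 + K)\<^sup>2 * norm r"
    by (simp add: power2_eq_square algebra_simps)
  also have "\<tau> * (1 + K)\<^sup>2 * norm (G m) \<le> 1/100 * norm m" by (rule cfl[OF m])
  also have "1/100 * norm m \<le> 1/100 * norm (m, \<delta> *\<^sub>R G m)"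
    unfolding norm_Pair by (simp add: real_le_rsqrt)
  finally show ?thesis by simp
qed

lemma scheme_from_0:
  assumes "n \<le> N" "W \<in> Vh"
  shows "((1/\<tau>) *\<^sub>R bdiff \<theta> n + G (abm \<nu> \<theta> n) - residual n) \<bullet> (W + \<delta> *\<^sub>R G W) = 0"
proof (cases "n < \<nu>")
  case True
  have "abm \<nu> \<theta> n = 0" unfolding abm_def using True by (intro sum.neutral) (auto simp: \<theta>0)
  moreover have "bdiff \<theta> n = 0" using True by (simp add: bdiff_def \<theta>0)
  ultimately show ?thesis using True by (simp add: residual_def G_0)
next
  case False
  then show ?thesis using scheme[of n W] assms by (simp add: residual_def inner_diff_left)
qed

text \<open>
  The scheme is linear with constant coefficients and holds trivially before index \<open>\<nu>\<close>, where
  everything vanishes; hence it passes to differences of all orders.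
\<close>

lemma scheme_bdiff_pow:
  assumes "n \<le> N" "W \<in> Vh"
  shows "((1/\<tau>) *\<^sub>R (bdiff ^^ Suc q) \<theta> n + G (abm \<nu> ((bdiff ^^ q) \<theta>) n) - (bdiff ^^ q) residual n) \<bullet> (W + \<delta> *\<^sub>R G W) = 0"
  using assms(1)
proof (induction q arbitrary: n)
  case 0 then show ?case using scheme_from_0[OF _ assms(2)] by simp
next
  case (Suc q)
  have V: "abm \<nu> ((bdiff ^^ q) \<theta>) k \<in> V" for k
    by (intro abm_in bdiff_pow_in subspace_V \<theta>V)
  have "(1/\<tau>) *\<^sub>R (bdiff ^^ Suc (Suc q)) \<theta> n + G (abm \<nu> ((bdiff ^^ Suc q) \<theta>) n) - (bdiff ^^ Suc q) residual n
    = ((1/\<tau>) *\<^sub>R (bdiff ^^ Suc q) \<theta> n + G (abm \<nu> ((bdiff ^^ q) \<theta>) n) - (bdiff ^^ q) residual n)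
     - ((1/\<tau>) *\<^sub>R (bdiff ^^ Suc q) \<theta> (n-1) + G (abm \<nu> ((bdiff ^^ q) \<theta>) (n-1)) - (bdiff ^^ q) residual (n-1))"
    using G_diff[OF V[of n] V[of "n-1"]]
    by (simp add: abm_bdiff_commute) (simp add: bdiff_def scaleR_diff_right)
  then show ?case using Suc.IH[of n] Suc.IH[of "n-1"] Suc.prems by (simp only: inner_diff_left)
qed

lemma X_bdiff_pow: "(bdiff ^^ q) X n = ((bdiff ^^ q) \<theta> n, \<delta> *\<^sub>R G ((bdiff ^^ q) \<theta> n))"
  unfolding X_def[abs_def] bdiff_pow_Pair G_bdiff_pow[OF \<theta>V] ..

lemma X_abm: "abm \<nu> ((bdiff ^^ q) X) n = (abm \<nu> ((bdiff ^^ q) \<theta>) n, \<delta> *\<^sub>R G (abm \<nu> ((bdiff ^^ q) \<theta>) n))"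
  unfolding X_bdiff_pow[abs_def] abm_Pair
  by (simp add: G_abm bdiff_pow_in[OF subspace_V] \<theta>V)

lemma X_step:
  assumes "n \<le> N"
  shows "norm ((bdiff ^^ Suc q) X n) \<le> 1/100 * norm (abm \<nu> ((bdiff ^^ q) X) n) + \<tau> * (1 + K)\<^sup>2 * norm ((bdiff ^^ q) residual n)"
  unfolding X_abm X_bdiff_pow
  by (rule one_step_energy[OF _ _ scheme_bdiff_pow[OF assms]])
     (intro abm_in bdiff_pow_in subspace_Vh \<theta>)+

text \<open>
  The energy identity of the method, obtained with the test function \<open>W = m + \<delta> d\<close>. The terms
  \<open>G m \<bullet> m\<close> and \<open>d \<bullet> G d\<close> drop out by skewness. What survives is the increment paired with
  the mean in the energy inner product, and the dissipation \<open>\<delta> (norm (d + G m))\<^sup>2\<close> of the residual that the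
  stabilization provides.
\<close>

lemma energy_identity:
  assumes d: "d \<in> Vh" and m: "m \<in> Vh"
    and eq: "\<And>W. W \<in> Vh \<Longrightarrow> (d + G m - r) \<bullet> (W + \<delta> *\<^sub>R G W) = 0"
  shows "d \<bullet> m + \<delta>\<^sup>2 * (G d \<bullet> G m) + \<delta> * (norm (d + G m))\<^sup>2 = r \<bullet> (m + \<delta> *\<^sub>R (d + G m) + \<delta>\<^sup>2 *\<^sub>R G d)"
proof -
  have W: "m + \<delta> *\<^sub>R d \<in> Vh" by (intro subspace_add subspace_scale subspace_Vh d m)
  have V: "d \<in> V" "m \<in> V" "\<delta> *\<^sub>R d \<in> V"
    using d m Vh_in_V subspace_scale[OF subspace_V] by auto
  have t: "m + \<delta> *\<^sub>R d + \<delta> *\<^sub>R G (m + \<delta> *\<^sub>R d) = m + \<delta> *\<^sub>R (d + G m) + \<delta>\<^sup>2 *\<^sub>R G d"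
    using V by (simp add: G_add G_scale algebra_simps power2_eq_square)
  have "r \<bullet> (m + \<delta> *\<^sub>R (d + G m) + \<delta>\<^sup>2 *\<^sub>R G d) = (d + G m) \<bullet> (m + \<delta> *\<^sub>R (d + G m) + \<delta>\<^sup>2 *\<^sub>R G d)"
    using eq[OF W] unfolding t by (simp add: inner_diff_left)
  also have "\<dots> = d \<bullet> m + \<delta>\<^sup>2 * (G d \<bullet> G m) + \<delta> * (norm (d + G m))\<^sup>2 + (G m \<bullet> m + \<delta>\<^sup>2 * (G d \<bullet> d))"
    unfolding power2_norm_eq_inner by (simp add: inner_add_left inner_add_right inner_commute algebra_simps)
  finally show ?thesis using skew_self V by simp
qed

text \<open>
  The pairing of the residual with the test function, where \<open>e\<close> is the difference quotient and
  \<open>f\<close> the mean of the projection error, and \<open>a\<close> the dissipated quantity. Where \<open>G\<close> acts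
  on \<open>f\<close> without a factor \<open>\<delta>\<close>, it is moved to the discrete side; there
  \<open>G m = a - d\<close> and \<open>f\<close> is orthogonal to \<open>d\<close>, so that only \<open>a\<close> remains. Only the last
  term cannot be bounded index by index without losing a power of \<open>\<delta>\<close>; it is left for summation
  by parts in time.
\<close>

lemma residual_bound:
  assumes d: "d \<in> Vh" and m: "m \<in> Vh"
    and e: "e \<in> V" "\<And>W. W \<in> Vh \<Longrightarrow> e \<bullet> W = 0" and f: "f \<in> V" "\<And>W. W \<in> Vh \<Longrightarrow> f \<bullet> W = 0"
    and a: "a = d + G m" and M: "norm m \<le> M" "\<delta> * norm (G m) \<le> M"
  shows "(p + e + G f) \<bullet> (m + \<delta> *\<^sub>R a + \<delta>\<^sup>2 *\<^sub>R G d)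
    \<le> norm a * (\<delta> * norm e + \<delta>\<^sup>2 * norm (G e) + norm f + \<delta> * norm (G f) + (1 + K) * \<delta> * norm p)
      + (\<delta> * norm (G e) + (1 + K) * norm p) * M + \<delta>\<^sup>2 * (G f \<bullet> G d)"
proof -
  have V: "d \<in> V" "m \<in> V" using d m Vh_in_V by auto
  have 1: "e \<bullet> m = 0" using e m by simp
  have 2: "\<delta> * (e \<bullet> a) \<le> norm a * (\<delta> * norm e)"
    using norm_cauchy_schwarz[of e a] \<delta> by (simp add: mult.assoc mult.left_commute mult.commute)
  have "e \<bullet> G d = - (G e \<bullet> a) + G e \<bullet> G m" using skew[OF e(1) V(1)] a by (simp add: inner_add_right)
  also have "\<dots> \<le> norm (G e) * norm a + norm (G e) * norm (G m)"
    using norm_cauchy_schwarz[of "G e" "- a"] norm_cauchy_schwarz[of "G e" "G m"] by simp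
  finally have "\<delta>\<^sup>2 * (e \<bullet> G d) \<le> \<delta>\<^sup>2 * (norm (G e) * norm a + norm (G e) * norm (G m))"
    by (rule mult_left_mono) simp
  also have "\<dots> = norm a * (\<delta>\<^sup>2 * norm (G e)) + \<delta> * norm (G e) * (\<delta> * norm (G m))"
    by (simp add: power2_eq_square algebra_simps)
  also have "\<dots> \<le> norm a * (\<delta>\<^sup>2 * norm (G e)) + \<delta> * norm (G e) * M"
    using M(2) \<delta> by (intro add_left_mono mult_left_mono) auto
  finally have 3: "\<delta>\<^sup>2 * (e \<bullet> G d) \<le> norm a * (\<delta>\<^sup>2 * norm (G e)) + \<delta> * norm (G e) * M" .
  have "G f \<bullet> m = - (f \<bullet> a)" using skew[OF f(1) V(2)] f(2)[OF d] a by (simp add: inner_add_right)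
  then have 4: "G f \<bullet> m \<le> norm a * norm f"
    using norm_cauchy_schwarz[of f "- a"] by (simp add: mult.commute)
  have 5: "\<delta> * (G f \<bullet> a) \<le> norm a * (\<delta> * norm (G f))"
    using norm_cauchy_schwarz[of "G f" a] \<delta> by (simp add: mult.assoc mult.left_commute mult.commute)
  have "d = a - G m" using a by simp
  then have "norm d \<le> norm a + norm (G m)" using norm_triangle_ineq4 by blast
  then have "\<delta> * norm d \<le> \<delta> * norm a + M" using M(2) mult_left_mono[of "norm d" _ \<delta>] \<delta> by (fastforce simp: algebra_simps)
  then have "K * (\<delta> * norm d) \<le> K * (\<delta> * norm a + M)" using K by (rule mult_left_mono)
  moreover have "\<delta> * (\<delta> * norm (G d)) \<le> \<delta> * (K * norm d)" using inverse[OF d] \<delta> by (intro mult_left_mono) auto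
  ultimately have Gd: "\<delta>\<^sup>2 * norm (G d) \<le> K * (\<delta> * norm a + M)"
    by (simp add: power2_eq_square algebra_simps)
  have "p \<bullet> (m + \<delta> *\<^sub>R a + \<delta>\<^sup>2 *\<^sub>R G d) \<le> norm p * norm (m + \<delta> *\<^sub>R a + \<delta>\<^sup>2 *\<^sub>R G d)"
    by (rule norm_cauchy_schwarz)
  also have "\<dots> \<le> norm p * (norm m + \<delta> * norm a + \<delta>\<^sup>2 * norm (G d))"
    using norm_triangle_ineq[of "m + \<delta> *\<^sub>R a" "\<delta>\<^sup>2 *\<^sub>R G d"] norm_triangle_ineq[of m "\<delta> *\<^sub>R a"] \<delta>
    by (intro mult_left_mono) auto
  also have "\<dots> \<le> norm p * (M + \<delta> * norm a + K * (\<delta> * norm a + M))"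
    using Gd M(1) by (intro mult_left_mono) auto
  also have "\<dots> = norm a * ((1 + K) * \<delta> * norm p) + (1 + K) * norm p * M" by (simp add: algebra_simps)
  finally have 6: "p \<bullet> (m + \<delta> *\<^sub>R a + \<delta>\<^sup>2 *\<^sub>R G d) \<le> norm a * ((1 + K) * \<delta> * norm p) + (1 + K) * norm p * M" .
  have "(p + e + G f) \<bullet> (m + \<delta> *\<^sub>R a + \<delta>\<^sup>2 *\<^sub>R G d)
    = p \<bullet> (m + \<delta> *\<^sub>R a + \<delta>\<^sup>2 *\<^sub>R G d) + e \<bullet> m + \<delta> * (e \<bullet> a) + \<delta>\<^sup>2 * (e \<bullet> G d)
      + G f \<bullet> m + \<delta> * (G f \<bullet> a) + \<delta>\<^sup>2 * (G f \<bullet> G d)"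
    by (simp add: inner_add_left inner_add_right algebra_simps)
  then show ?thesis using 1 2 3 4 5 6 by (simp add: distrib_left distrib_right)
qed

end

lemma inner_G_energy: "(d::'a::real_inner, a *\<^sub>R g::'a) \<bullet> (m, a *\<^sub>R h) = d \<bullet> m + a\<^sup>2 * (g \<bullet> h)"
  by (simp add: power2_eq_square)

lemma norm_fst_snd_le: "norm (fst x) \<le> norm x" "norm (snd x) \<le> norm x"
  by (metis norm_fst_le norm_snd_le prod.collapse)+

lemma young_cancel:
  fixes \<tau> :: real assumes "0 < \<tau>" "0 < \<delta>"
  shows "\<tau> * (x * y) - \<tau> * \<delta> * x\<^sup>2 \<le> \<tau> / (4 * \<delta>) * y\<^sup>2"
proof -
  have "0 \<le> \<tau> / (4 * \<delta>) * (y - 2 * \<delta> * x)\<^sup>2" using assms by auto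
  also have "\<dots> = \<tau> / (4 * \<delta>) * y\<^sup>2 - (\<tau> * (x * y) - \<tau> * \<delta> * x\<^sup>2)"
    using assms by (simp add: power2_eq_square field_simps)
  finally show ?thesis by simp
qed

lemma sq_sum5_le: "(a + b + c + d + e)\<^sup>2 \<le> 5 * (a\<^sup>2 + b\<^sup>2 + c\<^sup>2 + d\<^sup>2 + (e::real)\<^sup>2)"
proof -
  have "0 \<le> (a-b)\<^sup>2 + (a-c)\<^sup>2 + (a-d)\<^sup>2 + (a-e)\<^sup>2 + (b-c)\<^sup>2 + (b-d)\<^sup>2 + (b-e)\<^sup>2 + (c-d)\<^sup>2 + (c-e)\<^sup>2 + (d-e)\<^sup>2"
    by simp
  then show ?thesis by (simp add: power2_eq_square algebra_simps)
qed

lemma sq_sum3_le: "(a + b + c)\<^sup>2 \<le> 3 * (a\<^sup>2 + b\<^sup>2 + (c::real)\<^sup>2)"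
proof -
  have "0 \<le> (a-b)\<^sup>2 + (a-c)\<^sup>2 + (b-c)\<^sup>2" by simp
  then show ?thesis by (simp add: power2_eq_square algebra_simps)
qed

lemma sum_sq_le_sq_sum:
  assumes "0 \<le> a" "0 \<le> b" "0 \<le> c" "0 \<le> d" "0 \<le> (e::real)"
  shows "a\<^sup>2 + b\<^sup>2 + c\<^sup>2 + d\<^sup>2 + e\<^sup>2 \<le> (a + b + c + d + e)\<^sup>2"
  using assms by (simp add: power2_eq_square algebra_simps)

lemma le_of_sq_le:
  fixes x :: real
  assumes "x\<^sup>2 \<le> P\<^sup>2 + x * Q + Z\<^sup>2" "0 \<le> P" "0 \<le> Q" "0 \<le> Z" "0 \<le> x"
  shows "x \<le> P + Q + Z"
proof (rule ccontr)
  assume "\<not> ?thesis"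
  then have c: "P + Q + Z < x" by simp
  have 1: "P * P \<le> P * x" "Z * Z \<le> Z * x" using assms c by (auto intro!: mult_left_mono)
  have "(P + Q + Z) * x < x * x" using c assms by (intro mult_strict_right_mono) auto
  then show False using assms(1) 1 by (simp add: power2_eq_square algebra_simps)
qed

context stabilized_ab
begin

abbreviation dq :: "nat \<Rightarrow> 'a" where "dq n \<equiv> (1/\<tau>) *\<^sub>R bdiff \<eta> n"

text \<open>
  One time step: the part of the residual paired with the dissipated quantity is absorbed into the
  dissipation by Young's inequality, which leaves its square weighted with \<open>1 / \<delta>\<close>.
\<close>

lemma energy_increment:
  assumes n: "\<nu> \<le> n" "n \<le> N" and M: "norm (abm \<nu> X n) \<le> M"
  defines "\<alpha> \<equiv> \<delta> * norm (dq n) + \<delta>\<^sup>2 * norm (G (dq n)) + norm (abm \<nu> \<eta> n)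
      + \<delta> * norm (G (abm \<nu> \<eta> n)) + (1 + K) * \<delta> * norm (\<rho> n)"
  shows "bdiff X n \<bullet> abm \<nu> X n \<le> \<tau> / (4 * \<delta>) * \<alpha>\<^sup>2
    + \<tau> * (\<delta> * norm (G (dq n)) + (1 + K) * norm (\<rho> n)) * M
    + \<delta>\<^sup>2 * (G (abm \<nu> \<eta> n) \<bullet> bdiff (\<lambda>k. G (\<theta> k)) n)"
proof -
  define d where "d = (1/\<tau>) *\<^sub>R bdiff \<theta> n"
  define m where "m = abm \<nu> \<theta> n"
  define e where "e = dq n"
  define f where "f = abm \<nu> \<eta> n"
  have dV: "d \<in> Vh" unfolding d_def by (intro subspace_scale bdiff_in subspace_Vh \<theta>)
  have mV: "m \<in> Vh" unfolding m_def by (intro abm_in subspace_Vh \<theta>)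
  have eV: "e \<in> V" unfolding e_def by (intro subspace_scale bdiff_in subspace_V \<eta>)
  have fV: "f \<in> V" unfolding f_def by (intro abm_in subspace_V \<eta>)
  have eo: "e \<bullet> W = 0" if "W \<in> Vh" for W
    unfolding e_def bdiff_def using \<eta>_orth[OF that] by (simp add: inner_diff_left)
  have fo: "f \<bullet> W = 0" if "W \<in> Vh" for W
    unfolding f_def abm_def using \<eta>_orth[OF that] by (simp add: inner_sum_left)
  have r: "residual n = \<rho> n + e + G f" using n by (simp add: residual_def e_def f_def)
  have bX: "bdiff X n = \<tau> *\<^sub>R (d, \<delta> *\<^sub>R G d)"
    using X_bdiff_pow[of 1 n] \<tau> G_scale[OF Vh_in_V[OF dV], of \<tau>] by (simp add: d_def)
  have mX: "abm \<nu> X n = (m, \<delta> *\<^sub>R G m)" using X_abm[of 0 n] by (simp add: m_def)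
  have mM: "norm m \<le> M" "\<delta> * norm (G m) \<le> M"
    using norm_fst_snd_le[of "abm \<nu> X n"] M \<delta> unfolding mX by auto
  have eq: "(d + G m - residual n) \<bullet> (W + \<delta> *\<^sub>R G W) = 0" if "W \<in> Vh" for W
    using scheme_from_0[OF n(2) that] by (simp add: d_def m_def)
  have bG: "bdiff (\<lambda>k. G (\<theta> k)) n = \<tau> *\<^sub>R G d"
    using G_bdiff_pow[where f=\<theta> and q=1 and n=n, OF \<theta>V] G_scale[OF Vh_in_V[OF dV], of \<tau>] \<tau> by (simp add: d_def)
  have "bdiff X n \<bullet> abm \<nu> X n = \<tau> * (d \<bullet> m + \<delta>\<^sup>2 * (G d \<bullet> G m))"
    unfolding bX mX inner_scaleR_left inner_G_energy ..
  also have "\<dots> = \<tau> * (residual n \<bullet> (m + \<delta> *\<^sub>R (d + G m) + \<delta>\<^sup>2 *\<^sub>R G d)) - \<tau> * \<delta> * (norm (d + G m))\<^sup>2"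
  proof -
    have e: "d \<bullet> m + \<delta>\<^sup>2 * (G d \<bullet> G m)
      = residual n \<bullet> (m + \<delta> *\<^sub>R (d + G m) + \<delta>\<^sup>2 *\<^sub>R G d) - \<delta> * (norm (d + G m))\<^sup>2"
      using energy_identity[OF dV mV eq] by linarith
    show ?thesis unfolding e by (simp add: right_diff_distrib mult.assoc)
  qed
  also have "\<dots> \<le> \<tau> * (norm (d + G m) * \<alpha> + (\<delta> * norm (G e) + (1 + K) * norm (\<rho> n)) * M + \<delta>\<^sup>2 * (G f \<bullet> G d)) - \<tau> * \<delta> * (norm (d + G m))\<^sup>2"
    unfolding r \<alpha>_def e_def[symmetric] f_def[symmetric]
    by (intro diff_right_mono mult_left_mono residual_bound[OF dV mV eV eo fV fo refl mM]) (use \<tau> in simp_all)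
  also have "\<dots> = (\<tau> * (norm (d + G m) * \<alpha>) - \<tau> * \<delta> * (norm (d + G m))\<^sup>2)
     + \<tau> * (\<delta> * norm (G e) + (1 + K) * norm (\<rho> n)) * M + \<delta>\<^sup>2 * (G f \<bullet> (\<tau> *\<^sub>R G d))"
    by (simp add: algebra_simps)
  also have "\<dots> \<le> \<tau> / (4 * \<delta>) * \<alpha>\<^sup>2 + \<tau> * (\<delta> * norm (G e) + (1 + K) * norm (\<rho> n)) * M + \<delta>\<^sup>2 * (G f \<bullet> (\<tau> *\<^sub>R G d))"
    using young_cancel[OF \<tau> \<delta>] by simp
  finally show ?thesis unfolding bG e_def f_def .
qed

text \<open>
  Stability and the energy identity at the index \<open>m\<close> of the largest error give a quadratic inequality
  for that error. Its linear terms stem from \<open>\<rho>\<close>, from \<open>G\<close> applied to difference quotients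
  of \<open>\<eta>\<close>, and from the boundary term of the summation by parts. The first two are sums in time
  of norms, and bounding them by mean squares costs the factor \<open>sqrt T\<close>; the square terms are
  mean squares already.
\<close>

lemma error_bound:
  assumes T: "real N * \<tau> \<le> T" "0 \<le> T"
    and pos: "0 \<le> e0" "0 \<le> e1" "0 \<le> d0" "0 \<le> d1" "0 \<le> c" "0 \<le> g"
    and e0: "\<tau> * (\<Sum>k<N. (norm (\<eta> k))\<^sup>2) \<le> e0\<^sup>2"
    and e1: "\<tau> * (\<Sum>k<N. (norm (G (\<eta> k)))\<^sup>2) \<le> e1\<^sup>2"
    and d0: "(\<Sum>k\<in>{1..N}. (norm (bdiff \<eta> k))\<^sup>2) \<le> \<tau> * d0\<^sup>2"
    and d1: "(\<Sum>k\<in>{1..N}. (norm (G (bdiff \<eta> k)))\<^sup>2) \<le> \<tau> * d1\<^sup>2"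
    and c: "\<tau> * (\<Sum>k\<in>{\<nu>..N}. (norm (\<rho> k))\<^sup>2) \<le> c\<^sup>2"
    and g: "\<And>k. k < N \<Longrightarrow> norm (G (\<eta> k)) \<le> g"
    and n: "n \<le> N"
  shows "norm (X n) \<le> 300 * (1 + K)\<^sup>2 *
     (sqrt \<delta> * d0 + \<delta> * sqrt \<delta> * d1 + e0 / sqrt \<delta> + sqrt \<delta> * e1 + sqrt \<delta> * c
      + sqrt T * (\<delta> * d1 + c) + \<delta> * g + sqrt \<tau> * (c + d0 + e1))" (is "_ \<le> _ * ?B")
proof -
  define P where "P = sqrt \<delta> * d0 + \<delta> * sqrt \<delta> * d1 + e0 / sqrt \<delta> + sqrt \<delta> * e1 + sqrt \<delta> * c"
  define Q where "Q = sqrt T * (\<delta> * d1 + c) + \<delta> * g"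
  define Z where "Z = sqrt \<tau> * (c + d0 + e1)"
  have B: "?B = P + Q + Z" unfolding P_def Q_def Z_def by simp
  have P0: "0 \<le> P" and Q0: "0 \<le> Q" and Z0: "0 \<le> Z"
    unfolding P_def Q_def Z_def using pos \<delta> \<tau> T by (auto intro!: add_nonneg_nonneg)
  have K1: "1 \<le> (1 + K)\<^sup>2" "1 \<le> 1 + K" "1 + K \<le> (1 + K)\<^sup>2"
    using K by (auto simp: power2_eq_square algebra_simps)
  have sd: "(sqrt \<delta>)\<^sup>2 = \<delta>" "0 < sqrt \<delta>" using \<delta> by auto

  have fin: "finite ((\<lambda>k. norm (X k)) ` {..N})" "(\<lambda>k. norm (X k)) ` {..N} \<noteq> {}" by auto
  obtain m where m0: "m \<in> {..N}" "Max ((\<lambda>k. norm (X k)) ` {..N}) = norm (X m)"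
    using Max_in[OF fin] by (rule imageE)
  have m1: "m \<le> N" using m0 by simp
  have m2: "norm (X k) \<le> norm (X m)" if "k \<le> N" for k
    using m0 Max_ge[OF fin(1), of "norm (X k)"] that by auto
  note m = m1 m2
  define \<Theta> where "\<Theta> = norm (X m)"
  have \<Theta>0: "0 \<le> \<Theta>" unfolding \<Theta>_def by simp
  have X0: "X j = 0" if "j < \<nu>" for j using \<theta>0[OF that] by (simp add: X_def G_0 zero_prod_def)

  have "\<Theta> \<le> 300 * (1 + K)\<^sup>2 * (P + Q + Z)"
  proof (cases "m < \<nu>")
    case True
    then show ?thesis using X0[of m] P0 Q0 Z0 K unfolding \<Theta>_def by simp
  next
    case False
    then have \<nu>m: "\<nu> \<le> m" by simp
    have \<nu>1: "1 \<le> \<nu>" using \<nu> by auto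
    define \<alpha> where "\<alpha> n = \<delta> * norm (dq n) + \<delta>\<^sup>2 * norm (G (dq n)) + norm (abm \<nu> \<eta> n)
      + \<delta> * norm (G (abm \<nu> \<eta> n)) + (1 + K) * \<delta> * norm (\<rho> n)" for n
    define \<beta> where "\<beta> n = \<delta> * norm (G (dq n)) + (1 + K) * norm (\<rho> n)" for n

    have stab: "(1/4) * \<Theta>\<^sup>2 \<le> (\<Sum>n\<in>{\<nu>..m}. bdiff X n \<bullet> abm \<nu> X n)
        + 70 * (\<tau> * (1 + K)\<^sup>2)\<^sup>2 * (\<Sum>n\<in>{\<nu>..m}. (norm (residual n))\<^sup>2)"
      unfolding \<Theta>_def
      by (rule ab_stability[where \<kappa>="1/100", OF \<nu> X0 _ X_step])
         (use m \<nu>m \<tau> K in \<open>auto simp: residual_def\<close>)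

    have XM: "norm (abm \<nu> X n) \<le> 7 * \<Theta>" if "n \<le> m" for n
      using that m by (intro norm_abm_le_max \<nu>) (auto simp: \<Theta>_def)
    have "(\<Sum>n\<in>{\<nu>..m}. bdiff X n \<bullet> abm \<nu> X n) \<le> (\<Sum>n\<in>{\<nu>..m}. \<tau> / (4 * \<delta>) * (\<alpha> n)\<^sup>2 + \<tau> * \<beta> n * (7 * \<Theta>)
        + \<delta>\<^sup>2 * (G (abm \<nu> \<eta> n) \<bullet> bdiff (\<lambda>k. G (\<theta> k)) n))"
      unfolding \<alpha>_def \<beta>_def using m by (intro sum_mono energy_increment XM) auto
    also have "\<dots> = 1 / (4 * \<delta>) * (\<tau> * (\<Sum>n\<in>{\<nu>..m}. (\<alpha> n)\<^sup>2)) + 7 * \<Theta> * (\<tau> * (\<Sum>n\<in>{\<nu>..m}. \<beta> n))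
        + \<delta>\<^sup>2 * (\<Sum>n\<in>{\<nu>..m}. G (abm \<nu> \<eta> n) \<bullet> bdiff (\<lambda>k. G (\<theta> k)) n)"
      by (simp add: sum.distrib sum_distrib_left algebra_simps)
    finally have en: "(\<Sum>n\<in>{\<nu>..m}. bdiff X n \<bullet> abm \<nu> X n) \<le> \<dots>" .

    have GabM: "G (abm \<nu> \<eta> n) = abm \<nu> (\<lambda>k. G (\<eta> k)) n" for n by (rule G_abm[OF \<eta>])
    have Gb: "G (dq n) = (1/\<tau>) *\<^sub>R G (bdiff \<eta> n)" for n
      by (intro G_scale bdiff_in subspace_V \<eta>)
    have sub: "(\<Sum>k\<in>{\<nu>..m}. a k) \<le> (\<Sum>k\<in>{1..N}. a k)" "(\<Sum>k\<in>{\<nu>..m}. a k) \<le> (\<Sum>k\<in>{\<nu>..N}. a k)" "(\<Sum>k<m. a k) \<le> (\<Sum>k<N. a k)"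
      if "\<And>k. 0 \<le> a k" for a :: "nat \<Rightarrow> real"
      using that m(1) \<nu>1 by (auto intro!: sum_mono2)
    have s_abm: "\<tau> * (\<Sum>n\<in>{\<nu>..m}. (norm (abm \<nu> f n))\<^sup>2) \<le> 56 * v\<^sup>2"
      if f: "\<tau> * (\<Sum>k<N. (norm (f k))\<^sup>2) \<le> v\<^sup>2" for f :: "nat \<Rightarrow> 'a" and v
    proof -
      have "(\<Sum>n\<in>{\<nu>..m}. (norm (abm \<nu> f n))\<^sup>2) \<le> 56 * (\<Sum>k<N. (norm (f k))\<^sup>2)"
        by (rule order_trans[OF sum_abm_sq_le[OF \<nu>] mult_left_mono[OF sub(3)]]) auto
      from mult_left_mono[OF this less_imp_le[OF \<tau>]] f show ?thesis by simp
    qed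
    have s_dq: "\<tau> * (\<Sum>n\<in>{\<nu>..m}. (norm ((1/\<tau>) *\<^sub>R f n))\<^sup>2) \<le> v\<^sup>2"
      if f: "(\<Sum>k\<in>{1..N}. (norm (f k))\<^sup>2) \<le> \<tau> * v\<^sup>2" for f :: "nat \<Rightarrow> 'a" and v
    proof -
      have "\<tau> * (\<Sum>n\<in>{\<nu>..m}. (norm ((1/\<tau>) *\<^sub>R f n))\<^sup>2) = (1/\<tau>) * (\<Sum>n\<in>{\<nu>..m}. (norm (f n))\<^sup>2)"
        using \<tau> by (simp add: sum_distrib_left power_divide) (simp add: power2_eq_square)
      also have "\<dots> \<le> (1/\<tau>) * (\<tau> * v\<^sup>2)"
        using \<tau> by (intro mult_left_mono order_trans[OF sub(1) f]) auto
      finally show ?thesis using \<tau> by simp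
    qed
    note s_e0 = s_abm[OF e0] and s_d0 = s_dq[OF d0]
    have s_e1: "\<tau> * (\<Sum>n\<in>{\<nu>..m}. (norm (G (abm \<nu> \<eta> n)))\<^sup>2) \<le> 56 * e1\<^sup>2"
      unfolding GabM by (rule s_abm[OF e1])
    have s_d1: "\<tau> * (\<Sum>n\<in>{\<nu>..m}. (norm (G (dq n)))\<^sup>2) \<le> d1\<^sup>2"
      unfolding Gb by (rule s_dq[OF d1])
    have s_c: "\<tau> * (\<Sum>n\<in>{\<nu>..m}. (norm (\<rho> n))\<^sup>2) \<le> c\<^sup>2"
      using c \<tau> by (intro order_trans[OF mult_left_mono[OF sub(2)] c]) auto

    have "\<tau> * (\<Sum>n\<in>{\<nu>..m}. (\<alpha> n)\<^sup>2) \<le> \<tau> * (\<Sum>n\<in>{\<nu>..m}. 5 * (\<delta>\<^sup>2 * (norm (dq n))\<^sup>2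
      + \<delta>^4 * (norm (G (dq n)))\<^sup>2 + (norm (abm \<nu> \<eta> n))\<^sup>2
      + \<delta>\<^sup>2 * (norm (G (abm \<nu> \<eta> n)))\<^sup>2 + (1 + K)\<^sup>2 * \<delta>\<^sup>2 * (norm (\<rho> n))\<^sup>2))"
      unfolding \<alpha>_def using \<tau>
      by (intro mult_left_mono sum_mono order_trans[OF sq_sum5_le]) (auto simp: power_mult_distrib power_divide power2_eq_square power4_eq_xxxx mult_ac)
    also have "\<dots> = 5 * (\<delta>\<^sup>2 * (\<tau> * (\<Sum>n\<in>{\<nu>..m}. (norm (dq n))\<^sup>2))
      + \<delta>^4 * (\<tau> * (\<Sum>n\<in>{\<nu>..m}. (norm (G (dq n)))\<^sup>2)) + \<tau> * (\<Sum>n\<in>{\<nu>..m}. (norm (abm \<nu> \<eta> n))\<^sup>2)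
      + \<delta>\<^sup>2 * (\<tau> * (\<Sum>n\<in>{\<nu>..m}. (norm (G (abm \<nu> \<eta> n)))\<^sup>2)) + (1 + K)\<^sup>2 * \<delta>\<^sup>2 * (\<tau> * (\<Sum>n\<in>{\<nu>..m}. (norm (\<rho> n))\<^sup>2)))"
      unfolding sum_distrib_left[symmetric] sum.distrib by (simp add: algebra_simps)
    also have "\<dots> \<le> 5 * (\<delta>\<^sup>2 * d0\<^sup>2 + \<delta>^4 * d1\<^sup>2 + 56 * e0\<^sup>2 + \<delta>\<^sup>2 * (56 * e1\<^sup>2) + (1 + K)\<^sup>2 * \<delta>\<^sup>2 * c\<^sup>2)"
      by (intro mult_left_mono add_mono s_e0 s_e1 s_d0 s_d1 s_c) auto
    also have "\<dots> \<le> 5 * (56 * (1 + K)\<^sup>2 * (\<delta>\<^sup>2 * d0\<^sup>2) + 56 * (1 + K)\<^sup>2 * (\<delta>^4 * d1\<^sup>2) + 56 * (1 + K)\<^sup>2 * e0\<^sup>2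
        + 56 * (1 + K)\<^sup>2 * (\<delta>\<^sup>2 * e1\<^sup>2) + 56 * (1 + K)\<^sup>2 * (\<delta>\<^sup>2 * c\<^sup>2))"
    proof (intro mult_left_mono add_mono)
      have k: "x \<le> 56 * (1 + K)\<^sup>2 * x" "56 * x \<le> 56 * (1 + K)\<^sup>2 * x" "(1 + K)\<^sup>2 * x \<le> 56 * (1 + K)\<^sup>2 * x" if "0 \<le> x" for x
        using mult_right_mono[OF K1(1) that] that by (simp_all add: mult.assoc)
      show "\<delta>\<^sup>2 * d0\<^sup>2 \<le> 56 * (1 + K)\<^sup>2 * (\<delta>\<^sup>2 * d0\<^sup>2)" "\<delta>^4 * d1\<^sup>2 \<le> 56 * (1 + K)\<^sup>2 * (\<delta>^4 * d1\<^sup>2)"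
        "56 * e0\<^sup>2 \<le> 56 * (1 + K)\<^sup>2 * e0\<^sup>2" by (intro k; simp)+
      show "\<delta>\<^sup>2 * (56 * e1\<^sup>2) \<le> 56 * (1 + K)\<^sup>2 * (\<delta>\<^sup>2 * e1\<^sup>2)"
        using k(2)[of "\<delta>\<^sup>2 * e1\<^sup>2"] by (simp add: algebra_simps)
      show "(1 + K)\<^sup>2 * \<delta>\<^sup>2 * c\<^sup>2 \<le> 56 * (1 + K)\<^sup>2 * (\<delta>\<^sup>2 * c\<^sup>2)"
        using k(3)[of "\<delta>\<^sup>2 * c\<^sup>2"] by (simp add: mult.assoc)
    qed simp
    also have "\<dots> = 280 * (1 + K)\<^sup>2 * \<delta> * ((sqrt \<delta> * d0)\<^sup>2 + (\<delta> * sqrt \<delta> * d1)\<^sup>2 + (e0 / sqrt \<delta>)\<^sup>2 + (sqrt \<delta> * e1)\<^sup>2 + (sqrt \<delta> * c)\<^sup>2)"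
      unfolding power_mult_distrib power_divide sd(1) using \<delta>
      by (simp add: field_simps power2_eq_square power4_eq_xxxx)
    also have "\<dots> \<le> 280 * (1 + K)\<^sup>2 * \<delta> * P\<^sup>2"
      unfolding P_def using pos \<delta> by (intro mult_left_mono sum_sq_le_sq_sum) auto
    finally have s\<alpha>: "1 / (4 * \<delta>) * (\<tau> * (\<Sum>n\<in>{\<nu>..m}. (\<alpha> n)\<^sup>2)) \<le> 70 * (1 + K)\<^sup>2 * P\<^sup>2"
      using \<delta> by (simp add: field_simps)

    define y where "y k = norm (G (bdiff \<eta> k))" for k
    have y: "(\<Sum>k\<in>{1..N}. y k) \<le> sqrt T * d1"
      using d1 pos by (intro sum_le_sqrt_card[OF _ _ _ T(1) \<tau>]) (auto simp: y_def)
    have sc: "\<tau> * (\<Sum>n\<in>{\<nu>..m}. norm (\<rho> n)) \<le> sqrt T * c"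
    proof -
      have "(\<Sum>k\<in>{\<nu>..m}. \<tau> * norm (\<rho> k)) \<le> sqrt T * c"
      proof (intro sum_le_sqrt_card[OF _ _ _ T(1) \<tau>])
        show "(\<Sum>k\<in>{\<nu>..m}. (\<tau> * norm (\<rho> k))\<^sup>2) \<le> \<tau> * c\<^sup>2"
          using mult_left_mono[OF s_c, of \<tau>] \<tau> by (simp add: power_mult_distrib sum_distrib_left power2_eq_square mult_ac)
      qed (use m \<nu>1 \<tau> pos in auto)
      then show ?thesis by (simp add: sum_distrib_left)
    qed
    have "\<tau> * (\<Sum>n\<in>{\<nu>..m}. \<beta> n) = \<delta> * (\<Sum>n\<in>{\<nu>..m}. y n) + (1 + K) * (\<tau> * (\<Sum>n\<in>{\<nu>..m}. norm (\<rho> n)))"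
      unfolding \<beta>_def Gb y_def using \<tau> by (simp add: sum.distrib sum_distrib_left algebra_simps)
    also have "\<dots> \<le> \<delta> * (sqrt T * d1) + (1 + K) * (sqrt T * c)"
      using \<delta> K by (intro add_mono mult_left_mono sc order_trans[OF sub(1) y]) (auto simp: y_def)
    finally have s\<beta>: "\<tau> * (\<Sum>n\<in>{\<nu>..m}. \<beta> n) \<le> \<delta> * (sqrt T * d1) + (1 + K) * (sqrt T * c)" .

    \<comment> \<open>Summation by parts: each \<open>G (\<theta> n)\<close> costs one factor \<open>\<delta>\<close>, and the other one remains.\<close>
    have GT: "\<delta> * norm (G (\<theta> k)) \<le> \<Theta>" if "k \<le> m" for k
      using norm_fst_snd_le(2)[of "X k"] m(2)[of k] that m(1) \<delta> by (simp add: X_def \<Theta>_def)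
    have "\<delta>\<^sup>2 * (\<Sum>n\<in>{\<nu>..m}. G (abm \<nu> \<eta> n) \<bullet> bdiff (\<lambda>k. G (\<theta> k)) n)
      = \<delta>\<^sup>2 * (G (abm \<nu> \<eta> m) \<bullet> G (\<theta> m)) - \<delta>\<^sup>2 * (\<Sum>n\<in>{\<nu>..<m}. (G (abm \<nu> \<eta> (Suc n)) - G (abm \<nu> \<eta> n)) \<bullet> G (\<theta> n))"
      using sum_by_parts[where b="\<lambda>k. G (\<theta> k)" and a="\<lambda>n. G (abm \<nu> \<eta> n)", OF _ \<nu>m] \<theta>0[of "\<nu>-1"] \<nu>1
      by (simp add: G_0 right_diff_distrib)
    also have "\<dots> \<le> \<delta> * norm (G (abm \<nu> \<eta> m)) * \<Theta> + \<delta> * (\<Sum>n\<in>{\<nu>..<m}. norm (G (abm \<nu> \<eta> (Suc n)) - G (abm \<nu> \<eta> n))) * \<Theta>"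
    proof -
      have b: "\<bar>\<delta>\<^sup>2 * (v \<bullet> G (\<theta> k))\<bar> \<le> \<delta> * norm v * \<Theta>" if "k \<le> m" for v k
      proof -
        have "\<bar>\<delta>\<^sup>2 * (v \<bullet> G (\<theta> k))\<bar> \<le> \<delta>\<^sup>2 * (norm v * norm (G (\<theta> k)))"
          unfolding abs_mult using Cauchy_Schwarz_ineq2[of v "G (\<theta> k)"] by (simp add: mult_left_mono)
        also have "\<dots> = \<delta> * norm v * (\<delta> * norm (G (\<theta> k)))" by (simp add: power2_eq_square)
        also have "\<dots> \<le> \<delta> * norm v * \<Theta>" using GT[OF that] \<delta> by (intro mult_left_mono) auto
        finally show ?thesis .
      qed
      have "- (\<delta>\<^sup>2 * (\<Sum>n\<in>{\<nu>..<m}. (G (abm \<nu> \<eta> (Suc n)) - G (abm \<nu> \<eta> n)) \<bullet> G (\<theta> n)))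
        = (\<Sum>n\<in>{\<nu>..<m}. - (\<delta>\<^sup>2 * ((G (abm \<nu> \<eta> (Suc n)) - G (abm \<nu> \<eta> n)) \<bullet> G (\<theta> n))))"
        by (simp add: sum_distrib_left sum_negf)
      also have "\<dots> \<le> (\<Sum>n\<in>{\<nu>..<m}. \<delta> * norm (G (abm \<nu> \<eta> (Suc n)) - G (abm \<nu> \<eta> n)) * \<Theta>)"
      proof (intro sum_mono)
        fix n assume "n \<in> {\<nu>..<m}"
        then show "- (\<delta>\<^sup>2 * ((G (abm \<nu> \<eta> (Suc n)) - G (abm \<nu> \<eta> n)) \<bullet> G (\<theta> n)))
          \<le> \<delta> * norm (G (abm \<nu> \<eta> (Suc n)) - G (abm \<nu> \<eta> n)) * \<Theta>"
          using b[of n "G (abm \<nu> \<eta> (Suc n)) - G (abm \<nu> \<eta> n)"] by (simp add: abs_le_iff)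
      qed
      also have "\<dots> = \<delta> * (\<Sum>n\<in>{\<nu>..<m}. norm (G (abm \<nu> \<eta> (Suc n)) - G (abm \<nu> \<eta> n))) * \<Theta>"
        by (simp add: sum_distrib_left sum_distrib_right)
      finally show ?thesis using b[of m "G (abm \<nu> \<eta> m)"] by linarith
    qed
    also have "\<dots> \<le> \<delta> * (7 * g) * \<Theta> + \<delta> * (7 * (sqrt T * d1)) * \<Theta>"
    proof (intro add_mono mult_right_mono mult_left_mono)
      show "norm (G (abm \<nu> \<eta> m)) \<le> 7 * g"
        unfolding GabM using m(1) \<nu>m by (intro norm_abm_le_max \<nu> g) auto
      have "(\<Sum>n\<in>{\<nu>..<m}. norm (G (abm \<nu> \<eta> (Suc n)) - G (abm \<nu> \<eta> n)))
         = (\<Sum>n\<in>{Suc \<nu>..m}. norm (abm \<nu> (bdiff (\<lambda>k. G (\<eta> k))) n))"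
        unfolding GabM abm_bdiff_commute atLeastLessThanSuc_atLeastAtMost[symmetric] sum.shift_bounds_Suc_ivl by simp
      also have "\<dots> \<le> (\<Sum>n\<in>{\<nu>..m}. norm (abm \<nu> (bdiff (\<lambda>k. G (\<eta> k))) n))"
        by (intro sum_mono2) auto
      also have "\<dots> \<le> (\<Sum>n\<in>{\<nu>..m}. \<Sum>j\<in>{1..\<nu>}. \<bar>ab_coeff \<nu> j\<bar> * norm (bdiff (\<lambda>k. G (\<eta> k)) (n - j)))"
        by (intro sum_mono norm_abm_le \<nu>)
      also have "\<dots> = (\<Sum>j\<in>{1..\<nu>}. \<bar>ab_coeff \<nu> j\<bar> * (\<Sum>n\<in>{\<nu>..m}. norm (bdiff (\<lambda>k. G (\<eta> k)) (n - j))))"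
        by (subst sum.swap) (simp add: sum_distrib_left)
      also have "\<dots> \<le> (\<Sum>j\<in>{1..\<nu>}. \<bar>ab_coeff \<nu> j\<bar> * (sqrt T * d1))"
      proof (intro sum_mono mult_left_mono)
        fix j assume j: "j \<in> {1..\<nu>}"
        have eq: "norm (bdiff (\<lambda>k. G (\<eta> k)) k) = y k" for k
          using G_bdiff_pow[where f=\<eta> and q=1, OF \<eta>, of k] by (simp add: y_def)
        have "(\<Sum>n\<in>{\<nu>..m}. y (n - j)) \<le> (\<Sum>k<m. y k)"
          using j by (intro sum_lag_le) (auto simp: y_def)
        also have "\<dots> \<le> (\<Sum>k\<in>{0..N}. y k)" using m(1) by (intro sum_mono2) (auto simp: y_def)
        also have "\<dots> = (\<Sum>k\<in>{1..N}. y k)" by (simp add: sum.atLeast_Suc_atMost y_def bdiff_def G_0)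
        finally show "(\<Sum>n\<in>{\<nu>..m}. norm (bdiff (\<lambda>k. G (\<eta> k)) (n - j))) \<le> sqrt T * d1"
          unfolding eq using y by linarith
      qed simp
      also have "\<dots> \<le> 7 * (sqrt T * d1)"
        unfolding sum_distrib_right[symmetric] using ab_coeff_bounds(2)[OF \<nu>] T pos by (intro mult_right_mono) auto
      finally show "(\<Sum>n\<in>{\<nu>..<m}. norm (G (abm \<nu> \<eta> (Suc n)) - G (abm \<nu> \<eta> n))) \<le> 7 * (sqrt T * d1)" .
    qed (use \<delta> \<Theta>0 in auto)
    finally have s6: "\<delta>\<^sup>2 * (\<Sum>n\<in>{\<nu>..m}. G (abm \<nu> \<eta> n) \<bullet> bdiff (\<lambda>k. G (\<theta> k)) n)
       \<le> \<delta> * (7 * g) * \<Theta> + \<delta> * (7 * (sqrt T * d1)) * \<Theta>" .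

    have QQ: "7 * \<Theta> * (\<tau> * (\<Sum>n\<in>{\<nu>..m}. \<beta> n)) + \<delta>\<^sup>2 * (\<Sum>n\<in>{\<nu>..m}. G (abm \<nu> \<eta> n) \<bullet> bdiff (\<lambda>k. G (\<theta> k)) n)
       \<le> \<Theta> * (14 * (1 + K) * Q)"
    proof -
      have "7 * (\<delta> * (sqrt T * d1) + (1 + K) * (sqrt T * c)) + \<delta> * (7 * g) + \<delta> * (7 * (sqrt T * d1))
        \<le> 14 * (1 + K) * Q"
      proof -
        have a: "0 \<le> sqrt T * d1 * \<delta>" "0 \<le> sqrt T * c" "0 \<le> \<delta> * g" using T pos \<delta> by auto
        show ?thesis unfolding Q_def
          using a mult_nonneg_nonneg[OF K a(1)] mult_nonneg_nonneg[OF K a(2)] mult_nonneg_nonneg[OF K a(3)]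
          by (simp add: algebra_simps)
      qed
      from mult_left_mono[OF this \<Theta>0] mult_left_mono[OF s\<beta>, of "7 * \<Theta>"] \<Theta>0 s6
      show ?thesis by (simp add: algebra_simps)
    qed

    have sR: "70 * (\<tau> * (1 + K)\<^sup>2)\<^sup>2 * (\<Sum>n\<in>{\<nu>..m}. (norm (residual n))\<^sup>2) \<le> 11760 * ((1 + K)\<^sup>2)\<^sup>2 * Z\<^sup>2"
    proof -
      have "\<tau> * (\<Sum>n\<in>{\<nu>..m}. (norm (residual n))\<^sup>2) \<le> \<tau> * (\<Sum>n\<in>{\<nu>..m}. 3 * ((norm (\<rho> n))\<^sup>2
        + (norm (dq n))\<^sup>2 + (norm (G (abm \<nu> \<eta> n)))\<^sup>2))"
      proof (intro mult_left_mono sum_mono)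
        fix n assume "n \<in> {\<nu>..m}"
        then have "residual n = \<rho> n + dq n + G (abm \<nu> \<eta> n)" by (simp add: residual_def)
        then have "norm (residual n) \<le> norm (\<rho> n) + norm (dq n) + norm (G (abm \<nu> \<eta> n))"
          using norm_triangle_ineq[of "\<rho> n + dq n" "G (abm \<nu> \<eta> n)"]
            norm_triangle_ineq[of "\<rho> n" "dq n"] by simp
        then show "(norm (residual n))\<^sup>2 \<le> 3 * ((norm (\<rho> n))\<^sup>2 + (norm (dq n))\<^sup>2 + (norm (G (abm \<nu> \<eta> n)))\<^sup>2)"
          by (intro order_trans[OF power_mono sq_sum3_le]) auto
      qed (use \<tau> in simp)
      also have "\<dots> = 3 * (\<tau> * (\<Sum>n\<in>{\<nu>..m}. (norm (\<rho> n))\<^sup>2) + \<tau> * (\<Sum>n\<in>{\<nu>..m}. (norm (dq n))\<^sup>2)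
         + \<tau> * (\<Sum>n\<in>{\<nu>..m}. (norm (G (abm \<nu> \<eta> n)))\<^sup>2))"
        unfolding sum_distrib_left[symmetric] sum.distrib by (simp add: algebra_simps)
      also have "\<dots> \<le> 3 * (c\<^sup>2 + d0\<^sup>2 + 56 * e1\<^sup>2)" by (intro mult_left_mono add_mono s_c s_d0 s_e1) simp
      also have "\<dots> \<le> 168 * (c + d0 + e1)\<^sup>2"
        using pos by (simp add: power2_eq_square algebra_simps)
      finally have a: "\<tau> * (\<Sum>n\<in>{\<nu>..m}. (norm (residual n))\<^sup>2) \<le> 168 * (c + d0 + e1)\<^sup>2" .
      have "70 * (\<tau> * (1 + K)\<^sup>2)\<^sup>2 * (\<Sum>n\<in>{\<nu>..m}. (norm (residual n))\<^sup>2)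
        = 70 * ((1 + K)\<^sup>2)\<^sup>2 * \<tau> * (\<tau> * (\<Sum>n\<in>{\<nu>..m}. (norm (residual n))\<^sup>2))"
        by (simp add: power2_eq_square)
      also have "\<dots> \<le> 70 * ((1 + K)\<^sup>2)\<^sup>2 * \<tau> * (168 * (c + d0 + e1)\<^sup>2)"
        using \<tau> by (intro mult_left_mono a) auto
      also have "\<dots> = 11760 * ((1 + K)\<^sup>2)\<^sup>2 * Z\<^sup>2"
        unfolding Z_def power_mult_distrib using \<tau> by simp
      finally show ?thesis .
    qed

    have "(1/4) * \<Theta>\<^sup>2 \<le> 70 * (1 + K)\<^sup>2 * P\<^sup>2 + \<Theta> * (14 * (1 + K) * Q) + 11760 * ((1 + K)\<^sup>2)\<^sup>2 * Z\<^sup>2"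
      using stab en s\<alpha> QQ sR by linarith
    then have "\<Theta>\<^sup>2 \<le> 280 * (1 + K)\<^sup>2 * P\<^sup>2 + \<Theta> * (56 * (1 + K) * Q) + 47040 * ((1 + K)\<^sup>2)\<^sup>2 * Z\<^sup>2"
      by (simp add: algebra_simps)
    also have "\<dots> \<le> (17 * (1 + K) * P)\<^sup>2 + \<Theta> * (56 * (1 + K) * Q) + (217 * (1 + K)\<^sup>2 * Z)\<^sup>2"
    proof -
      have "280 * k\<^sup>2 * x\<^sup>2 \<le> (17 * k * x)\<^sup>2" "47040 * k\<^sup>2 * x\<^sup>2 \<le> (217 * k * x)\<^sup>2" for k x :: real
        using zero_le_power2[of "k * x"] unfolding power_mult_distrib by simp_all
      from this(1)[of "1 + K" P] this(2)[of "(1 + K)\<^sup>2" Z] show ?thesis by linarith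
    qed
    finally have "\<Theta> \<le> 17 * (1 + K) * P + 56 * (1 + K) * Q + 217 * (1 + K)\<^sup>2 * Z"
      by (rule le_of_sq_le) (use P0 Q0 Z0 K \<Theta>0 in auto)
    also have "\<dots> \<le> 300 * (1 + K)\<^sup>2 * P + 300 * (1 + K)\<^sup>2 * Q + 300 * (1 + K)\<^sup>2 * Z"
      using P0 Q0 Z0 K1 K by (intro add_mono mult_right_mono mult_mono) auto
    finally show ?thesis by (simp add: algebra_simps)
  qed
  then show ?thesis unfolding B using m(2)[OF n] unfolding \<Theta>_def by linarith
qed

end

section \<open>Integrals over time cells\<close>

abbreviation grid_cell :: "real \<Rightarrow> nat \<Rightarrow> real set" where
  "grid_cell \<tau> k \<equiv> {real k * \<tau><..<real (Suc k) * \<tau>}"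

lemma AE_lebesgue_on_subset:
  assumes "AE x in lebesgue_on S. P x" "A \<subseteq> S" "S \<in> sets lebesgue" "A \<in> sets lebesgue"
  shows "AE x in lebesgue_on A. P x"
  using assms by (auto simp: AE_restrict_space_iff elim!: eventually_mono)

lemma integrable_lebesgue_on_subset:
  fixes f :: "real \<Rightarrow> real"
  assumes "integrable (lebesgue_on S) f" "A \<subseteq> S" "S \<in> sets lebesgue" "A \<in> sets lebesgue"
  shows "integrable (lebesgue_on A) f"
  using set_integrable_subset[of lebesgue S f A] assms
  by (simp add: integrable_restrict_space set_integrable_def)

text \<open>
  If \<open>f\<close> is not integrable, its integral is \<open>0\<close> by convention.
\<close>

lemma LINT_abs_le:
  fixes f :: "'a \<Rightarrow> real"
  assumes n: "integrable M n" and f: "AE x in M. \<bar>f x\<bar> \<le> n x"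
  shows "\<bar>LINT x|M. f x\<bar> \<le> (LINT x|M. n x)"
proof (cases "integrable M f")
  case True
  have "\<bar>LINT x|M. f x\<bar> \<le> (LINT x|M. \<bar>f x\<bar>)" by (rule integral_abs_bound)
  also have "\<dots> \<le> (LINT x|M. n x)" using True n f by (intro integral_mono_AE) auto
  finally show ?thesis .
next
  case False
  have "0 \<le> (LINT x|M. n x)" using f by (intro integral_nonneg_AE) auto
  then show ?thesis using False by (simp add: not_integrable_integral_eq)
qed

lemma LINT_open_interval:
  fixes f :: "real \<Rightarrow> real"
  assumes "integrable (lebesgue_on {c<..<d}) f"
  shows "f integrable_on {c..d}" "(LINT x|lebesgue_on {c<..<d}. f x) = integral {c..d} f"
proof -
  have "f absolutely_integrable_on {c<..<d}"
    using assms by (simp add: integrable_restrict_space set_integrable_def)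
  then have "f integrable_on {c<..<d}" by (rule set_lebesgue_integral_eq_integral(1))
  then show "f integrable_on {c..d}" by (simp add: integrable_on_open_interval_real)
  show "(LINT x|lebesgue_on {c<..<d}. f x) = integral {c..d} f"
    using lebesgue_integral_eq_integral[OF assms] by (simp add: integral_open_interval_real)
qed

lemma LINT_const_interval: "(c::real) \<le> d \<Longrightarrow> (LINT x|lebesgue_on {c<..<d}. K) = (d - c) * (K::real)"
  by (simp add: measure_restrict_space)

lemma integrable_const_interval: "integrable (lebesgue_on {c<..<d::real}) (\<lambda>x. K::real)"
  by (intro finite_measure.integrable_const finite_measure_lebesgue_on bounded_set_imp_lmeasurable) auto

lemma LINT_square_le:
  fixes n :: "real \<Rightarrow> real"
  assumes cd: "c < d" and n: "integrable (lebesgue_on {c<..<d}) n" "integrable (lebesgue_on {c<..<d}) (\<lambda>x. (n x)\<^sup>2)"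
  shows "(LINT x|lebesgue_on {c<..<d}. n x)\<^sup>2 \<le> (d - c) * (LINT x|lebesgue_on {c<..<d}. (n x)\<^sup>2)"
proof -
  define J where "J = (LINT x|lebesgue_on {c<..<d}. n x)"
  define m where "m = J / (d - c)"
  have mJ: "m * (d - c) = J" unfolding m_def using cd by simp
  have "0 \<le> (LINT x|lebesgue_on {c<..<d}. (n x - m)\<^sup>2)" by (intro integral_nonneg_AE) auto
  also have "\<dots> = (LINT x|lebesgue_on {c<..<d}. (n x)\<^sup>2 - 2 * m * n x + m\<^sup>2)"
    by (intro Bochner_Integration.integral_cong refl) (simp add: power2_eq_square algebra_simps)
  also have "\<dots> = (LINT x|lebesgue_on {c<..<d}. (n x)\<^sup>2) - 2 * m * J + (d - c) * m\<^sup>2"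
    using n integrable_const_interval[of c d "m\<^sup>2"] LINT_const_interval[of c d "m\<^sup>2"] cd
    by (simp add: J_def)
  also have "\<dots> = (LINT x|lebesgue_on {c<..<d}. (n x)\<^sup>2) - m * J"
    using mJ by (simp add: power2_eq_square algebra_simps)
  finally have "m * J \<le> (LINT x|lebesgue_on {c<..<d}. (n x)\<^sup>2)" by simp
  then have "(d - c) * (m * J) \<le> (d - c) * (LINT x|lebesgue_on {c<..<d}. (n x)\<^sup>2)"
    using cd by (intro mult_left_mono) auto
  moreover have "(d - c) * (m * J) = J\<^sup>2" using mJ by (simp add: power2_eq_square algebra_simps)
  ultimately show ?thesis unfolding J_def by simp
qed

lemma sum_cells_le:
  fixes f :: "real \<Rightarrow> real"
  assumes f: "integrable (lebesgue_on {0<..<T}) f" "\<And>x. 0 \<le> f x" and N: "real N * \<tau> \<le> T" "0 < \<tau>"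
  shows "(\<Sum>k<N. LINT x|lebesgue_on (grid_cell \<tau> k). f x) \<le> (LINT x|lebesgue_on {0<..<T}. f x)"
proof -
  have fT: "f integrable_on {0..T}" "(LINT x|lebesgue_on {0<..<T}. f x) = integral {0..T} f"
    using LINT_open_interval[OF f(1)] by auto
  have cell: "(LINT x|lebesgue_on (grid_cell \<tau> k). f x) = integral {real k * \<tau>..real (Suc k) * \<tau>} f"
    if "k < N" for k
  proof -
    have "real (Suc k) * \<tau> \<le> real N * \<tau>" using that N by (intro mult_right_mono) auto
    then have "real (Suc k) * \<tau> \<le> T" using N(1) by linarith
    then have "grid_cell \<tau> k \<subseteq> {0<..<T}"
      using N by (intro greaterThanLessThan_subseteq_greaterThanLessThan[THEN iffD2]) (auto simp del: of_nat_Suc)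
    then show ?thesis by (intro LINT_open_interval(2) integrable_lebesgue_on_subset[OF f(1)]) auto
  qed
  have "(\<Sum>k<m. integral {real k * \<tau>..real (Suc k) * \<tau>} f) = integral {0..real m * \<tau>} f" if "m \<le> N" for m
    using that
  proof (induction m)
    case (Suc m)
    have "real (Suc m) * \<tau> \<le> real N * \<tau>" using Suc.prems N by (intro mult_right_mono) auto
    then have "real (Suc m) * \<tau> \<le> T" using N(1) by linarith
    then have "f integrable_on {0..real (Suc m) * \<tau>}"
      by (intro integrable_on_subinterval[OF fT(1)]) auto
    then have "integral {0..real m * \<tau>} f + integral {real m * \<tau>..real (Suc m) * \<tau>} f = integral {0..real (Suc m) * \<tau>} f"
      using N by (intro Henstock_Kurzweil_Integration.integral_combine) (auto simp: algebra_simps)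
    then show ?case using Suc by simp
  qed simp
  from this[of N] have "(\<Sum>k<N. LINT x|lebesgue_on (grid_cell \<tau> k). f x) = integral {0..real N * \<tau>} f"
    using cell by (simp cong: sum.cong_simp)
  also have "\<dots> \<le> integral {0..T} f"
    using N f(2) by (intro integral_subset_le fT(1) integrable_on_subinterval[OF fT(1)]) auto
  finally show ?thesis using fT(2) by simp
qed

lemma integrable_of_square:
  fixes n :: "real \<Rightarrow> real"
  assumes "n \<in> borel_measurable (lebesgue_on {0<..<T})" "integrable (lebesgue_on {0<..<T}) (\<lambda>x. (n x)\<^sup>2)"
  shows "integrable (lebesgue_on {0<..<T}) n"
proof (rule Bochner_Integration.integrable_bound[where f="\<lambda>x. 1 + (n x)\<^sup>2"])
  show "integrable (lebesgue_on {0<..<T}) (\<lambda>x. 1 + (n x)\<^sup>2)"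
    using assms(2) integrable_const_interval by (intro Bochner_Integration.integrable_add) auto
  have "\<bar>y\<bar> \<le> 1 + y\<^sup>2" for y :: real
    using zero_le_power2[of "\<bar>y\<bar> - 1"] zero_le_power2[of y] by (simp add: power2_diff)
  then show "AE x in lebesgue_on {0<..<T}. norm (n x) \<le> norm (1 + (n x)\<^sup>2)"
    by (auto intro!: AE_I2 order_trans[OF _ abs_ge_self])
qed (rule assms(1))

lemma const_le_of_AE:
  fixes K K' c d :: real
  assumes "c < d" "AE t in lebesgue_on {c<..<d}. K \<le> K'"
  shows "K \<le> K'"
proof -
  have "(LINT t|lebesgue_on {c<..<d}. K) \<le> (LINT t|lebesgue_on {c<..<d}. K')"
    by (intro integral_mono_AE integrable_const_interval assms(2))
  then show ?thesis unfolding LINT_const_interval[OF less_imp_le[OF assms(1)]] using assms(1) by simp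
qed

section \<open>Projection errors along an evolution\<close>

text \<open>
  Testing with the elements of \<open>H\<close> avoids integrals of vector-valued functions.
\<close>

definition primitive_of :: "'a::real_inner set \<Rightarrow> real \<Rightarrow> (real \<Rightarrow> 'a) \<Rightarrow> (real \<Rightarrow> 'a) \<Rightarrow> bool" where
  "primitive_of H T u g \<longleftrightarrow> (\<forall>\<phi>\<in>H. \<forall>s t. 0 \<le> s \<and> s \<le> t \<and> t \<le> T \<longrightarrow>
     (u t - u s) \<bullet> \<phi> = (LINT \<sigma>|lebesgue_on {s<..<t}. g \<sigma> \<bullet> \<phi>))"

lemma primitive_ofD:
  "primitive_of H T u g \<Longrightarrow> \<phi> \<in> H \<Longrightarrow> 0 \<le> s \<Longrightarrow> s \<le> t \<Longrightarrow> t \<le> T \<Longrightarrow>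
    (u t - u s) \<bullet> \<phi> = (LINT \<sigma>|lebesgue_on {s<..<t}. g \<sigma> \<bullet> \<phi>)"
  unfolding primitive_of_def by blast

context skew_galerkin
begin

text \<open>
  Both bounds follow by duality. The projection error of an increment is tested with \<open>\<psi>\<close>, or with \<open>G \<psi>\<close>
  after \<open>G\<close> has been moved to the test function. Subtracting from the test function its projection
  leaves the projection error of \<open>g\<close> under the time integral, where its pointwise bounds apply,
  and there \<open>G\<close> can be moved back. Thus \<open>G\<close>, which is unbounded, never has to be exchanged
  with an integral.
\<close>

lemma increment_bounds:
  assumes u: "u s \<in> V" "u t \<in> V"
    and incr: "\<And>\<phi>. \<phi> \<in> H \<Longrightarrow> (u t - u s) \<bullet> \<phi> = (LINT \<sigma>|lebesgue_on {s<..<t}. g \<sigma> \<bullet> \<phi>)"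
    and n: "integrable (lebesgue_on {s<..<t}) n" "\<And>\<sigma>. 0 \<le> n \<sigma>"
    and bound: "AE \<sigma> in lebesgue_on {s<..<t}. g \<sigma> \<in> V \<and> proj_error_le (g \<sigma>) (a * n \<sigma>) (b * n \<sigma>)"
    and ab: "0 \<le> a" "0 \<le> b"
    and p: "p \<in> Vh" "\<And>w. w \<in> Vh \<Longrightarrow> (u s - p) \<bullet> w = 0"
    and q: "q \<in> Vh" "\<And>w. w \<in> Vh \<Longrightarrow> (u t - q) \<bullet> w = 0"
  shows "norm ((u t - q) - (u s - p)) \<le> a * (LINT \<sigma>|lebesgue_on {s<..<t}. n \<sigma>)"
    and "norm (G ((u t - q) - (u s - p))) \<le> b * (LINT \<sigma>|lebesgue_on {s<..<t}. n \<sigma>)"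
proof -
  define e where "e = (u t - q) - (u s - p)"
  define J where "J = (LINT \<sigma>|lebesgue_on {s<..<t}. n \<sigma>)"
  have J0: "0 \<le> J" unfolding J_def using n(2) by (intro integral_nonneg_AE) auto
  have eV: "e \<in> V" unfolding e_def using u p q Vh_in_V by (intro subspace_diff subspace_V) auto
  have eo: "e \<bullet> w = 0" if "w \<in> Vh" for w
    unfolding e_def using p(2)[OF that] q(2)[OF that] by (simp add: inner_diff_left)
  have main: "\<bar>e \<bullet> \<psi>\<bar> \<le> M * J"
    if \<psi>: "\<psi> \<in> H" and M: "AE \<sigma> in lebesgue_on {s<..<t}. \<exists>y. y \<in> Vh \<and> (\<forall>w\<in>Vh. (g \<sigma> - y) \<bullet> w = 0) \<and> \<bar>(g \<sigma> - y) \<bullet> \<psi>\<bar> \<le> M * n \<sigma>"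
    for \<psi> M
  proof -
    obtain \<pi> where \<pi>: "\<pi> \<in> Vh" "\<And>w. w \<in> Vh \<Longrightarrow> (\<psi> - \<pi>) \<bullet> w = 0" using ex_proj by blast
    have H: "\<psi> - \<pi> \<in> H" using \<psi> \<pi>(1) Vh_in_V V_in_H by (intro subspace_diff subspace_H) auto
    have "e \<bullet> \<psi> = e \<bullet> (\<psi> - \<pi>)" using eo[OF \<pi>(1)] by (simp add: inner_diff_right)
    also have "\<dots> = (u t - u s) \<bullet> (\<psi> - \<pi>) - (\<psi> - \<pi>) \<bullet> (q - p)"
      unfolding e_def by (simp add: inner_diff_left inner_diff_right inner_commute)
    also have "(\<psi> - \<pi>) \<bullet> (q - p) = 0" using p(1) q(1) by (intro \<pi>(2) subspace_diff subspace_Vh)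
    also have "(u t - u s) \<bullet> (\<psi> - \<pi>) = (LINT \<sigma>|lebesgue_on {s<..<t}. g \<sigma> \<bullet> (\<psi> - \<pi>))" by (rule incr[OF H])
    finally have "e \<bullet> \<psi> = (LINT \<sigma>|lebesgue_on {s<..<t}. g \<sigma> \<bullet> (\<psi> - \<pi>))" by simp
    moreover have "\<bar>LINT \<sigma>|lebesgue_on {s<..<t}. g \<sigma> \<bullet> (\<psi> - \<pi>)\<bar> \<le> (LINT \<sigma>|lebesgue_on {s<..<t}. M * n \<sigma>)"
    proof (rule LINT_abs_le)
      show "AE \<sigma> in lebesgue_on {s<..<t}. \<bar>g \<sigma> \<bullet> (\<psi> - \<pi>)\<bar> \<le> M * n \<sigma>"
        using M
      proof eventually_elim
        case (elim \<sigma>)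
        then obtain y where y: "y \<in> Vh" "\<And>w. w \<in> Vh \<Longrightarrow> (g \<sigma> - y) \<bullet> w = 0" "\<bar>(g \<sigma> - y) \<bullet> \<psi>\<bar> \<le> M * n \<sigma>" by blast
        have "g \<sigma> \<bullet> (\<psi> - \<pi>) = (g \<sigma> - y) \<bullet> \<psi>"
          using \<pi>(2)[OF y(1)] y(2)[OF \<pi>(1)] by (simp add: inner_diff_left inner_diff_right inner_commute)
        then show ?case using y(3) by simp
      qed
    qed (use n in simp)
    ultimately show ?thesis unfolding J_def using n by simp
  qed
  have "norm e \<le> a * J"
  proof (rule norm_le_by_duality)
    show "e \<in> H" by (rule V_in_H[OF eV])
    fix v assume v: "v \<in> V"
    have "\<bar>e \<bullet> v\<bar> \<le> (a * norm v) * J"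
    proof (rule main[OF V_in_H[OF v]])
      show "AE \<sigma> in lebesgue_on {s<..<t}. \<exists>y. y \<in> Vh \<and> (\<forall>w\<in>Vh. (g \<sigma> - y) \<bullet> w = 0) \<and> \<bar>(g \<sigma> - y) \<bullet> v\<bar> \<le> a * norm v * n \<sigma>"
        using bound
      proof eventually_elim
        case (elim \<sigma>)
        obtain y where y: "y \<in> Vh" "\<forall>w\<in>Vh. (g \<sigma> - y) \<bullet> w = 0" using ex_proj by blast
        have "\<bar>(g \<sigma> - y) \<bullet> v\<bar> \<le> norm (g \<sigma> - y) * norm v" by (rule Cauchy_Schwarz_ineq2)
        also have "\<dots> \<le> (a * n \<sigma>) * norm v" using elim y by (intro mult_right_mono) auto
        finally show ?case using y by (intro exI[of _ y]) (simp add: mult_ac)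
      qed
    qed
    then show "\<bar>e \<bullet> v\<bar> \<le> a * J * norm v" by (simp add: mult_ac)
  qed (use ab J0 in simp)
  then show "norm ((u t - q) - (u s - p)) \<le> a * (LINT \<sigma>|lebesgue_on {s<..<t}. n \<sigma>)" unfolding e_def J_def .
  have "norm (G e) \<le> b * J"
  proof (rule norm_le_by_duality)
    show "G e \<in> H" by (rule G_H[OF eV])
    fix v assume v: "v \<in> V"
    have "\<bar>e \<bullet> G v\<bar> \<le> (b * norm v) * J"
    proof (rule main[OF G_H[OF v]])
      show "AE \<sigma> in lebesgue_on {s<..<t}. \<exists>y. y \<in> Vh \<and> (\<forall>w\<in>Vh. (g \<sigma> - y) \<bullet> w = 0) \<and> \<bar>(g \<sigma> - y) \<bullet> G v\<bar> \<le> b * norm v * n \<sigma>"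
        using bound
      proof eventually_elim
        case (elim \<sigma>)
        obtain y where y: "y \<in> Vh" "\<forall>w\<in>Vh. (g \<sigma> - y) \<bullet> w = 0" using ex_proj by blast
        have "g \<sigma> - y \<in> V" using elim y Vh_in_V by (intro subspace_diff subspace_V) auto
        then have "\<bar>(g \<sigma> - y) \<bullet> G v\<bar> = \<bar>G (g \<sigma> - y) \<bullet> v\<bar>" using skew v by simp
        also have "\<dots> \<le> norm (G (g \<sigma> - y)) * norm v" by (rule Cauchy_Schwarz_ineq2)
        also have "\<dots> \<le> (b * n \<sigma>) * norm v" using elim y by (intro mult_right_mono) auto
        finally show ?case using y by (intro exI[of _ y]) (simp add: mult_ac)
      qed
    qed
    then show "\<bar>G e \<bullet> v\<bar> \<le> b * J * norm v" using skew[OF eV v] by (simp add: mult_ac)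
  qed (use ab J0 in simp)
  then show "norm (G ((u t - q) - (u s - p))) \<le> b * (LINT \<sigma>|lebesgue_on {s<..<t}. n \<sigma>)" unfolding e_def J_def .
qed

end

lemma LINT_mono_interval:
  fixes f :: "real \<Rightarrow> real"
  assumes f: "integrable (lebesgue_on {c<..<d}) f" "\<And>x. 0 \<le> f x" and "c \<le> s" "t \<le> d"
  shows "(LINT x|lebesgue_on {s<..<t}. f x) \<le> (LINT x|lebesgue_on {c<..<d}. f x)"
proof -
  have st: "integrable (lebesgue_on {s<..<t}) f"
    using assms by (intro integrable_lebesgue_on_subset[OF f(1)]) auto
  show ?thesis
    unfolding LINT_open_interval(2)[OF f(1)] LINT_open_interval(2)[OF st]
    using assms by (intro integral_subset_le LINT_open_interval(1) st f) auto
qed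

lemma cell_square_bound:
  fixes n0 :: "real \<Rightarrow> real"
  assumes cd: "c < d" and n0: "integrable (lebesgue_on {c<..<d}) (\<lambda>t. (n0 t)\<^sup>2)"
    and y: "0 \<le> y" "AE t in lebesgue_on {c<..<d}. y \<le> a * (n0 t + J)"
  shows "(d - c) * y\<^sup>2 \<le> 2 * a\<^sup>2 * ((LINT t|lebesgue_on {c<..<d}. (n0 t)\<^sup>2) + (d - c) * J\<^sup>2)"
proof -
  have "(d - c) * y\<^sup>2 = (LINT t|lebesgue_on {c<..<d}. y\<^sup>2)" unfolding LINT_const_interval[OF less_imp_le[OF cd]] ..
  also have "\<dots> \<le> (LINT t|lebesgue_on {c<..<d}. 2 * a\<^sup>2 * (n0 t)\<^sup>2 + 2 * a\<^sup>2 * J\<^sup>2)"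
  proof (intro integral_mono_AE Bochner_Integration.integrable_add integrable_const_interval)
    show "AE t in lebesgue_on {c<..<d}. y\<^sup>2 \<le> 2 * a\<^sup>2 * (n0 t)\<^sup>2 + 2 * a\<^sup>2 * J\<^sup>2"
      using y(2)
    proof eventually_elim
      case (elim t)
      have "y\<^sup>2 \<le> (a * (n0 t + J))\<^sup>2" using elim y(1) by (intro power_mono)
      also have "\<dots> \<le> a\<^sup>2 * (2 * (n0 t)\<^sup>2 + 2 * J\<^sup>2)"
        unfolding power_mult_distrib by (intro mult_left_mono sq_add_le) simp
      finally show ?case by (simp add: algebra_simps)
    qed
  qed (use n0 in simp)
  also have "\<dots> = 2 * a\<^sup>2 * (LINT t|lebesgue_on {c<..<d}. (n0 t)\<^sup>2) + (d - c) * (2 * a\<^sup>2 * J\<^sup>2)"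
    using n0 LINT_const_interval[OF less_imp_le[OF cd], of "2 * a\<^sup>2 * J\<^sup>2"]
    by (simp add: integrable_const_interval del: lebesgue_integral_const)
  finally show ?thesis by (simp add: algebra_simps)
qed

text \<open>
  Approximation bounds are available at almost every time only, for \<open>u\<close> and for its derivative
  \<open>g\<close>; in the application \<open>n0\<close> and \<open>n1\<close> are their Sobolev norms.
\<close>

locale galerkin_evolution = skew_galerkin H V Vh G for H V Vh :: "'a::real_inner set" and G +
  fixes T :: real and u g :: "real \<Rightarrow> 'a" and n0 n1 :: "real \<Rightarrow> real" and a b :: real
  assumes u_V: "\<And>t. t \<in> {0..T} \<Longrightarrow> u t \<in> V"
    and incr: "primitive_of H T u g"
    and n0: "\<And>\<sigma>. 0 \<le> n0 \<sigma>" "integrable (lebesgue_on {0<..<T}) (\<lambda>\<sigma>. (n0 \<sigma>)\<^sup>2)"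
    and n1: "\<And>\<sigma>. 0 \<le> n1 \<sigma>" "integrable (lebesgue_on {0<..<T}) n1" "integrable (lebesgue_on {0<..<T}) (\<lambda>\<sigma>. (n1 \<sigma>)\<^sup>2)"
    and approx_u: "AE t in lebesgue_on {0<..<T}. proj_error_le (u t) (a * n0 t) (b * n0 t)"
    and approx_g: "AE \<sigma> in lebesgue_on {0<..<T}. g \<sigma> \<in> V \<and> proj_error_le (g \<sigma>) (a * n1 \<sigma>) (b * n1 \<sigma>)"
    and ab: "0 \<le> a" "0 \<le> b"
begin

lemma sub_int:
  fixes f :: "real \<Rightarrow> real"
  shows "integrable (lebesgue_on {0<..<T}) f \<Longrightarrow> 0 \<le> c \<Longrightarrow> d \<le> T \<Longrightarrow> integrable (lebesgue_on {c<..<d}) f"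
  by (rule integrable_lebesgue_on_subset) auto

lemma sub_AE: "AE t in lebesgue_on {0<..<T}. P t \<Longrightarrow> 0 \<le> c \<Longrightarrow> d \<le> T \<Longrightarrow> AE t in lebesgue_on {c<..<d}. P t"
  by (rule AE_lebesgue_on_subset) auto

lemma projection_increment:
  assumes st: "0 \<le> s" "s \<le> t" "t \<le> T"
    and p: "p \<in> Vh" "\<And>w. w \<in> Vh \<Longrightarrow> (u s - p) \<bullet> w = 0"
    and q: "q \<in> Vh" "\<And>w. w \<in> Vh \<Longrightarrow> (u t - q) \<bullet> w = 0"
  shows "norm ((u t - q) - (u s - p)) \<le> a * (LINT \<sigma>|lebesgue_on {s<..<t}. n1 \<sigma>)"
    and "norm (G ((u t - q) - (u s - p))) \<le> b * (LINT \<sigma>|lebesgue_on {s<..<t}. n1 \<sigma>)"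
  by (rule increment_bounds[OF u_V u_V primitive_ofD[OF incr] sub_int[OF n1(2)] n1(1) sub_AE[OF approx_g] ab p q];
      use st in simp)+

text \<open>
  The approximation bound may fail at a given grid point \<open>x\<close>. It is transferred to \<open>x\<close> from almost every
  point of an adjacent cell, at the cost of the variation of the projection error over that cell.
\<close>

lemma cell_bounds:
  assumes cd: "0 \<le> c" "c < d" "d \<le> T" and x: "x \<in> {c..d}"
    and p: "p \<in> Vh" "\<And>w. w \<in> Vh \<Longrightarrow> (u x - p) \<bullet> w = 0"
  defines "J \<equiv> (LINT \<sigma>|lebesgue_on {c<..<d}. n1 \<sigma>)"
  shows "AE t in lebesgue_on {c<..<d}. norm (u x - p) \<le> a * (n0 t + J) \<and> norm (G (u x - p)) \<le> b * (n0 t + J)"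
proof -
  have sp: "AE t in lebesgue_on {c<..<d}. t \<in> {c<..<d}" by (rule AE_I2) simp
  from sub_AE[OF approx_u cd(1,3)] sp show ?thesis
  proof eventually_elim
    case (elim t)
    obtain q where q: "q \<in> Vh" "\<And>w. w \<in> Vh \<Longrightarrow> (u t - q) \<bullet> w = 0" using ex_proj by blast
    define ex et where "ex = u x - p" and "et = u t - q"
    have V: "ex \<in> V" "et \<in> V"
      unfolding ex_def et_def using elim x cd p q Vh_in_V by (auto intro!: subspace_diff subspace_V u_V)
    have et: "norm et \<le> a * n0 t" "norm (G et) \<le> b * n0 t" 
    proof -
      have "\<forall>w\<in>Vh. (u t - q) \<bullet> w = 0" using q(2) by blast
      then show "norm et \<le> a * n0 t" "norm (G et) \<le> b * n0 t" using elim(1) q(1) unfolding et_def by blast+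
    qed
    have J: "(LINT \<sigma>|lebesgue_on {s<..<r}. n1 \<sigma>) \<le> J" if "c \<le> s" "r \<le> d" for s r
      unfolding J_def by (rule LINT_mono_interval[OF sub_int[OF n1(2)] n1(1)]) (use that cd in auto)
    have diff: "norm (ex - et) \<le> a * J \<and> norm (G ex - G et) \<le> b * J"
    proof (cases "t \<le> x")
      case True
      have "norm (ex - et) \<le> a * (LINT \<sigma>|lebesgue_on {t<..<x}. n1 \<sigma>)" "norm (G (ex - et)) \<le> b * (LINT \<sigma>|lebesgue_on {t<..<x}. n1 \<sigma>)"
        unfolding ex_def et_def using True elim x cd by (intro projection_increment p q; simp)+
      moreover have "a * (LINT \<sigma>|lebesgue_on {t<..<x}. n1 \<sigma>) \<le> a * J" "b * (LINT \<sigma>|lebesgue_on {t<..<x}. n1 \<sigma>) \<le> b * J"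
        using elim x ab by (auto intro!: mult_left_mono J)
      ultimately show ?thesis using G_diff[OF V] by simp
    next
      case False
      have "norm (et - ex) \<le> a * (LINT \<sigma>|lebesgue_on {x<..<t}. n1 \<sigma>)" "norm (G (et - ex)) \<le> b * (LINT \<sigma>|lebesgue_on {x<..<t}. n1 \<sigma>)"
        unfolding ex_def et_def using False elim x cd by (intro projection_increment p q; simp)+
      moreover have "a * (LINT \<sigma>|lebesgue_on {x<..<t}. n1 \<sigma>) \<le> a * J" "b * (LINT \<sigma>|lebesgue_on {x<..<t}. n1 \<sigma>) \<le> b * J"
        using elim x ab by (auto intro!: mult_left_mono J)
      ultimately show ?thesis using G_diff[OF V(2,1)] by (simp add: norm_minus_commute)
    qed
    have "norm ex \<le> norm et + norm (ex - et)" "norm (G ex) \<le> norm (G et) + norm (G ex - G et)"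
      using norm_triangle_ineq[of et "ex - et"] norm_triangle_ineq[of "G et" "G ex - G et"] by simp_all
    then show ?case using et diff unfolding ex_def by (simp add: distrib_left)
  qed
qed

end

locale galerkin_grid = galerkin_evolution H V Vh G T u g n0 n1 a b
  for H V Vh :: "'a::real_inner set" and G T u g n0 n1 a b +
  fixes \<tau> :: real and N :: nat and p \<eta> :: "nat \<Rightarrow> 'a"
  assumes \<tau>: "0 < \<tau>" and NT: "real N * \<tau> \<le> T"
    and p: "\<And>k. k \<le> N \<Longrightarrow> p k \<in> Vh" "\<And>k w. k \<le> N \<Longrightarrow> w \<in> Vh \<Longrightarrow> (u (real k * \<tau>) - p k) \<bullet> w = 0"
    and \<eta>: "\<And>k. k \<le> N \<Longrightarrow> \<eta> k = u (real k * \<tau>) - p k"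
begin

lemma kT: "k \<le> N \<Longrightarrow> real k * \<tau> \<le> T"
  using NT \<tau> mult_right_mono[of "real k" "real N" \<tau>] by linarith

lemma cell: "k < N \<Longrightarrow> 0 \<le> real k * \<tau> \<and> real k * \<tau> < real (Suc k) * \<tau> \<and> real (Suc k) * \<tau> \<le> T"
  using kT[of "Suc k"] \<tau> by simp

definition I0 where "I0 = (LINT \<sigma>|lebesgue_on {0<..<T}. (n0 \<sigma>)\<^sup>2)"
definition I1 where "I1 = (LINT \<sigma>|lebesgue_on {0<..<T}. (n1 \<sigma>)\<^sup>2)"

lemma I_nonneg: "0 \<le> I0" "0 \<le> I1"
  unfolding I0_def I1_def by (auto intro!: integral_nonneg_AE)

lemma cell_n1_sq:
  assumes "k < N"
  shows "(LINT \<sigma>|lebesgue_on (grid_cell \<tau> k). n1 \<sigma>)\<^sup>2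
    \<le> \<tau> * (LINT \<sigma>|lebesgue_on (grid_cell \<tau> k). (n1 \<sigma>)\<^sup>2)"
  using LINT_square_le[of "real k * \<tau>" "real (Suc k) * \<tau>" n1] cell[OF assms] sub_int[OF n1(2)] sub_int[OF n1(3)]
  by (simp add: algebra_simps)

text \<open>
  Squaring the bound of a grid value by values at almost all points of a cell and averaging over the cell.
\<close>

lemma grid_sum_le:
  assumes m: "0 \<le> m"
    and y: "\<And>k. k < N \<Longrightarrow> 0 \<le> y k" "\<And>k. k < N \<Longrightarrow> AE t in lebesgue_on (grid_cell \<tau> k).
        y k \<le> m * (n0 t + (LINT \<sigma>|lebesgue_on (grid_cell \<tau> k). n1 \<sigma>))"
  shows "\<tau> * (\<Sum>k<N. (y k)\<^sup>2) \<le> 2 * m\<^sup>2 * (I0 + \<tau>\<^sup>2 * I1)"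
proof -
  have "\<tau> * (\<Sum>k<N. (y k)\<^sup>2) = (\<Sum>k<N. \<tau> * (y k)\<^sup>2)" by (simp add: sum_distrib_left)
  also have "\<dots> \<le> (\<Sum>k<N. 2 * m\<^sup>2 * ((LINT \<sigma>|lebesgue_on (grid_cell \<tau> k). (n0 \<sigma>)\<^sup>2)
      + \<tau>\<^sup>2 * (LINT \<sigma>|lebesgue_on (grid_cell \<tau> k). (n1 \<sigma>)\<^sup>2)))"
  proof (intro sum_mono)
    fix k assume "k \<in> {..<N}"
    then have k: "k < N" by simp
    note c = cell[OF k]
    have e: "real (Suc k) * \<tau> - real k * \<tau> = \<tau>" by (simp add: algebra_simps)
    have "\<tau> * (y k)\<^sup>2 \<le> 2 * m\<^sup>2 * ((LINT \<sigma>|lebesgue_on (grid_cell \<tau> k). (n0 \<sigma>)\<^sup>2)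
      + \<tau> * (LINT \<sigma>|lebesgue_on (grid_cell \<tau> k). n1 \<sigma>)\<^sup>2)"
      using cell_square_bound[OF _ sub_int[OF n0(2)] y(1)[OF k] y(2)[OF k]] c unfolding e by blast
    also have "\<dots> \<le> 2 * m\<^sup>2 * ((LINT \<sigma>|lebesgue_on (grid_cell \<tau> k). (n0 \<sigma>)\<^sup>2)
      + \<tau> * (\<tau> * (LINT \<sigma>|lebesgue_on (grid_cell \<tau> k). (n1 \<sigma>)\<^sup>2)))"
      using \<tau> by (intro mult_left_mono add_left_mono cell_n1_sq[OF k]) auto
    finally show "\<tau> * (y k)\<^sup>2 \<le> 2 * m\<^sup>2 * ((LINT \<sigma>|lebesgue_on (grid_cell \<tau> k). (n0 \<sigma>)\<^sup>2)
      + \<tau>\<^sup>2 * (LINT \<sigma>|lebesgue_on (grid_cell \<tau> k). (n1 \<sigma>)\<^sup>2))"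
      by (simp add: power2_eq_square mult.assoc)
  qed
  also have "\<dots> = 2 * m\<^sup>2 * ((\<Sum>k<N. LINT \<sigma>|lebesgue_on (grid_cell \<tau> k). (n0 \<sigma>)\<^sup>2)
      + \<tau>\<^sup>2 * (\<Sum>k<N. LINT \<sigma>|lebesgue_on (grid_cell \<tau> k). (n1 \<sigma>)\<^sup>2))"
    unfolding sum_distrib_left[symmetric] sum.distrib by simp
  also have "\<dots> \<le> 2 * m\<^sup>2 * (I0 + \<tau>\<^sup>2 * I1)"
    unfolding I0_def I1_def by (intro mult_left_mono add_mono sum_cells_le n0 n1 NT \<tau>) auto
  finally show ?thesis .
qed

lemma cell_bounds_grid:
  assumes "k < N" "j = k \<or> j = Suc k"
  shows "AE t in lebesgue_on (grid_cell \<tau> k).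
      norm (\<eta> j) \<le> a * (n0 t + (LINT \<sigma>|lebesgue_on (grid_cell \<tau> k). n1 \<sigma>)) \<and>
      norm (G (\<eta> j)) \<le> b * (n0 t + (LINT \<sigma>|lebesgue_on (grid_cell \<tau> k). n1 \<sigma>))"
proof -
  have j: "j \<le> N" using assms by auto
  have x: "real j * \<tau> \<in> {real k * \<tau>..real (Suc k) * \<tau>}" using assms cell[OF assms(1)] by auto
  show ?thesis unfolding \<eta>[OF j]
    using cell[OF assms(1)] by (intro cell_bounds x p j) auto
qed

lemma eta_sum: "\<tau> * (\<Sum>k<N. (norm (\<eta> k))\<^sup>2) \<le> 2 * a\<^sup>2 * (I0 + \<tau>\<^sup>2 * I1)"
  by (rule grid_sum_le[OF ab(1)]) (auto intro: eventually_mono[OF cell_bounds_grid])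

lemma G_eta_sum: "\<tau> * (\<Sum>k<N. (norm (G (\<eta> k)))\<^sup>2) \<le> 2 * b\<^sup>2 * (I0 + \<tau>\<^sup>2 * I1)"
  by (rule grid_sum_le[OF ab(2)]) (auto intro: eventually_mono[OF cell_bounds_grid])

lemma eta_increment_sum:
  "(\<Sum>k\<in>{1..N}. (norm (bdiff \<eta> k))\<^sup>2) \<le> \<tau> * (a\<^sup>2 * I1)"
  "(\<Sum>k\<in>{1..N}. (norm (G (bdiff \<eta> k)))\<^sup>2) \<le> \<tau> * (b\<^sup>2 * I1)"
proof -
  have sum: "(\<Sum>k\<in>{1..N}. (y k)\<^sup>2) \<le> \<tau> * (m\<^sup>2 * I1)"
    if y: "\<And>k. k < N \<Longrightarrow> 0 \<le> y (Suc k)"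
      "\<And>k. k < N \<Longrightarrow> y (Suc k) \<le> m * (LINT \<sigma>|lebesgue_on (grid_cell \<tau> k). n1 \<sigma>)"
    for y :: "nat \<Rightarrow> real" and m
  proof -
    have "(\<Sum>k\<in>{1..N}. (y k)\<^sup>2) = (\<Sum>k<N. (y (Suc k))\<^sup>2)"
      by (rule sum.reindex_bij_witness[of _ Suc "\<lambda>k. k - 1"]) auto
    also have "\<dots> \<le> (\<Sum>k<N. m\<^sup>2 * (\<tau> * (LINT \<sigma>|lebesgue_on (grid_cell \<tau> k). (n1 \<sigma>)\<^sup>2)))"
    proof (intro sum_mono)
      fix k assume "k \<in> {..<N}"
      then have k: "k < N" by simp
      have "(y (Suc k))\<^sup>2 \<le> m\<^sup>2 * (LINT \<sigma>|lebesgue_on (grid_cell \<tau> k). n1 \<sigma>)\<^sup>2"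
        unfolding power_mult_distrib[symmetric] by (intro power_mono y k)
      also have "\<dots> \<le> m\<^sup>2 * (\<tau> * (LINT \<sigma>|lebesgue_on (grid_cell \<tau> k). (n1 \<sigma>)\<^sup>2))"
        by (intro mult_left_mono cell_n1_sq k) simp
      finally show "(y (Suc k))\<^sup>2 \<le> m\<^sup>2 * (\<tau> * (LINT \<sigma>|lebesgue_on (grid_cell \<tau> k). (n1 \<sigma>)\<^sup>2))" .
    qed
    also have "\<dots> = m\<^sup>2 * (\<tau> * (\<Sum>k<N. LINT \<sigma>|lebesgue_on (grid_cell \<tau> k). (n1 \<sigma>)\<^sup>2))"
      by (simp only: sum_distrib_left)
    also have "\<dots> \<le> m\<^sup>2 * (\<tau> * I1)"
      unfolding I1_def using \<tau> by (intro mult_left_mono sum_cells_le n1 NT) auto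
    finally show ?thesis by (simp add: mult_ac)
  qed
  have step: "norm (bdiff \<eta> (Suc k)) \<le> a * (LINT \<sigma>|lebesgue_on (grid_cell \<tau> k). n1 \<sigma>)"
    "norm (G (bdiff \<eta> (Suc k))) \<le> b * (LINT \<sigma>|lebesgue_on (grid_cell \<tau> k). n1 \<sigma>)" if k: "k < N" for k
  proof -
    have kk: "k \<le> N" "Suc k \<le> N" using k by auto
    have e: "bdiff \<eta> (Suc k) = (u (real (Suc k) * \<tau>) - p (Suc k)) - (u (real k * \<tau>) - p k)"
      unfolding bdiff_def by (simp only: diff_Suc_1 \<eta>[OF kk(1)] \<eta>[OF kk(2)])
    show "norm (bdiff \<eta> (Suc k)) \<le> a * (LINT \<sigma>|lebesgue_on (grid_cell \<tau> k). n1 \<sigma>)"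
      "norm (G (bdiff \<eta> (Suc k))) \<le> b * (LINT \<sigma>|lebesgue_on (grid_cell \<tau> k). n1 \<sigma>)"
      unfolding e using cell[OF k] by (intro projection_increment p kk; simp)+
  qed
  show "(\<Sum>k\<in>{1..N}. (norm (bdiff \<eta> k))\<^sup>2) \<le> \<tau> * (a\<^sup>2 * I1)"
    by (rule sum) (use step in auto)
  show "(\<Sum>k\<in>{1..N}. (norm (G (bdiff \<eta> k)))\<^sup>2) \<le> \<tau> * (b\<^sup>2 * I1)"
    by (rule sum) (use step in auto)
qed

lemma eta_max:
  assumes E: "AE t in lebesgue_on {0<..<T}. n0 t \<le> E" and N: "0 < N" and j: "j \<le> N"
  shows "norm (\<eta> j) \<le> a * (E + sqrt \<tau> * sqrt I1)" "norm (G (\<eta> j)) \<le> b * (E + sqrt \<tau> * sqrt I1)"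
proof -
  define k where "k = (if j = 0 then 0 else j - 1)"
  have k: "k < N" "j = k \<or> j = Suc k" using N j by (auto simp: k_def)
  define J where "J = (LINT \<sigma>|lebesgue_on (grid_cell \<tau> k). n1 \<sigma>)"
  have "J\<^sup>2 \<le> \<tau> * I1"
  proof -
    have "J\<^sup>2 \<le> \<tau> * (LINT \<sigma>|lebesgue_on (grid_cell \<tau> k). (n1 \<sigma>)\<^sup>2)"
      unfolding J_def by (rule cell_n1_sq[OF k(1)])
    also have "\<dots> \<le> \<tau> * I1"
      unfolding I1_def using \<tau> cell[OF k(1)] by (intro mult_left_mono LINT_mono_interval n1) auto
    finally show ?thesis .
  qed
  then have J: "J \<le> sqrt \<tau> * sqrt I1" by (simp add: real_le_rsqrt flip: real_sqrt_mult)
  have "AE t in lebesgue_on (grid_cell \<tau> k). norm (\<eta> j) \<le> a * (E + sqrt \<tau> * sqrt I1) \<and> norm (G (\<eta> j)) \<le> b * (E + sqrt \<tau> * sqrt I1)"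
    using cell_bounds_grid[OF k] sub_AE[OF E, of "real k * \<tau>" "real (Suc k) * \<tau>"] cell[OF k(1)]
  proof -
    have "AE t in lebesgue_on (grid_cell \<tau> k). n0 t \<le> E"
      using cell[OF k(1)] by (intro sub_AE[OF E]) auto
    with cell_bounds_grid[OF k] show ?thesis
    proof eventually_elim
      case (elim t)
      have "n0 t + J \<le> E + sqrt \<tau> * sqrt I1" using elim J by simp
      then have "a * (n0 t + J) \<le> a * (E + sqrt \<tau> * sqrt I1)" "b * (n0 t + J) \<le> b * (E + sqrt \<tau> * sqrt I1)"
        using ab by (auto intro: mult_left_mono)
      then show ?case using elim unfolding J_def by linarith
    qed
  qed
  then have 1: "AE t in lebesgue_on (grid_cell \<tau> k). norm (\<eta> j) \<le> a * (E + sqrt \<tau> * sqrt I1)"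
    and 2: "AE t in lebesgue_on (grid_cell \<tau> k). norm (G (\<eta> j)) \<le> b * (E + sqrt \<tau> * sqrt I1)"
    by simp_all
  show "norm (\<eta> j) \<le> a * (E + sqrt \<tau> * sqrt I1)" "norm (G (\<eta> j)) \<le> b * (E + sqrt \<tau> * sqrt I1)"
    using const_le_of_AE[OF _ 1] const_le_of_AE[OF _ 2] cell[OF k(1)] by auto
qed

end

section \<open>Consistency of the Adams--Bashforth formula\<close>

lemma taylor_remainder_le:
  fixes Df :: "nat \<Rightarrow> real \<Rightarrow> real"
  assumes p: "0 < p"
    and Df: "\<And>m t. m < p \<Longrightarrow> t \<in> {c..d} \<Longrightarrow> (Df m has_vector_derivative Df (Suc m) t) (at t within {c..d})"
    and n: "n integrable_on {c..d}" "\<And>t. 0 \<le> n t" and M: "\<And>t. t \<in> {c..d} \<Longrightarrow> \<bar>Df p t\<bar> \<le> M * n t" "0 \<le> M"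
    and b: "b \<in> {c..d}"
  shows "\<bar>Df 0 b - (\<Sum>i<p. (b - c) ^ i / fact i * Df i c)\<bar> \<le> (d - c) ^ (p - 1) * (M * integral {c..d} n)"
proof -
  have D: "(Df m has_vector_derivative Df (Suc m) t) (at t within {c..b})" if "m < p" "c \<le> t" "t \<le> b" for m t
    by (rule has_vector_derivative_within_subset[OF Df]) (use that b in auto)
  define i where "i = (\<lambda>x. ((b - x) ^ (p - 1) / fact (p - 1)) *\<^sub>R Df p x)"
  have cb: "c \<le> b" using b by simp
  have T: "Df 0 b = (\<Sum>i<p. ((b - c) ^ i / fact i) *\<^sub>R Df i c) + integral {c..b} i" "i integrable_on {c..b}"
    unfolding i_def using Taylor_integral[where p=p and Df=Df and f="Df 0" and a=c and b=b, OF p refl D cb]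
      Taylor_integrable[where p=p and Df=Df and f="Df 0" and a=c and b=b, OF p refl D cb] by auto
  have nb: "n integrable_on {c..b}" using b by (intro integrable_on_subinterval[OF n(1)]) auto
  have "\<bar>Df 0 b - (\<Sum>i<p. (b - c) ^ i / fact i * Df i c)\<bar> = norm (integral {c..b} i)"
    using T(1) by simp
  also have "\<dots> \<le> integral {c..b} (\<lambda>x. (d - c) ^ (p - 1) * (M * n x))"
  proof (rule integral_norm_bound_integral[OF T(2)])
    show "(\<lambda>x. (d - c) ^ (p - 1) * (M * n x)) integrable_on {c..b}"
      using nb by (intro integrable_on_mult_right)
    fix x assume x: "x \<in> {c..b}"
    have "norm (i x) = (b - x) ^ (p - 1) / fact (p - 1) * \<bar>Df p x\<bar>"
      using x unfolding i_def by (simp add: abs_mult)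
    also have "\<dots> \<le> (d - c) ^ (p - 1) * (M * n x)"
    proof (rule mult_mono)
      have "(b - x) ^ (p - 1) / fact (p - 1) \<le> (b - x) ^ (p - 1) / 1"
        using x by (intro divide_left_mono) (auto simp: fact_ge_1)
      also have "\<dots> \<le> (d - c) ^ (p - 1)" using x b by (simp add: power_mono)
      finally show "(b - x) ^ (p - 1) / fact (p - 1) \<le> (d - c) ^ (p - 1)" .
      show "\<bar>Df p x\<bar> \<le> M * n x" using x b by (intro M) auto
    qed (use x b in auto)
    finally show "norm (i x) \<le> (d - c) ^ (p - 1) * (M * n x)" .
  qed
  also have "\<dots> = (d - c) ^ (p - 1) * (M * integral {c..b} n)" by simp
  also have "\<dots> \<le> (d - c) ^ (p - 1) * (M * integral {c..d} n)"
    using b M(2) n(2) by (intro mult_left_mono integral_subset_le nb n(1)) auto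
  finally show ?thesis .
qed

text \<open>
  With \<open>q\<close> the Taylor coefficients at the oldest grid point, this is the exactness of the formula for
  polynomials of degree below \<open>\<nu>\<close>: the mean of the derivative equals the difference quotient.
\<close>

lemma ab_exact:
  fixes q :: "nat \<Rightarrow> real"
  assumes \<nu>: "\<nu> \<in> {3, 4}" and \<tau>: "0 < \<tau>"
  shows "(\<Sum>j\<in>{1..\<nu>}. ab_coeff \<nu> j * (\<Sum>i<\<nu>. (real (\<nu> - j) * \<tau>) ^ i / fact i * q (Suc i)))
    = ((\<Sum>i<Suc \<nu>. (real \<nu> * \<tau>) ^ i / fact i * q i) - (\<Sum>i<Suc \<nu>. (real (\<nu> - 1) * \<tau>) ^ i / fact i * q i)) / \<tau>"
proof -
  have "\<nu> = 3 \<or> \<nu> = 4" using \<nu> by auto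
  then show ?thesis
  proof
    assume n: "\<nu> = 3"
    show ?thesis unfolding n using \<tau>
      by (simp add: ab_coeff_def numeral_eq_Suc lessThan_Suc atLeastAtMostSuc_conv field_simps fact_numeral power2_eq_square power3_eq_cube)
  next
    assume n: "\<nu> = 4"
    show ?thesis unfolding n using \<tau>
      by (simp add: ab_coeff_def numeral_eq_Suc lessThan_Suc atLeastAtMostSuc_conv field_simps fact_numeral power2_eq_square power3_eq_cube)
  qed
qed

text \<open>
  Taylor expansion at the oldest grid point \<open>c\<close>, for the function and for its derivative. The
  integral form of the remainder is needed, since the final estimate involves only the mean square of the
  top derivative over the cells, not its supremum.
\<close>

lemma ab_consistency_scalar:
  fixes Df :: "nat \<Rightarrow> real \<Rightarrow> real"
  assumes \<nu>: "\<nu> \<in> {3, 4}" and \<tau>: "0 < \<tau>" and c: "c = d - real \<nu> * \<tau>"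
    and Df: "\<And>m t. m < Suc \<nu> \<Longrightarrow> t \<in> {c..d} \<Longrightarrow> (Df m has_vector_derivative Df (Suc m) t) (at t within {c..d})"
    and n: "n integrable_on {c..d}" "\<And>t. 0 \<le> n t"
    and M: "\<And>t. t \<in> {c..d} \<Longrightarrow> \<bar>Df (Suc \<nu>) t\<bar> \<le> M * n t" "0 \<le> M"
  shows "\<bar>(\<Sum>j\<in>{1..\<nu>}. ab_coeff \<nu> j * Df 1 (d - real j * \<tau>)) - (Df 0 d - Df 0 (d - \<tau>)) / \<tau>\<bar>
    \<le> 1000 * \<tau> ^ (\<nu> - 1) * (M * integral {c..d} n)"
proof -
  define I where "I = M * integral {c..d} n"
  have I0: "0 \<le> I" unfolding I_def using M(2) n by (intro mult_nonneg_nonneg integral_nonneg) auto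
  have \<nu>1: "1 \<le> \<nu>" "\<nu> \<le> 4" using \<nu> by auto
  have dc: "d - c = real \<nu> * \<tau>" using c by simp
  define P where "P b = (\<Sum>i<Suc \<nu>. (b - c) ^ i / fact i * Df i c)" for b
  define P1 where "P1 b = (\<Sum>i<\<nu>. (b - c) ^ i / fact i * Df (Suc i) c)" for b
  have R0: "\<bar>Df 0 b - P b\<bar> \<le> (real \<nu> * \<tau>) ^ \<nu> * I" if "b \<in> {c..d}" for b
    using taylor_remainder_le[of "Suc \<nu>" c d Df n M b] Df n M that unfolding P_def I_def dc by simp
  have R1: "\<bar>Df 1 b - P1 b\<bar> \<le> (real \<nu> * \<tau>) ^ (\<nu> - 1) * I" if "b \<in> {c..d}" for b
    using taylor_remainder_le[of \<nu> c d "\<lambda>i. Df (Suc i)" n M b] Df n M that \<nu>1 unfolding P1_def I_def dc by simp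
  have jc: "d - real j * \<tau> - c = real (\<nu> - j) * \<tau>" if "j \<le> \<nu>" for j
    using that c by (simp add: of_nat_diff algebra_simps)
  have jin: "d - real j * \<tau> \<in> {c..d}" if "j \<le> \<nu>" for j
  proof -
    have "0 \<le> real (\<nu> - j) * \<tau>" "0 \<le> real j * \<tau>" using \<tau> by auto
    then show ?thesis using jc[OF that] by auto
  qed
  have exact: "(\<Sum>j\<in>{1..\<nu>}. ab_coeff \<nu> j * P1 (d - real j * \<tau>)) = (P d - P (d - \<tau>)) / \<tau>"
  proof -
    have "(\<Sum>j\<in>{1..\<nu>}. ab_coeff \<nu> j * P1 (d - real j * \<tau>)) = (\<Sum>j\<in>{1..\<nu>}. ab_coeff \<nu> j * (\<Sum>i<\<nu>. (real (\<nu> - j) * \<tau>) ^ i / fact i * Df (Suc i) c))"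
      unfolding P1_def by (intro sum.cong refl) (simp add: jc)
    also have "\<dots> = ((\<Sum>i<Suc \<nu>. (real \<nu> * \<tau>) ^ i / fact i * Df i c) - (\<Sum>i<Suc \<nu>. (real (\<nu> - 1) * \<tau>) ^ i / fact i * Df i c)) / \<tau>"
      by (rule ab_exact[OF \<nu> \<tau>, of "\<lambda>i. Df i c"])
    also have "\<dots> = (P d - P (d - \<tau>)) / \<tau>"
      unfolding P_def using dc jc[of 1] \<nu>1 by simp
    finally show ?thesis .
  qed
  have "(\<Sum>j\<in>{1..\<nu>}. ab_coeff \<nu> j * Df 1 (d - real j * \<tau>)) - (Df 0 d - Df 0 (d - \<tau>)) / \<tau>
    = (\<Sum>j\<in>{1..\<nu>}. ab_coeff \<nu> j * (Df 1 (d - real j * \<tau>) - P1 (d - real j * \<tau>)))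
      - ((Df 0 d - P d) - (Df 0 (d - \<tau>) - P (d - \<tau>))) / \<tau>"
    using exact by (simp add: right_diff_distrib sum_subtractf diff_divide_distrib)
  then have "\<bar>(\<Sum>j\<in>{1..\<nu>}. ab_coeff \<nu> j * Df 1 (d - real j * \<tau>)) - (Df 0 d - Df 0 (d - \<tau>)) / \<tau>\<bar>
    \<le> \<bar>\<Sum>j\<in>{1..\<nu>}. ab_coeff \<nu> j * (Df 1 (d - real j * \<tau>) - P1 (d - real j * \<tau>))\<bar>
      + \<bar>((Df 0 d - P d) - (Df 0 (d - \<tau>) - P (d - \<tau>))) / \<tau>\<bar>" by linarith
  also have "\<dots> \<le> 7 * ((real \<nu> * \<tau>) ^ (\<nu> - 1) * I) + 2 * ((real \<nu> * \<tau>) ^ \<nu> * I) / \<tau>"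
  proof (intro add_mono)
    have "\<bar>\<Sum>j\<in>{1..\<nu>}. ab_coeff \<nu> j * (Df 1 (d - real j * \<tau>) - P1 (d - real j * \<tau>))\<bar>
      \<le> (\<Sum>j\<in>{1..\<nu>}. \<bar>ab_coeff \<nu> j\<bar> * ((real \<nu> * \<tau>) ^ (\<nu> - 1) * I))"
    proof (rule order_trans[OF sum_abs], rule sum_mono)
      fix j assume "j \<in> {1..\<nu>}"
      then show "\<bar>ab_coeff \<nu> j * (Df 1 (d - real j * \<tau>) - P1 (d - real j * \<tau>))\<bar> \<le> \<bar>ab_coeff \<nu> j\<bar> * ((real \<nu> * \<tau>) ^ (\<nu> - 1) * I)"
        unfolding abs_mult by (intro mult_left_mono R1 jin) auto
    qed
    also have "\<dots> \<le> 7 * ((real \<nu> * \<tau>) ^ (\<nu> - 1) * I)"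
      unfolding sum_distrib_right[symmetric] using I0 \<tau> by (intro mult_right_mono ab_coeff_bounds \<nu>) auto
    finally show "\<bar>\<Sum>j\<in>{1..\<nu>}. ab_coeff \<nu> j * (Df 1 (d - real j * \<tau>) - P1 (d - real j * \<tau>))\<bar>
      \<le> 7 * ((real \<nu> * \<tau>) ^ (\<nu> - 1) * I)" .
    have "\<bar>(Df 0 d - P d) - (Df 0 (d - \<tau>) - P (d - \<tau>))\<bar> \<le> 2 * ((real \<nu> * \<tau>) ^ \<nu> * I)"
      using R0[OF jin[of 0]] R0[OF jin[of 1]] \<nu>1 by simp
    then show "\<bar>((Df 0 d - P d) - (Df 0 (d - \<tau>) - P (d - \<tau>))) / \<tau>\<bar> \<le> 2 * ((real \<nu> * \<tau>) ^ \<nu> * I) / \<tau>"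
      using \<tau> by (simp add: divide_right_mono)
  qed
  also have "\<dots> = (7 * real \<nu> ^ (\<nu> - 1) + 2 * real \<nu> ^ \<nu>) * (\<tau> ^ (\<nu> - 1) * I)"
  proof -
    obtain m where m: "\<nu> = Suc m" using \<nu>1 by (cases \<nu>) auto
    have "2 * ((real \<nu> * \<tau>) ^ \<nu> * I) / \<tau> = 2 * real \<nu> ^ \<nu> * (\<tau> ^ (\<nu> - 1) * I)"
      unfolding power_mult_distrib using \<tau> by (subst (2) m) (simp add: m field_simps)
    then show ?thesis unfolding power_mult_distrib by (simp add: algebra_simps)
  qed
  also have "\<dots> \<le> 1000 * (\<tau> ^ (\<nu> - 1) * I)"
    using \<nu> I0 \<tau> by (intro mult_right_mono) auto
  finally show ?thesis unfolding I_def by (simp add: mult.assoc)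
qed

lemma continuous_on_of_increment_bound:
  fixes f F :: "real \<Rightarrow> real"
  assumes F: "continuous_on S F" and C: "0 \<le> C"
    and b: "\<And>s t. s \<in> S \<Longrightarrow> t \<in> S \<Longrightarrow> s \<le> t \<Longrightarrow> \<bar>f t - f s\<bar> \<le> C * \<bar>F t - F s\<bar>"
  shows "continuous_on S f"
proof -
  have b': "\<bar>f t - f s\<bar> \<le> C * \<bar>F t - F s\<bar>" if "s \<in> S" "t \<in> S" for s t
    using b[of s t] b[of t s] that by (cases "s \<le> t") (auto simp: abs_minus_commute)
  show ?thesis
    unfolding continuous_on_def
  proof
    fix x assume x: "x \<in> S"
    have "((\<lambda>y. C * \<bar>F y - F x\<bar>) \<longlongrightarrow> C * \<bar>F x - F x\<bar>) (at x within S)"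
      using F x unfolding continuous_on_def by (intro tendsto_intros) auto
    then have "((\<lambda>y. C * \<bar>F y - F x\<bar>) \<longlongrightarrow> 0) (at x within S)" by simp
    then have "((\<lambda>y. f y - f x) \<longlongrightarrow> 0) (at x within S)"
      by (rule tendsto_rabs_zero_cancel[OF tendsto_sandwich[OF _ _ tendsto_const, rotated 2]])
         (use b' x in \<open>auto simp: eventually_at_filter\<close>)
    then show "(f \<longlongrightarrow> f x) (at x within S)" by (simp add: LIM_zero_iff)
  qed
qed

lemma has_derivative_of_LINT:
  fixes f g :: "real \<Rightarrow> real"
  assumes g: "continuous_on {0..T} g"
    and f: "\<And>s t. 0 \<le> s \<Longrightarrow> s \<le> t \<Longrightarrow> t \<le> T \<Longrightarrow> f t - f s = (LINT \<sigma>|lebesgue_on {s<..<t}. g \<sigma>)"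
    and t: "t \<in> {0..T}"
  shows "(f has_vector_derivative g t) (at t within {0..T})"
proof -
  have eq: "f s = f 0 + integral {0..s} g" if "s \<in> {0..T}" for s
  proof -
    have c: "continuous_on {0..s} g" using that by (intro continuous_on_subset[OF g]) auto
    have "g absolutely_integrable_on {0..s}" by (rule absolutely_integrable_continuous_real[OF c])
    then have "integrable (lebesgue_on {0..s}) g" by (simp add: integrable_restrict_space set_integrable_def)
    then have "integrable (lebesgue_on {0<..<s}) g" by (rule integrable_lebesgue_on_subset) auto
    then show ?thesis using f[of 0 s] that LINT_open_interval(2)[of 0 s g] by simp
  qed
  have "((\<lambda>s. f 0 + integral {0..s} g) has_vector_derivative g t) (at t within {0..T})"
    using integral_has_vector_derivative[OF g t] by (auto intro!: derivative_eq_intros)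
  from has_vector_derivative_transform[OF t _ this] show ?thesis using eq by blast
qed

locale smooth_evolution =
  fixes H :: "'a::real_inner set" and T :: real and \<nu> :: nat and u :: "real \<Rightarrow> 'a" and D :: "nat \<Rightarrow> real \<Rightarrow> 'a"
  assumes H: "subspace H" and \<nu>: "\<nu> \<in> {3, 4}"
    and u_H: "\<And>t. t \<in> {0..T} \<Longrightarrow> u t \<in> H" and D_H: "\<And>j t. j \<le> \<nu> \<Longrightarrow> t \<in> {0..T} \<Longrightarrow> D j t \<in> H"
    and u_incr: "primitive_of H T u (D 0)" and D_incr: "\<And>j. j \<le> \<nu> \<Longrightarrow> primitive_of H T (D j) (D (Suc j))"
    and D_int: "\<And>j. j \<le> \<nu> \<Longrightarrow> integrable (lebesgue_on {0<..<T}) (\<lambda>\<sigma>. norm (D (Suc j) \<sigma>))"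
begin

text \<open>
  Weak continuity suffices below, because the derivatives are only ever paired with one fixed element.
\<close>

lemma D_continuous:
  assumes j: "j \<le> \<nu>" and \<phi>: "\<phi> \<in> H"
  shows "continuous_on {0..T} (\<lambda>t. D j t \<bullet> \<phi>)"
proof (rule continuous_on_of_increment_bound)
  let ?n = "\<lambda>\<sigma>. norm (D (Suc j) \<sigma>)"
  have n: "?n integrable_on {0..T}" by (rule LINT_open_interval(1)[OF D_int[OF j]])
  show "continuous_on {0..T} (\<lambda>t. integral {0..t} ?n)"
    by (rule indefinite_integral_continuous_1[OF n])
  fix s t assume st: "s \<in> {0..T}" "t \<in> {0..T}" "s \<le> t"
  have i: "integrable (lebesgue_on {s<..<t}) ?n"
    using st by (intro integrable_lebesgue_on_subset[OF D_int[OF j]]) auto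
  have "\<bar>D j t \<bullet> \<phi> - D j s \<bullet> \<phi>\<bar> = \<bar>LINT \<sigma>|lebesgue_on {s<..<t}. D (Suc j) \<sigma> \<bullet> \<phi>\<bar>"
    using primitive_ofD[OF D_incr[OF j] \<phi>, of s t] st by (simp add: inner_diff_left)
  also have "\<dots> \<le> (LINT \<sigma>|lebesgue_on {s<..<t}. norm \<phi> * ?n \<sigma>)"
  proof (rule LINT_abs_le)
    show "AE \<sigma> in lebesgue_on {s<..<t}. \<bar>D (Suc j) \<sigma> \<bullet> \<phi>\<bar> \<le> norm \<phi> * ?n \<sigma>"
      by (rule AE_I2) (subst mult.commute, rule Cauchy_Schwarz_ineq2)
  qed (use i in simp)
  also have "\<dots> = norm \<phi> * integral {s..t} ?n" using i LINT_open_interval(2)[OF i] by simp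
  also have "integral {s..t} ?n = integral {0..t} ?n - integral {0..s} ?n"
    using Henstock_Kurzweil_Integration.integral_combine[of 0 s t ?n] st integrable_on_subinterval[OF n, of 0 t] by auto
  also have "norm \<phi> * (integral {0..t} ?n - integral {0..s} ?n) \<le> norm \<phi> * \<bar>integral {0..t} ?n - integral {0..s} ?n\<bar>"
    by (intro mult_left_mono) auto
  finally show "\<bar>D j t \<bullet> \<phi> - D j s \<bullet> \<phi>\<bar> \<le> norm \<phi> * \<bar>integral {0..t} ?n - integral {0..s} ?n\<bar>" .
qed simp

text \<open>
  By duality with the consistency error itself, the scalar estimate carries over.
\<close>

lemma consistency:
  assumes \<tau>: "0 < \<tau>" and c: "0 \<le> d - real \<nu> * \<tau>" and d: "d \<le> T"
  shows "norm ((\<Sum>j\<in>{1..\<nu>}. ab_coeff \<nu> j *\<^sub>R D 0 (d - real j * \<tau>)) - (1/\<tau>) *\<^sub>R (u d - u (d - \<tau>)))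
    \<le> 1000 * \<tau> ^ (\<nu> - 1) * (LINT \<sigma>|lebesgue_on {d - real \<nu> * \<tau><..<d}. norm (D \<nu> \<sigma>))" (is "norm ?e \<le> _")
proof -
  define c where "c = d - real \<nu> * \<tau>"
  have cc: "0 \<le> c" "c \<le> d" using assms \<tau> by (auto simp: c_def)
  have \<nu>1: "1 \<le> \<nu>" using \<nu> by auto
  have jin: "d - real j * \<tau> \<in> {0..T}" if "j \<le> \<nu>" for j
  proof -
    have "real j * \<tau> \<le> real \<nu> * \<tau>" using that \<tau> by (intro mult_right_mono) auto
    then have "0 \<le> d - real j * \<tau>" using c by linarith
    moreover have "d - real j * \<tau> \<le> d" using \<tau> by simp
    ultimately show ?thesis using d by simp
  qed
  have e: "?e \<in> H"
    using jin[of 0] jin[of 1] \<nu>1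
    by (intro subspace_diff[OF H] subspace_sum[OF H] subspace_scale[OF H] D_H u_H jin) auto
  let ?n = "\<lambda>\<sigma>. norm (D \<nu> \<sigma>)"
  have iT: "integrable (lebesgue_on {0<..<T}) ?n" using D_int[of "\<nu> - 1"] \<nu>1 by simp
  have i: "integrable (lebesgue_on {c<..<d}) ?n"
    using cc d by (intro integrable_lebesgue_on_subset[OF iT]) auto
  define Df where "Df m t = (case m of 0 \<Rightarrow> u t \<bullet> ?e | Suc j \<Rightarrow> D j t \<bullet> ?e)" for m t
  have Df_deriv: "(Df m has_vector_derivative Df (Suc m) t) (at t within {c..d})" if m: "m < Suc \<nu>" and t: "t \<in> {c..d}" for m t
  proof -
    have "(Df m has_vector_derivative Df (Suc m) t) (at t within {0..T})"
    proof (cases m)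
      case 0
      show ?thesis unfolding 0 Df_def nat.case
      proof (rule has_derivative_of_LINT)
        show "continuous_on {0..T} (\<lambda>t. D 0 t \<bullet> ?e)" by (rule D_continuous[OF _ e]) simp
        show "u t \<bullet> ?e - u s \<bullet> ?e = (LINT \<sigma>|lebesgue_on {s<..<t}. D 0 \<sigma> \<bullet> ?e)" if "0 \<le> s" "s \<le> t" "t \<le> T" for s t
          using primitive_ofD[OF u_incr e that] by (simp add: inner_diff_left)
      qed (use t cc d in auto)
    next
      case (Suc j)
      have j: "j \<le> \<nu>" "Suc j \<le> \<nu>" using m Suc by auto
      show ?thesis unfolding Suc Df_def nat.case
      proof (rule has_derivative_of_LINT)
        show "continuous_on {0..T} (\<lambda>t. D (Suc j) t \<bullet> ?e)" by (rule D_continuous[OF j(2) e])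
        show "D j t \<bullet> ?e - D j s \<bullet> ?e = (LINT \<sigma>|lebesgue_on {s<..<t}. D (Suc j) \<sigma> \<bullet> ?e)" if "0 \<le> s" "s \<le> t" "t \<le> T" for s t
          using primitive_ofD[OF D_incr[OF j(1)] e that] by (simp add: inner_diff_left)
      qed (use t cc d in auto)
    qed
    then show ?thesis by (rule has_vector_derivative_within_subset) (use cc d in auto)
  qed
  have "\<bar>(\<Sum>j\<in>{1..\<nu>}. ab_coeff \<nu> j * Df 1 (d - real j * \<tau>)) - (Df 0 d - Df 0 (d - \<tau>)) / \<tau>\<bar>
    \<le> 1000 * \<tau> ^ (\<nu> - 1) * (norm ?e * integral {c..d} ?n)"
    proof (rule ab_consistency_scalar[where Df=Df and n="?n", OF \<nu> \<tau> c_def Df_deriv LINT_open_interval(1)[OF i]])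
    show "\<bar>Df (Suc \<nu>) t\<bar> \<le> norm ?e * ?n t" for t
      unfolding Df_def nat.case by (subst mult.commute) (rule Cauchy_Schwarz_ineq2)
  qed auto
  moreover have "(\<Sum>j\<in>{1..\<nu>}. ab_coeff \<nu> j * Df 1 (d - real j * \<tau>)) - (Df 0 d - Df 0 (d - \<tau>)) / \<tau> = ?e \<bullet> ?e"
  proof -
    have "?e \<bullet> x = (\<Sum>j\<in>{1..\<nu>}. ab_coeff \<nu> j * (D 0 (d - real j * \<tau>) \<bullet> x)) - (u d \<bullet> x - u (d - \<tau>) \<bullet> x) / \<tau>" for x
      by (simp add: inner_diff_left inner_sum_left)
    then show ?thesis by (simp add: Df_def)
  qed
  ultimately have "norm ?e * norm ?e \<le> (1000 * \<tau> ^ (\<nu> - 1) * integral {c..d} ?n) * norm ?e"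
    by (simp add: dot_square_norm power2_eq_square mult_ac)
  moreover have "0 \<le> 1000 * \<tau> ^ (\<nu> - 1) * integral {c..d} ?n"
    using \<tau> LINT_open_interval(1)[OF i] by (intro mult_nonneg_nonneg integral_nonneg) auto
  ultimately have "norm ?e \<le> 1000 * \<tau> ^ (\<nu> - 1) * integral {c..d} ?n"
    by (cases "norm ?e = 0") auto
  then show ?thesis unfolding LINT_open_interval(2)[OF i, unfolded c_def] c_def .
qed

text \<open>
  Each consistency error sees \<open>\<nu>\<close> cells, and each cell is seen at most \<open>\<nu>\<close> times. With \<open>\<nu> \<le> 4\<close> this
  turns the constant \<open>1000\<^sup>2\<close> of \<open>consistency\<close> into \<open>4000\<^sup>2\<close>.
\<close>

lemma consistency_sum:
  assumes \<tau>: "0 < \<tau>" and N: "real N * \<tau> \<le> T"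
    and sq: "integrable (lebesgue_on {0<..<T}) (\<lambda>\<sigma>. (norm (D \<nu> \<sigma>))\<^sup>2)"
    and \<rho>: "\<And>n. \<nu> \<le> n \<Longrightarrow> n \<le> N \<Longrightarrow> \<rho> n = (\<Sum>j\<in>{1..\<nu>}. ab_coeff \<nu> j *\<^sub>R D 0 (real (n - j) * \<tau>))
        - (1/\<tau>) *\<^sub>R (u (real n * \<tau>) - u (real (n - 1) * \<tau>))"
  shows "\<tau> * (\<Sum>n\<in>{\<nu>..N}. (norm (\<rho> n))\<^sup>2) \<le> (4000 * \<tau> ^ \<nu> * sqrt (LINT \<sigma>|lebesgue_on {0<..<T}. (norm (D \<nu> \<sigma>))\<^sup>2))\<^sup>2"
proof -
  define I where "I = (LINT \<sigma>|lebesgue_on {0<..<T}. (norm (D \<nu> \<sigma>))\<^sup>2)"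
  define q where "q k = (LINT \<sigma>|lebesgue_on (grid_cell \<tau> k). (norm (D \<nu> \<sigma>))\<^sup>2)" for k
  have I0: "0 \<le> I" unfolding I_def by (intro integral_nonneg_AE) auto
  have q0: "0 \<le> q k" for k unfolding q_def by (intro integral_nonneg_AE) auto
  have \<nu>1: "1 \<le> \<nu>" "\<nu> \<le> 4" using \<nu> by auto
  have iT: "integrable (lebesgue_on {0<..<T}) (\<lambda>\<sigma>. norm (D \<nu> \<sigma>))" using D_int[of "\<nu> - 1"] \<nu>1 by simp
  have step: "\<tau> * (norm (\<rho> n))\<^sup>2 \<le> 4000000 * (\<tau> ^ \<nu>)\<^sup>2 * (\<Sum>j\<in>{1..\<nu>}. q (n - j))"
    if n: "n \<in> {\<nu>..N}" for n
  proof -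
    define d c where "d = real n * \<tau>" and "c = real n * \<tau> - real \<nu> * \<tau>"
    have nN: "real n * \<tau> \<le> real N * \<tau>" "real \<nu> * \<tau> \<le> real n * \<tau>" using n \<tau> by (auto intro!: mult_right_mono)
    have "0 < real \<nu> * \<tau>" using \<nu>1 \<tau> by simp
    then have d: "0 \<le> c" "d \<le> T" "c < d" unfolding c_def d_def using N nN by linarith+
    have sub: "{c<..<d} \<subseteq> {0<..<T}" using d by auto
    have lag: "real (n - j) * \<tau> = d - real j * \<tau>" if "j \<le> \<nu>" for j
      using that n unfolding d_def by (simp add: of_nat_diff algebra_simps)
    have "\<rho> n = (\<Sum>j\<in>{1..\<nu>}. ab_coeff \<nu> j *\<^sub>R D 0 (d - real j * \<tau>)) - (1/\<tau>) *\<^sub>R (u d - u (d - \<tau>))"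
      using \<rho>[of n] n lag lag[of 1] \<nu>1 unfolding d_def by simp
    then have "norm (\<rho> n) \<le> 1000 * \<tau> ^ (\<nu> - 1) * (LINT \<sigma>|lebesgue_on {c<..<d}. norm (D \<nu> \<sigma>))"
      using consistency[OF \<tau>, of d] d unfolding c_def d_def by simp
    then have "(norm (\<rho> n))\<^sup>2 \<le> (1000 * \<tau> ^ (\<nu> - 1) * (LINT \<sigma>|lebesgue_on {c<..<d}. norm (D \<nu> \<sigma>)))\<^sup>2"
      by (intro power_mono) auto
    also have "\<dots> = 1000000 * (\<tau> ^ (\<nu> - 1))\<^sup>2 * (LINT \<sigma>|lebesgue_on {c<..<d}. norm (D \<nu> \<sigma>))\<^sup>2"
      by (simp add: power_mult_distrib)
    also have "\<dots> \<le> 1000000 * (\<tau> ^ (\<nu> - 1))\<^sup>2 * ((d - c) * (LINT \<sigma>|lebesgue_on {c<..<d}. (norm (D \<nu> \<sigma>))\<^sup>2))"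
      using d by (intro mult_left_mono LINT_square_le integrable_lebesgue_on_subset[OF iT sub] integrable_lebesgue_on_subset[OF sq sub]) auto
    also have "(LINT \<sigma>|lebesgue_on {c<..<d}. (norm (D \<nu> \<sigma>))\<^sup>2) = (\<Sum>j\<in>{1..\<nu>}. q (n - j))"
    proof -
      let ?f = "\<lambda>\<sigma>. (norm (D \<nu> \<sigma>))\<^sup>2"
      have L: "(LINT \<sigma>|lebesgue_on {s<..<t}. ?f \<sigma>) = integral {s..t} ?f" "?f integrable_on {s..t}" if "0 \<le> s" "t \<le> T" for s t
      proof -
        have "integrable (lebesgue_on {s<..<t}) ?f" using that by (intro integrable_lebesgue_on_subset[OF sq]) auto
        then show "(LINT \<sigma>|lebesgue_on {s<..<t}. ?f \<sigma>) = integral {s..t} ?f" "?f integrable_on {s..t}"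
          by (rule LINT_open_interval)+
      qed
      have "(LINT \<sigma>|lebesgue_on {d - real m * \<tau><..<d}. ?f \<sigma>) = (\<Sum>j\<in>{1..m}. q (n - j))" if "m \<le> \<nu>" for m
        using that
      proof (induction m)
        case (Suc m)
        have m0: "0 \<le> d - real (Suc m) * \<tau>" 
        proof -
          have "0 \<le> real (n - Suc m) * \<tau>" using \<tau> by simp
          then show ?thesis unfolding lag[OF Suc.prems] .
        qed
        have s: "Suc (n - Suc m) = n - m" using Suc.prems n by auto
        have m1: "real (n - Suc m) * \<tau> = d - real (Suc m) * \<tau>" "real (Suc (n - Suc m)) * \<tau> = d - real m * \<tau>"
          using lag[of "Suc m"] lag[of m] Suc.prems unfolding s by auto
        have le: "d - real (Suc m) * \<tau> \<le> d - real m * \<tau>" "d - real m * \<tau> \<le> d" using \<tau> by (auto simp: algebra_simps)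
        have "integral {d - real (Suc m) * \<tau>..d - real m * \<tau>} ?f + integral {d - real m * \<tau>..d} ?f = integral {d - real (Suc m) * \<tau>..d} ?f"
          using m0 d by (intro Henstock_Kurzweil_Integration.integral_combine le L(2)) auto
        moreover have "q (n - Suc m) = integral {d - real (Suc m) * \<tau>..d - real m * \<tau>} ?f"
          unfolding q_def m1 using m0 le d by (intro L(1)) linarith+
        moreover have "(\<Sum>j\<in>{1..m}. q (n - j)) = integral {d - real m * \<tau>..d} ?f"
          using Suc.IH Suc.prems L(1)[of "d - real m * \<tau>" d] m0 le d by simp
        moreover have "(LINT \<sigma>|lebesgue_on {d - real (Suc m) * \<tau><..<d}. ?f \<sigma>) = integral {d - real (Suc m) * \<tau>..d} ?f"
          using m0 d by (intro L(1)) auto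
        ultimately show ?case by (simp add: atLeastAtMostSuc_conv)
      qed simp
      from this[of \<nu>] show ?thesis unfolding c_def d_def by simp
    qed
    finally have "(norm (\<rho> n))\<^sup>2 \<le> 1000000 * (\<tau> ^ (\<nu> - 1))\<^sup>2 * ((d - c) * (\<Sum>j\<in>{1..\<nu>}. q (n - j)))" .
    then have "\<tau> * (norm (\<rho> n))\<^sup>2 \<le> \<tau> * (1000000 * (\<tau> ^ (\<nu> - 1))\<^sup>2 * ((d - c) * (\<Sum>j\<in>{1..\<nu>}. q (n - j))))"
      using \<tau> by (intro mult_left_mono) auto
    also have "\<dots> = 1000000 * real \<nu> * ((\<tau> * \<tau> ^ (\<nu> - 1))\<^sup>2 * (\<Sum>j\<in>{1..\<nu>}. q (n - j)))"
      unfolding c_def d_def by (simp add: power2_eq_square)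
    also have "\<tau> * \<tau> ^ (\<nu> - 1) = \<tau> ^ \<nu>" using \<nu>1 by (simp add: power_eq_if)
    also have "1000000 * real \<nu> * ((\<tau> ^ \<nu>)\<^sup>2 * (\<Sum>j\<in>{1..\<nu>}. q (n - j))) \<le> 1000000 * 4 * ((\<tau> ^ \<nu>)\<^sup>2 * (\<Sum>j\<in>{1..\<nu>}. q (n - j)))"
      using \<nu>1 q0 by (intro mult_right_mono mult_left_mono mult_nonneg_nonneg sum_nonneg) auto
    finally show ?thesis by simp
  qed
  have "\<tau> * (\<Sum>n\<in>{\<nu>..N}. (norm (\<rho> n))\<^sup>2) \<le> (\<Sum>n\<in>{\<nu>..N}. 4000000 * (\<tau> ^ \<nu>)\<^sup>2 * (\<Sum>j\<in>{1..\<nu>}. q (n - j)))"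
    unfolding sum_distrib_left[where f="\<lambda>n. (norm (\<rho> n))\<^sup>2"] by (intro sum_mono step)
  also have "\<dots> = 4000000 * (\<tau> ^ \<nu>)\<^sup>2 * (\<Sum>j\<in>{1..\<nu>}. \<Sum>n\<in>{\<nu>..N}. q (n - j))"
    unfolding sum_distrib_left[symmetric] by (simp only: sum.swap[of _ "{1..\<nu>}"])
  also have "\<dots> \<le> 4000000 * (\<tau> ^ \<nu>)\<^sup>2 * (\<Sum>j\<in>{1..\<nu>}. I)"
  proof (intro mult_left_mono sum_mono)
    fix j assume "j \<in> {1..\<nu>}"
    then have "(\<Sum>n\<in>{\<nu>..N}. q (n - j)) \<le> (\<Sum>k<N. q k)" by (intro sum_lag_le q0) auto
    also have "\<dots> \<le> I" unfolding q_def I_def by (intro sum_cells_le sq N \<tau>) auto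
    finally show "(\<Sum>n\<in>{\<nu>..N}. q (n - j)) \<le> I" .
  qed auto
  also have "\<dots> \<le> 4000000 * (\<tau> ^ \<nu>)\<^sup>2 * (4 * I)"
    using \<nu>1 I0 by (intro mult_left_mono) (auto intro: mult_right_mono)
  also have "\<dots> = (4000 * \<tau> ^ \<nu> * sqrt I)\<^sup>2" using I0 by (simp add: power_mult_distrib)
  finally show ?thesis unfolding I_def .
qed

end

section \<open>The Hilbert space of square integrable functions\<close>

text \<open>
  To use the library of inner product spaces, functions on \<open>\<Omega>\<close> are extended by zero and identified
  when they agree almost everywhere. The type does not depend on \<open>\<Omega>\<close>, so that \<open>L\<^sup>2(\<Omega>)\<close> becomes a
  subspace of \<open>L\<^sup>2\<close> of the whole space.
\<close>

definition sq_integrable :: "('a::euclidean_space \<Rightarrow> 'b::euclidean_space) \<Rightarrow> bool" where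
  "sq_integrable f \<longleftrightarrow> f \<in> borel_measurable lebesgue \<and> integrable lebesgue (\<lambda>x. (norm (f x))\<^sup>2)"

lemma sq_integrable_bound:
  assumes "f \<in> borel_measurable lebesgue" "integrable lebesgue g" "\<And>x. (norm (f x))\<^sup>2 \<le> g x"
  shows "sq_integrable f"
  unfolding sq_integrable_def using assms(1)
proof (intro conjI)
  show "integrable lebesgue (\<lambda>x. (norm (f x))\<^sup>2)"
    by (rule Bochner_Integration.integrable_bound[OF assms(2)])
       (use assms in \<open>auto intro!: AE_I2 order_trans[OF _ abs_ge_self]\<close>)
qed

lemma sq_integrable_0: "sq_integrable (\<lambda>x. 0)"
  by (simp add: sq_integrable_def)

lemma norm_add_sq_le: "(norm (a + b))\<^sup>2 \<le> 2 * (norm a)\<^sup>2 + 2 * (norm (b::'a::real_normed_vector))\<^sup>2"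
proof -
  have "(norm (a + b))\<^sup>2 \<le> (norm a + norm b)\<^sup>2" by (intro power_mono norm_triangle_ineq) auto
  also have "\<dots> \<le> 2 * (norm a)\<^sup>2 + 2 * (norm b)\<^sup>2"
    using zero_le_power2[of "norm a - norm b"] by (simp add: power2_eq_square algebra_simps)
  finally show ?thesis .
qed

lemma sq_integrable_add: "sq_integrable f \<Longrightarrow> sq_integrable g \<Longrightarrow> sq_integrable (\<lambda>x. f x + g x)"
  by (rule sq_integrable_bound[where g="\<lambda>x. 2 * (norm (f x))\<^sup>2 + 2 * (norm (g x))\<^sup>2"])
     (auto simp: sq_integrable_def norm_add_sq_le)

lemma sq_integrable_scaleR: "sq_integrable f \<Longrightarrow> sq_integrable (\<lambda>x. a *\<^sub>R f x)"
  by (auto simp: sq_integrable_def power_mult_distrib)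

lemma sq_integrable_uminus: "sq_integrable f \<Longrightarrow> sq_integrable (\<lambda>x. - f x)"
  using sq_integrable_scaleR[of f "-1"] by simp

lemma sq_integrable_diff: "sq_integrable f \<Longrightarrow> sq_integrable g \<Longrightarrow> sq_integrable (\<lambda>x. f x - g x)"
  using sq_integrable_add[OF _ sq_integrable_uminus, of f g] by simp

lemma integrable_inner_sq:
  assumes "sq_integrable f" "sq_integrable g"
  shows "integrable lebesgue (\<lambda>x. f x \<bullet> g x)"
proof (rule Bochner_Integration.integrable_bound)
  show "integrable lebesgue (\<lambda>x. (norm (f x))\<^sup>2 + (norm (g x))\<^sup>2)"
    using assms by (auto simp: sq_integrable_def)
  show "(\<lambda>x. f x \<bullet> g x) \<in> borel_measurable lebesgue"
    using assms by (auto simp: sq_integrable_def)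
  have "\<bar>u \<bullet> v\<bar> \<le> (norm u)\<^sup>2 + (norm v)\<^sup>2" for u v :: 'b
  proof -
    have "norm u * norm v \<le> (norm u)\<^sup>2 + (norm v)\<^sup>2"
      using zero_le_power2[of "norm u - norm v"] zero_le_power2[of "norm u"] zero_le_power2[of "norm v"]
      by (simp only: power2_diff)
    then show ?thesis using Cauchy_Schwarz_ineq2[of u v] by linarith
  qed
  then show "AE x in lebesgue. norm (f x \<bullet> g x) \<le> norm ((norm (f x))\<^sup>2 + (norm (g x))\<^sup>2)"
    by (auto intro!: AE_I2 order_trans[OF _ abs_ge_self])
qed

definition l2_eq :: "('a::euclidean_space \<Rightarrow> 'b::euclidean_space) \<Rightarrow> ('a \<Rightarrow> 'b) \<Rightarrow> bool" where
  "l2_eq f g \<longleftrightarrow> sq_integrable f \<and> sq_integrable g \<and> (AE x in lebesgue. f x = g x)"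

quotient_type (overloaded) ('a, 'b) l2 = "'a::euclidean_space \<Rightarrow> 'b::euclidean_space" / partial: l2_eq
proof (rule part_equivpI)
  show "\<exists>x. l2_eq x x" using sq_integrable_0 by (auto simp: l2_eq_def)
  show "symp l2_eq" by (auto simp: symp_def l2_eq_def)
  show "transp l2_eq" by (auto simp: transp_def l2_eq_def)
qed

instantiation l2 :: (euclidean_space, euclidean_space) real_vector
begin

lift_definition zero_l2 :: "('a, 'b) l2" is "\<lambda>x. 0" by (simp add: l2_eq_def sq_integrable_0)
lift_definition plus_l2 :: "('a, 'b) l2 \<Rightarrow> ('a, 'b) l2 \<Rightarrow> ('a, 'b) l2" is "\<lambda>f g x. f x + g x"
  by (auto simp: l2_eq_def sq_integrable_add)
lift_definition minus_l2 :: "('a, 'b) l2 \<Rightarrow> ('a, 'b) l2 \<Rightarrow> ('a, 'b) l2" is "\<lambda>f g x. f x - g x"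
  by (auto simp: l2_eq_def sq_integrable_diff)
lift_definition uminus_l2 :: "('a, 'b) l2 \<Rightarrow> ('a, 'b) l2" is "\<lambda>f x. - f x"
  by (auto simp: l2_eq_def sq_integrable_uminus)
lift_definition scaleR_l2 :: "real \<Rightarrow> ('a, 'b) l2 \<Rightarrow> ('a, 'b) l2" is "\<lambda>a f x. a *\<^sub>R f x"
  by (auto simp: l2_eq_def sq_integrable_scaleR)
instance
proof
  fix f g h :: "('a, 'b) l2" and a b :: real
  show "f + g + h = f + (g + h)"
    by transfer (auto simp: l2_eq_def algebra_simps intro!: sq_integrable_add)
  show "f + g = g + f"
    by transfer (auto simp: l2_eq_def algebra_simps intro!: sq_integrable_add)
  show "0 + f = f" by transfer (auto simp: l2_eq_def)
  show "- f + f = 0" by transfer (auto simp: l2_eq_def sq_integrable_0)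
  show "f - g = f + - g"
    by transfer (auto simp: l2_eq_def intro!: sq_integrable_diff)
  show "a *\<^sub>R (f + g) = a *\<^sub>R f + a *\<^sub>R g"
    by transfer (auto simp: l2_eq_def scaleR_add_right intro!: sq_integrable_add sq_integrable_scaleR)
  show "(a + b) *\<^sub>R f = a *\<^sub>R f + b *\<^sub>R f"
    by transfer (auto simp: l2_eq_def scaleR_add_left intro!: sq_integrable_add sq_integrable_scaleR)
  show "a *\<^sub>R b *\<^sub>R f = (a * b) *\<^sub>R f"
    by transfer (auto simp: l2_eq_def intro!: sq_integrable_scaleR)
  show "1 *\<^sub>R f = f" by transfer (auto simp: l2_eq_def)
qed

end

instantiation l2 :: (euclidean_space, euclidean_space) real_inner
begin

lift_definition inner_l2 :: "('a, 'b) l2 \<Rightarrow> ('a, 'b) l2 \<Rightarrow> real" is "\<lambda>f g. LINT x|lebesgue. f x \<bullet> g x"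
  by (rule integral_cong_AE) (auto simp: l2_eq_def sq_integrable_def)

definition norm_l2 :: "('a, 'b) l2 \<Rightarrow> real" where "norm_l2 f = sqrt (inner f f)"
definition dist_l2 :: "('a, 'b) l2 \<Rightarrow> ('a, 'b) l2 \<Rightarrow> real" where "dist_l2 f g = norm (f - g)"
definition sgn_l2 :: "('a, 'b) l2 \<Rightarrow> ('a, 'b) l2" where "sgn_l2 f = f /\<^sub>R norm f"
definition uniformity_l2 :: "(('a, 'b) l2 \<times> ('a, 'b) l2) filter" where
  "uniformity_l2 = (INF e\<in>{0 <..}. principal {(f, g). dist f g < e})"
definition open_l2 :: "('a, 'b) l2 set \<Rightarrow> bool" where
  "open_l2 S \<longleftrightarrow> (\<forall>f\<in>S. \<forall>\<^sub>F (f', g) in uniformity. f' = f \<longrightarrow> g \<in> S)"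

instance
proof
  fix f g h :: "('a, 'b) l2" and a b :: real
  show "dist f g = norm (f - g)" by (rule dist_l2_def)
  show "sgn f = f /\<^sub>R norm f" by (rule sgn_l2_def)
  show "uniformity = (INF e\<in>{0 <..}. principal {(f::('a, 'b) l2, g). dist f g < e})" by (rule uniformity_l2_def)
  show "open S = (\<forall>f\<in>S. \<forall>\<^sub>F (f', g) in uniformity. f' = f \<longrightarrow> g \<in> S)" for S :: "('a, 'b) l2 set"
    by (rule open_l2_def)
  show "inner f g = inner g f" by transfer (simp add: inner_commute)
  show "inner (f + g) h = inner f h + inner g h"
    by transfer (auto simp: l2_eq_def inner_add_left integrable_inner_sq)
  show "inner (a *\<^sub>R f) g = a * inner f g" by transfer auto
  show "0 \<le> inner f f" by transfer (auto intro: integral_nonneg_AE)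
  show "(inner f f = 0) = (f = 0)"
  proof transfer
    fix f :: "'a \<Rightarrow> 'b" assume "l2_eq f f"
    then have f: "sq_integrable f" by (simp add: l2_eq_def)
    have "((LINT x|lebesgue. f x \<bullet> f x) = 0) \<longleftrightarrow> (AE x in lebesgue. f x \<bullet> f x = 0)"
      by (rule integral_nonneg_eq_0_iff_AE) (auto intro: integrable_inner_sq f)
    then show "((LINT x|lebesgue. f x \<bullet> f x) = 0) = l2_eq f (\<lambda>x. 0)"
      using f by (simp add: l2_eq_def sq_integrable_0)
  qed
  show "norm f = sqrt (inner f f)" by (rule norm_l2_def)
qed

end

text \<open>
  Off \<open>l2_space \<Omega>\<close> the value is \<open>0\<close>. This concerns time-dependent functions, whose values lie in
  \<open>L\<^sup>2(\<Omega>)\<close> for almost every time only.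
\<close>

definition emb :: "(real^'d) set \<Rightarrow> (real^'d \<Rightarrow> real^'m) \<Rightarrow> (real^'d, real^'m) l2" where
  "emb \<Omega> u = (if u \<in> l2_space \<Omega> then abs_l2 (\<lambda>x. indicator \<Omega> x *\<^sub>R u x) else 0)"

lemma l2_space_extend_iff:
  assumes "\<Omega> \<in> sets lebesgue"
  shows "u \<in> l2_space \<Omega> \<longleftrightarrow> sq_integrable (\<lambda>x. indicator \<Omega> x *\<^sub>R u x)"
proof -
  have "(\<lambda>x. (norm (indicator \<Omega> x *\<^sub>R u x))\<^sup>2) = (\<lambda>x. indicator \<Omega> x *\<^sub>R (norm (u x))\<^sup>2)"
    by (auto simp: indicator_def)
  then show ?thesis using assms
    by (simp add: sq_integrable_def l2_space_def borel_measurable_restrict_space_iff integrable_restrict_space)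
qed

lemmas l2_space_extend = l2_space_extend_iff[THEN iffD1]

lemma l2_eq_extend: "\<Omega> \<in> sets lebesgue \<Longrightarrow> u \<in> l2_space \<Omega> \<Longrightarrow>
  l2_eq (\<lambda>x. indicator \<Omega> x *\<^sub>R u x) (\<lambda>x. indicator \<Omega> x *\<^sub>R u x)"
  by (simp add: l2_eq_def l2_space_extend)

lemma inner_emb:
  assumes "\<Omega> \<in> sets lebesgue" "u \<in> l2_space \<Omega>" "v \<in> l2_space \<Omega>"
  shows "emb \<Omega> u \<bullet> emb \<Omega> v = l2_inner \<Omega> u v"
proof -
  have "emb \<Omega> u \<bullet> emb \<Omega> v = (LINT x|lebesgue. (indicator \<Omega> x *\<^sub>R u x) \<bullet> (indicator \<Omega> x *\<^sub>R v x))"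
    using assms by (simp add: emb_def inner_l2.abs_eq l2_eq_extend)
  also have "\<dots> = (LINT x|lebesgue. indicator \<Omega> x *\<^sub>R (u x \<bullet> v x))"
    by (intro Bochner_Integration.integral_cong refl) (simp add: indicator_def)
  also have "\<dots> = l2_inner \<Omega> u v"
    unfolding l2_inner_def using assms(1) by (subst integral_restrict_space) auto
  finally show ?thesis .
qed

lemma norm_emb: "\<Omega> \<in> sets lebesgue \<Longrightarrow> u \<in> l2_space \<Omega> \<Longrightarrow> norm (emb \<Omega> u) = l2_norm \<Omega> u"
  by (simp add: norm_eq_sqrt_inner inner_emb l2_norm_def)

lemma l2_space_add: "\<Omega> \<in> sets lebesgue \<Longrightarrow> u \<in> l2_space \<Omega> \<Longrightarrow> v \<in> l2_space \<Omega> \<Longrightarrow> (\<lambda>x. u x + v x) \<in> l2_space \<Omega>"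
  using sq_integrable_add[of "\<lambda>x. indicator \<Omega> x *\<^sub>R u x" "\<lambda>x. indicator \<Omega> x *\<^sub>R v x"]
  by (simp add: l2_space_extend_iff scaleR_add_right)

lemma l2_space_scaleR: "\<Omega> \<in> sets lebesgue \<Longrightarrow> u \<in> l2_space \<Omega> \<Longrightarrow> (\<lambda>x. a *\<^sub>R u x) \<in> l2_space \<Omega>"
  using sq_integrable_scaleR[of "\<lambda>x. indicator \<Omega> x *\<^sub>R u x" a]
  by (simp add: l2_space_extend_iff mult.commute)

lemma l2_space_0: "\<Omega> \<in> sets lebesgue \<Longrightarrow> (\<lambda>x. 0) \<in> l2_space \<Omega>"
  by (simp add: l2_space_extend_iff sq_integrable_0)

lemma l2_space_diff: "\<Omega> \<in> sets lebesgue \<Longrightarrow> u \<in> l2_space \<Omega> \<Longrightarrow> v \<in> l2_space \<Omega> \<Longrightarrow> (\<lambda>x. u x - v x) \<in> l2_space \<Omega>"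
  using l2_space_add[of \<Omega> u "\<lambda>x. (-1) *\<^sub>R v x"] l2_space_scaleR[of \<Omega> v "-1"] by simp

lemma emb_add: "\<Omega> \<in> sets lebesgue \<Longrightarrow> u \<in> l2_space \<Omega> \<Longrightarrow> v \<in> l2_space \<Omega> \<Longrightarrow>
    emb \<Omega> (\<lambda>x. u x + v x) = emb \<Omega> u + emb \<Omega> v"
  by (simp add: emb_def l2_space_add plus_l2.abs_eq l2_eq_extend scaleR_add_right)

lemma emb_scaleR: "\<Omega> \<in> sets lebesgue \<Longrightarrow> u \<in> l2_space \<Omega> \<Longrightarrow> emb \<Omega> (\<lambda>x. a *\<^sub>R u x) = a *\<^sub>R emb \<Omega> u"
  by (simp add: emb_def l2_space_scaleR scaleR_l2.abs_eq l2_eq_extend mult.commute)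

lemma emb_0: "\<Omega> \<in> sets lebesgue \<Longrightarrow> emb \<Omega> (\<lambda>x. 0) = 0"
  by (simp add: emb_def zero_l2_def)

lemma emb_diff: "\<Omega> \<in> sets lebesgue \<Longrightarrow> u \<in> l2_space \<Omega> \<Longrightarrow> v \<in> l2_space \<Omega> \<Longrightarrow>
    emb \<Omega> (\<lambda>x. u x - v x) = emb \<Omega> u - emb \<Omega> v"
  by (simp add: emb_def l2_space_diff minus_l2.abs_eq l2_eq_extend scaleR_diff_right)

lemma emb_sum:
  assumes "\<Omega> \<in> sets lebesgue" "finite I" "\<And>i. i \<in> I \<Longrightarrow> u i \<in> l2_space \<Omega>"
  shows "(\<lambda>x. \<Sum>i\<in>I. c i *\<^sub>R u i x) \<in> l2_space \<Omega> \<and>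
    emb \<Omega> (\<lambda>x. \<Sum>i\<in>I. c i *\<^sub>R u i x) = (\<Sum>i\<in>I. c i *\<^sub>R emb \<Omega> (u i))"
  using assms(2,3)
proof (induction I rule: finite_induct)
  case (insert i I)
  then show ?case using assms(1)
    by (simp add: l2_space_add l2_space_scaleR emb_add emb_scaleR)
qed (use assms(1) in \<open>simp add: emb_0 l2_space_0\<close>)

lemma emb_cong_AE:
  assumes "\<Omega> \<in> sets lebesgue" "u \<in> l2_space \<Omega>" "v \<in> l2_space \<Omega>" "AE x in lebesgue_on \<Omega>. u x = v x"
  shows "emb \<Omega> u = emb \<Omega> v"
proof -
  have "AE x in lebesgue. x \<in> \<Omega> \<longrightarrow> u x = v x"
    using assms(1,4) by (simp add: AE_restrict_space_iff)
  then have "AE x in lebesgue. indicator \<Omega> x *\<^sub>R u x = indicator \<Omega> x *\<^sub>R v x"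
    by eventually_elim (auto simp: indicator_def)
  then have "l2_eq (\<lambda>x. indicator \<Omega> x *\<^sub>R u x) (\<lambda>x. indicator \<Omega> x *\<^sub>R v x)"
    using assms by (simp add: l2_eq_def l2_space_extend)
  then show ?thesis using assms(2,3) by (simp add: emb_def Quotient3_rel_abs[OF Quotient3_l2])
qed

section \<open>The differential operator as a skew operator on the Hilbert space\<close>

text \<open>
  Completeness of Lebesgue measure makes integrability insensitive to null sets.
\<close>

lemma integrable_cong_AE_lebesgue:
  fixes f g :: "real \<Rightarrow> real"
  assumes S: "S \<in> sets lebesgue" and fg: "AE x in lebesgue_on S. f x = g x" and f: "integrable (lebesgue_on S) f"
  shows "integrable (lebesgue_on S) g"
proof -
  have "AE x in lebesgue. x \<in> S \<longrightarrow> f x = g x" using fg S by (simp add: AE_restrict_space_iff)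
  then obtain N where N: "{x \<in> space lebesgue. \<not> (x \<in> S \<longrightarrow> f x = g x)} \<subseteq> N" "N \<in> null_sets lebesgue"
    by (auto simp: eventually_ae_filter)
  have "f absolutely_integrable_on S" using f S by (simp add: integrable_restrict_space set_integrable_def)
  then have "g absolutely_integrable_on S"
    by (rule absolutely_integrable_spike[where S=N]) (use N in \<open>auto simp: negligible_iff_null_sets\<close>)
  then show ?thesis using S by (simp add: integrable_restrict_space set_integrable_def)
qed

lemma LINT_cong_AE_lebesgue:
  fixes f g :: "real \<Rightarrow> real"
  assumes S: "S \<in> sets lebesgue" and fg: "AE x in lebesgue_on S. f x = g x"
  shows "(LINT x|lebesgue_on S. f x) = (LINT x|lebesgue_on S. g x)"
proof -
  have gf: "AE x in lebesgue_on S. g x = f x" using fg by eventually_elim simp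
  show ?thesis
  proof (cases "integrable (lebesgue_on S) f")
    case True
    then show ?thesis using integrable_cong_AE_lebesgue[OF S fg True] fg
      by (intro integral_cong_AE) auto
  next
    case False
    then have "\<not> integrable (lebesgue_on S) g" using integrable_cong_AE_lebesgue[OF S gf] by blast
    then show ?thesis using False by (simp add: not_integrable_integral_eq)
  qed
qed

text \<open>
  A Gram--Schmidt step: the component of \<open>b\<close> orthogonal to \<open>span B\<close> supplies the new direction.
\<close>

lemma ex_orthogonal_projection_span:
  fixes B :: "'a::real_inner set"
  assumes "finite B"
  shows "\<exists>p\<in>span B. \<forall>w\<in>span B. (x - p) \<bullet> w = 0"
  using assms
proof (induction B arbitrary: x rule: finite_induct)
  case empty
  then show ?case by simp
next
  case (insert b B)
  obtain q where q: "q \<in> span B" "\<forall>w\<in>span B. (b - q) \<bullet> w = 0" using insert.IH by blast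
  obtain p where p: "p \<in> span B" "\<forall>w\<in>span B. (x - p) \<bullet> w = 0" using insert.IH by blast
  define c where "c = b - q"
  define p' where "p' = p + ((x \<bullet> c) / (c \<bullet> c)) *\<^sub>R c"
  have sub: "span B \<subseteq> span (insert b B)" by (rule span_mono) auto
  have c: "c \<in> span (insert b B)" unfolding c_def by (intro span_diff subsetD[OF sub q(1)] span_base) simp
  have pc: "p \<bullet> c = 0" "c \<bullet> w = 0" if "w \<in> span B" for w
    using q(2) p(1) that unfolding c_def by (auto simp: inner_commute)
  have p': "p' \<in> span (insert b B)" unfolding p'_def by (intro span_add span_scale subsetD[OF sub p(1)] c)
  have xc: "(x - p') \<bullet> c = 0"
    unfolding p'_def using pc(1)[OF p(1)] by (cases "c = 0") (simp_all add: inner_diff_left inner_add_left)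
  have "(x - p') \<bullet> w = 0" if w: "w \<in> span (insert b B)" for w
  proof -
    obtain k where k: "w - k *\<^sub>R b \<in> span B" using w unfolding span_breakdown_eq by blast
    define v where "v = (w - k *\<^sub>R b) + k *\<^sub>R q"
    have v: "v \<in> span B" unfolding v_def using k q(1) by (intro span_add span_scale)
    have w': "w = v + k *\<^sub>R c" unfolding v_def c_def by (simp add: algebra_simps)
    have "(x - p') \<bullet> v = 0"
      using p(2) v pc(2)[OF v] unfolding p'_def by (simp add: inner_diff_left inner_add_left)
    then show ?thesis unfolding w' using xc by (simp add: inner_add_right)
  qed
  then show ?case using p' by blast
qed

lemma l2_norm_nonneg: "0 \<le> l2_norm \<Omega> u"
  unfolding l2_norm_def l2_inner_def by (auto intro: integral_nonneg_AE)

lemma gagliardo_quot_nonneg: "0 \<le> gagliardo_quot \<Omega> \<theta> \<alpha> u z"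
  unfolding gagliardo_quot_def by (cases z) simp

lemma sobolev_norm_nonneg: "0 \<le> sobolev_norm \<Omega> r u"
  unfolding sobolev_norm_def
  by (intro real_sqrt_ge_zero add_nonneg_nonneg sum_nonneg)
     (auto intro!: sum_nonneg integral_nonneg_AE gagliardo_quot_nonneg)

locale l2_operator =
  fixes \<Omega> :: "(real^'d) set" and V :: "(real^'d \<Rightarrow> real^'m) set" and G :: "(real^'d \<Rightarrow> real^'m) \<Rightarrow> (real^'d \<Rightarrow> real^'m)"
  assumes \<Omega>: "\<Omega> \<in> sets lebesgue" and V_l2: "V \<subseteq> l2_space \<Omega>" and V_sub: "ae_subspace \<Omega> V"
    and V_dense: "l2_dense \<Omega> V" and G_l2: "\<And>u. u \<in> V \<Longrightarrow> G u \<in> l2_space \<Omega>"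
    and G_skew: "\<And>u v. u \<in> V \<Longrightarrow> v \<in> V \<Longrightarrow> l2_inner \<Omega> (G u) v = - l2_inner \<Omega> u (G v)"
begin

abbreviation E :: "(real^'d \<Rightarrow> real^'m) \<Rightarrow> (real^'d, real^'m) l2" where "E \<equiv> emb \<Omega>"

lemma V_in_l2: "u \<in> V \<Longrightarrow> u \<in> l2_space \<Omega>" using V_l2 by auto

lemma V_add: "u \<in> V \<Longrightarrow> v \<in> V \<Longrightarrow> (\<lambda>x. u x + v x) \<in> V"
  and V_scaleR: "u \<in> V \<Longrightarrow> (\<lambda>x. a *\<^sub>R u x) \<in> V"
  and V_0: "(\<lambda>x. 0) \<in> V"
  using V_sub unfolding ae_subspace_def by blast+

lemma V_diff: "u \<in> V \<Longrightarrow> v \<in> V \<Longrightarrow> (\<lambda>x. u x - v x) \<in> V"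
  using V_add[OF _ V_scaleR[of v "-1"], of u] by simp

lemma subspace_emb:
  assumes S: "S \<subseteq> l2_space \<Omega>" "(\<lambda>x. 0) \<in> S" "\<And>u v. u \<in> S \<Longrightarrow> v \<in> S \<Longrightarrow> (\<lambda>x. u x + v x) \<in> S"
    "\<And>a u. u \<in> S \<Longrightarrow> (\<lambda>x. a *\<^sub>R u x) \<in> S"
  shows "subspace (E ` S)"
proof (rule subspaceI)
  show "0 \<in> E ` S" using emb_0[OF \<Omega>] S(2) by (metis imageI)
  show "x + y \<in> E ` S" if xy: "x \<in> E ` S" "y \<in> E ` S" for x y
  proof -
    obtain u v where uv: "u \<in> S" "v \<in> S" "x = E u" "y = E v" using xy by blast
    then have "x + y = E (\<lambda>x. u x + v x)" using S(1) by (subst emb_add[OF \<Omega>]) auto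
    then show ?thesis using S(3) uv by blast
  qed
  show "a *\<^sub>R x \<in> E ` S" if x: "x \<in> E ` S" for a x
  proof -
    obtain u where u: "u \<in> S" "x = E u" using x by blast
    then have "a *\<^sub>R x = E (\<lambda>x. a *\<^sub>R u x)" using S(1) by (subst emb_scaleR[OF \<Omega>]) auto
    then show ?thesis using S(4) u by blast
  qed
qed

lemma subspace_emb_l2: "subspace (E ` l2_space \<Omega>)"
  by (intro subspace_emb l2_space_0 l2_space_add l2_space_scaleR \<Omega>) auto

lemma subspace_emb_V: "subspace (E ` V)"
  by (intro subspace_emb V_l2 V_0 V_add V_scaleR)

lemma dense_emb:
  assumes "x \<in> E ` l2_space \<Omega>" "0 < e"
  shows "\<exists>v\<in>E ` V. norm (x - v) < e"
proof -
  obtain u where u: "u \<in> l2_space \<Omega>" "x = E u" using assms(1) by auto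
  obtain v where v: "v \<in> V" "l2_norm \<Omega> (\<lambda>x. u x - v x) < e"
    using V_dense u(1) assms(2) unfolding l2_dense_def by blast
  have "norm (x - E v) < e"
    using v u V_in_l2 by (simp add: emb_diff[OF \<Omega>, symmetric] norm_emb[OF \<Omega>] l2_space_diff[OF \<Omega>])
  then show ?thesis using v(1) by blast
qed

text \<open>
  Skewness and density determine \<open>G u\<close> up to null sets from the values \<open>l2_inner \<Omega> u (G w)\<close>, and these
  are the same for \<open>v\<close>. Hence \<open>G\<close> descends to equivalence classes.
\<close>

lemma emb_G_cong:
  assumes "u \<in> V" "v \<in> V" "E u = E v"
  shows "E (G u) = E (G v)"
proof (rule ccontr)
  assume ne: "E (G u) \<noteq> E (G v)"
  define x where "x = E (G u) - E (G v)"
  have x: "x \<in> E ` l2_space \<Omega>"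
    unfolding x_def using assms by (intro subspace_diff[OF subspace_emb_l2] imageI G_l2)
  have o: "x \<bullet> E w = 0" if w: "w \<in> V" for w
  proof -
    have "x \<bullet> E w = l2_inner \<Omega> (G u) w - l2_inner \<Omega> (G v) w"
      unfolding x_def using assms w by (simp add: inner_diff_left inner_emb[OF \<Omega>] G_l2 V_in_l2)
    also have "\<dots> = - (E u \<bullet> E (G w)) + E v \<bullet> E (G w)"
      using assms(1,2) w by (simp add: G_skew inner_emb[OF \<Omega>] G_l2 V_in_l2)
    finally show ?thesis using assms(3) by simp
  qed
  have n: "0 < norm x" using ne unfolding x_def by simp
  obtain w where w: "w \<in> V" "norm (x - E w) < norm x" using dense_emb[OF x n] by blast
  have "norm x * norm x = x \<bullet> (x - E w)" using o[OF w(1)] by (simp add: inner_diff_right norm_eq_sqrt_inner)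
  also have "\<dots> \<le> norm x * norm (x - E w)" by (rule norm_cauchy_schwarz)
  also have "\<dots> < norm x * norm x" using w(2) n by (intro mult_strict_left_mono)
  finally show False by simp
qed

definition Gl :: "(real^'d, real^'m) l2 \<Rightarrow> (real^'d, real^'m) l2" where
  "Gl x = E (G (SOME v. v \<in> V \<and> E v = x))"

lemma Gl_emb: "v \<in> V \<Longrightarrow> Gl (E v) = E (G v)"
proof -
  assume v: "v \<in> V"
  have "(SOME v'. v' \<in> V \<and> E v' = E v) \<in> V \<and> E (SOME v'. v' \<in> V \<and> E v' = E v) = E v"
    by (rule someI[where x=v]) (use v in simp)
  then show ?thesis unfolding Gl_def using emb_G_cong v by blast
qed

text \<open>
  The basis functions belong to the space themselves, hence are square integrable.
\<close>

lemma fe_span: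
  assumes fe: "conforming_fe_space V k Th Vh"
  obtains B where "finite B" "E ` Vh = span B"
proof -
  have VhV: "Vh \<subseteq> V" using fe unfolding conforming_fe_space_def by blast
  obtain M :: nat and \<phi> where Vh: "Vh = {\<lambda>x. \<Sum>i<M. c i *\<^sub>R \<phi> i x | c. True}"
    using fe unfolding conforming_fe_space_def by blast
  have mem: "(\<lambda>x. \<Sum>i<M. c i *\<^sub>R \<phi> i x) \<in> Vh" for c unfolding Vh by blast
  have \<phi>: "\<phi> i \<in> Vh" if "i < M" for i
  proof -
    have "(\<lambda>x. \<Sum>j<M. (if j = i then 1 else 0) *\<^sub>R \<phi> j x) = \<phi> i"
      using that by (auto simp: if_distrib[of "\<lambda>c. c *\<^sub>R _"] sum.delta cong: if_cong)
    with mem[of "\<lambda>j. if j = i then 1 else 0"] show ?thesis by simp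
  qed
  have l2: "\<phi> i \<in> l2_space \<Omega>" if "i < M" for i using \<phi>[OF that] VhV V_l2 by blast
  have sum: "E (\<lambda>x. \<Sum>i<M. c i *\<^sub>R \<phi> i x) = (\<Sum>i<M. c i *\<^sub>R E (\<phi> i))" for c
    using emb_sum[OF \<Omega> finite_lessThan, of M \<phi> c] l2 by simp
    have r: "\<exists>c. x = (\<Sum>i<M. c i *\<^sub>R E (\<phi> i))" if x: "x \<in> E ` Vh" for x
    proof -
      obtain v where v: "v \<in> Vh" "x = E v" using x by blast
      obtain c where "v = (\<lambda>x. \<Sum>i<M. c i *\<^sub>R \<phi> i x)" using v(1) unfolding Vh by blast
      then show ?thesis using v(2) sum by blast
    qed
  have sub: "subspace (E ` Vh)"
  proof (rule subspaceI)
    have e: "(\<Sum>i<M. c i *\<^sub>R E (\<phi> i)) \<in> E ` Vh" for c unfolding sum[symmetric] by (rule imageI[OF mem])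
    show "0 \<in> E ` Vh" using e[of "\<lambda>_. 0"] by simp
    show "x + y \<in> E ` Vh" if xy: "x \<in> E ` Vh" "y \<in> E ` Vh" for x y
    proof -
      obtain c d where "x = (\<Sum>i<M. c i *\<^sub>R E (\<phi> i))" "y = (\<Sum>i<M. d i *\<^sub>R E (\<phi> i))" using r[OF xy(1)] r[OF xy(2)] by blast
      then show ?thesis using e[of "\<lambda>i. c i + d i"] by (simp add: scaleR_add_left sum.distrib)
    qed
    show "a *\<^sub>R x \<in> E ` Vh" if x: "x \<in> E ` Vh" for a x
    proof -
      obtain c where "x = (\<Sum>i<M. c i *\<^sub>R E (\<phi> i))" using r[OF x] by blast
      then show ?thesis using e[of "\<lambda>i. a * c i"] by (simp add: scaleR_sum_right)
    qed
  qed
  have "E ` Vh = span ((\<lambda>i. E (\<phi> i)) ` {..<M})"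
  proof
    show "E ` Vh \<subseteq> span ((\<lambda>i. E (\<phi> i)) ` {..<M})"
    proof
      fix x assume "x \<in> E ` Vh"
      then obtain c where "x = (\<Sum>i<M. c i *\<^sub>R E (\<phi> i))" using r by blast
      then show "x \<in> span ((\<lambda>i. E (\<phi> i)) ` {..<M})"
        by (simp only:) (intro span_sum span_scale span_base imageI)
    qed
    show "span ((\<lambda>i. E (\<phi> i)) ` {..<M}) \<subseteq> E ` Vh"
      by (rule span_minimal[OF _ sub]) (use \<phi> in auto)
  qed
  then show thesis using that[of "(\<lambda>i. E (\<phi> i)) ` {..<M}"] by simp
qed

lemma galerkin:
  assumes fe: "conforming_fe_space V k Th Vh"
  shows "skew_galerkin (E ` l2_space \<Omega>) (E ` V) (E ` Vh) Gl"
proof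
  have VhV: "Vh \<subseteq> V" using fe unfolding conforming_fe_space_def by blast
  obtain B where B: "finite B" "E ` Vh = span B" using fe_span[OF fe] .
  show "subspace (E ` l2_space \<Omega>)" by (rule subspace_emb_l2)
  show "subspace (E ` V)" by (rule subspace_emb_V)
  show "E ` V \<subseteq> E ` l2_space \<Omega>" using V_l2 by auto
  show "Gl v \<in> E ` l2_space \<Omega>" if "v \<in> E ` V" for v using that Gl_emb G_l2 by auto
  show "Gl u \<bullet> v = - (u \<bullet> Gl v)" if "u \<in> E ` V" "v \<in> E ` V" for u v
    using that by (auto simp: Gl_emb inner_emb[OF \<Omega>] G_l2 V_in_l2 G_skew)
  show "\<exists>v\<in>E ` V. norm (x - v) < e" if "x \<in> E ` l2_space \<Omega>" "0 < e" for x e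
    by (rule dense_emb[OF that])
  show "subspace (E ` Vh)" unfolding B(2) by (rule subspace_span)
  show "E ` Vh \<subseteq> E ` V" using VhV by auto
  show "\<exists>p\<in>E ` Vh. \<forall>w\<in>E ` Vh. (x - p) \<bullet> w = 0" for x
    unfolding B(2) by (rule ex_orthogonal_projection_span[OF B(1)])
qed

lemma l2_proj:
  assumes fe: "conforming_fe_space V k Th Vh" and u: "u \<in> l2_space \<Omega>"
  shows "l2_proj \<Omega> Vh u \<in> Vh" "\<And>w. w \<in> E ` Vh \<Longrightarrow> (E u - E (l2_proj \<Omega> Vh u)) \<bullet> w = 0"
proof -
  have Vh: "w \<in> l2_space \<Omega>" if "w \<in> Vh" for w using fe V_l2 that unfolding conforming_fe_space_def by blast
  have in_eq: "(E u - E p) \<bullet> E w = l2_inner \<Omega> (\<lambda>x. u x - p x) w" if "p \<in> Vh" "w \<in> Vh" for p w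
    using that Vh u by (simp add: emb_diff[OF \<Omega>, symmetric] inner_emb[OF \<Omega>] l2_space_diff[OF \<Omega>])
  obtain p where p: "p \<in> Vh" "\<forall>w\<in>E ` Vh. (E u - E p) \<bullet> w = 0"
    using skew_galerkin.ex_proj[OF galerkin[OF fe], of "E u"] by blast
  have "p \<in> Vh \<and> (\<forall>w\<in>Vh. l2_inner \<Omega> (\<lambda>x. u x - p x) w = 0)" using p in_eq by auto
  then have P: "l2_proj \<Omega> Vh u \<in> Vh \<and> (\<forall>w\<in>Vh. l2_inner \<Omega> (\<lambda>x. u x - l2_proj \<Omega> Vh u x) w = 0)"
    unfolding l2_proj_def
    by (rule someI[where P="\<lambda>p. p \<in> Vh \<and> (\<forall>w\<in>Vh. l2_inner \<Omega> (\<lambda>x. u x - p x) w = 0)"])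
  then show "l2_proj \<Omega> Vh u \<in> Vh" by simp
  then show "(E u - E (l2_proj \<Omega> Vh u)) \<bullet> w = 0" if "w \<in> E ` Vh" for w
    using P that in_eq by auto
qed

text \<open>
  The orthogonal projection is unique, so that any \<open>p\<close> with the orthogonality property is
  represented by \<open>l2_proj\<close>. Dividing the approximation estimate by \<open>h\<close> bounds the second norm.
\<close>

lemma approx_emb:
  assumes fe: "conforming_fe_space V k Th Vh" and Y: "Y \<in> V" and h: "0 < h"
    and ap: "approx_estimate \<Omega> G Vh h r C Y"
    and p: "p \<in> E ` Vh" "\<forall>w\<in>E ` Vh. (E Y - p) \<bullet> w = 0"
  shows "norm (E Y - p) \<le> C * h powr r * sobolev_norm \<Omega> r Y \<and>
    norm (Gl (E Y - p)) \<le> C * h powr (r - 1) * sobolev_norm \<Omega> r Y"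
proof -
  define q where "q = l2_proj \<Omega> Vh Y"
  have VhV: "Vh \<subseteq> V" using fe unfolding conforming_fe_space_def by blast
  have q: "q \<in> Vh" "\<And>w. w \<in> E ` Vh \<Longrightarrow> (E Y - E q) \<bullet> w = 0"
    using l2_proj[OF fe V_in_l2[OF Y]] unfolding q_def by auto
  define z where "z = E q - p"
  have z: "z \<in> E ` Vh" unfolding z_def using q(1) p(1)
    by (intro subspace_diff[OF skew_galerkin.subspace_Vh[OF galerkin[OF fe]]]) auto
  have "z \<bullet> z = (E Y - p) \<bullet> z - (E Y - E q) \<bullet> z" unfolding inner_diff_left[symmetric] by (simp add: z_def)
  also have "(E Y - p) \<bullet> z = 0" using p(2) z by blast
  also have "(E Y - E q) \<bullet> z = 0" by (rule q(2)[OF z])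
  finally have "z = 0" by simp
  then have pq: "p = E q" by (simp add: z_def)
  define e where "e = (\<lambda>x. Y x - q x)"
  have e: "e \<in> V" unfolding e_def using Y q(1) VhV by (intro V_diff) auto
  have Ee: "E Y - p = E e" unfolding pq e_def using Y q(1) VhV V_in_l2 by (subst emb_diff[OF \<Omega>]) auto
  have a: "l2_norm \<Omega> e + h * l2_norm \<Omega> (G e) \<le> C * h powr r * sobolev_norm \<Omega> r Y"
    using ap unfolding approx_estimate_def Let_def e_def q_def .
  have "l2_norm \<Omega> e \<le> C * h powr r * sobolev_norm \<Omega> r Y"
    using a mult_nonneg_nonneg[OF less_imp_le[OF h] l2_norm_nonneg[of \<Omega> "G e"]] by linarith
  moreover have "l2_norm \<Omega> (G e) \<le> C * h powr (r - 1) * sobolev_norm \<Omega> r Y"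
  proof -
    have "h * l2_norm \<Omega> (G e) \<le> C * h powr r * sobolev_norm \<Omega> r Y" using a l2_norm_nonneg[of \<Omega> e] by linarith
    also have "\<dots> = h * (C * h powr (r - 1) * sobolev_norm \<Omega> r Y)"
      using h by (simp add: powr_diff)
    finally show ?thesis using h by simp
  qed
  ultimately show ?thesis
    unfolding Ee Gl_emb[OF e] by (simp add: norm_emb[OF \<Omega>] V_in_l2[OF e] G_l2[OF e])
qed

lemma has_time_deriv_emb:
  assumes d: "has_time_deriv \<Omega> T u g"
  shows "primitive_of (E ` l2_space \<Omega>) T (\<lambda>t. E (u t)) (\<lambda>t. E (g t))"
  unfolding primitive_of_def
proof (intro ballI allI impI, elim conjE)
  fix \<phi> s t assume \<phi>: "\<phi> \<in> E ` l2_space \<Omega>" and st: "0 \<le> s" "s \<le> t" "t \<le> T"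
  obtain f where f: "f \<in> l2_space \<Omega>" "\<phi> = E f" using \<phi> by auto
  have u: "u t \<in> l2_space \<Omega>" "u s \<in> l2_space \<Omega>" using d st unfolding has_time_deriv_def by auto
  have g: "AE \<sigma> in lebesgue_on {0<..<T}. g \<sigma> \<in> l2_space \<Omega>"
    using d unfolding has_time_deriv_def time_measurable_def by auto
  have g': "AE \<sigma> in lebesgue_on {s<..<t}. g \<sigma> \<in> l2_space \<Omega>"
    by (rule AE_lebesgue_on_subset[OF g]) (use st in auto)
  have "(E (u t) - E (u s)) \<bullet> \<phi> = l2_inner \<Omega> (\<lambda>x. u t x - u s x) f"
    using f u by (simp add: emb_diff[OF \<Omega>, symmetric] inner_emb[OF \<Omega>] l2_space_diff[OF \<Omega>])
  also have "\<dots> = (LINT \<sigma>|lebesgue_on {s<..<t}. l2_inner \<Omega> (g \<sigma>) f)"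
    using d f(1) st unfolding has_time_deriv_def by blast
  also have "\<dots> = (LINT \<sigma>|lebesgue_on {s<..<t}. E (g \<sigma>) \<bullet> \<phi>)"
  proof (rule LINT_cong_AE_lebesgue)
    show "AE \<sigma> in lebesgue_on {s<..<t}. l2_inner \<Omega> (g \<sigma>) f = E (g \<sigma>) \<bullet> \<phi>"
      using g' by eventually_elim (simp add: f inner_emb[OF \<Omega>])
  qed simp
  finally show "(E (u t) - E (u s)) \<bullet> \<phi> = (LINT \<sigma>|lebesgue_on {s<..<t}. E (g \<sigma>) \<bullet> \<phi>)" .
qed

lemma has_time_deriv_norm:
  assumes d: "has_time_deriv \<Omega> T u g"
  shows "integrable (lebesgue_on {0<..<T}) (\<lambda>\<sigma>. norm (E (g \<sigma>)))"
proof (rule integrable_cong_AE_lebesgue[where f="\<lambda>\<sigma>. l2_norm \<Omega> (g \<sigma>)"])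
  have "AE \<sigma> in lebesgue_on {0<..<T}. g \<sigma> \<in> l2_space \<Omega>"
    using d unfolding has_time_deriv_def time_measurable_def by auto
  then show "AE \<sigma> in lebesgue_on {0<..<T}. l2_norm \<Omega> (g \<sigma>) = norm (E (g \<sigma>))"
    by eventually_elim (simp add: norm_emb[OF \<Omega>])
  show "integrable (lebesgue_on {0<..<T}) (\<lambda>\<sigma>. l2_norm \<Omega> (g \<sigma>))"
    using d unfolding has_time_deriv_def by auto
qed simp

end

lemma Linf_time_norm_nonneg:
  assumes T: "0 < T" and n: "\<And>v. 0 \<le> nX v"
  shows "0 \<le> Linf_time_norm T nX w"
proof (cases "esssup (lebesgue_on {0<..<T}) (\<lambda>t. ereal (nX (w t)))")
  case (real r)
  have "AE t in lebesgue_on {0<..<T}. 0 \<le> r"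
    using esssup_AE[of "\<lambda>t. ereal (nX (w t))" "lebesgue_on {0<..<T}"] unfolding real
    by eventually_elim (use n order_trans in \<open>auto simp: ereal_less_eq(3)\<close>)
  then have "0 \<le> r" by (rule const_le_of_AE[OF T])
  then show ?thesis unfolding Linf_time_norm_def real by simp
qed (simp_all add: Linf_time_norm_def)

lemma Linf_time_norm_AE:
  assumes "esssup (lebesgue_on {0<..<T}) (\<lambda>t. ereal (nX (w t))) < \<infinity>"
  shows "AE t in lebesgue_on {0<..<T}. nX (w t) \<le> Linf_time_norm T nX w"
  using esssup_AE[of "\<lambda>t. ereal (nX (w t))" "lebesgue_on {0<..<T}"]
proof eventually_elim
  case (elim t)
  then show ?case using assms unfolding Linf_time_norm_def
    by (cases "esssup (lebesgue_on {0<..<T}) (\<lambda>t. ereal (nX (w t)))") auto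
qed

lemma L2_time_norm_nonneg: "0 \<le> L2_time_norm T nX w"
  unfolding L2_time_norm_def by (auto intro: integral_nonneg_AE)

lemma mesh_size_le:
  assumes "lipschitz_domain \<Omega>" "fe_mesh \<Omega> Th"
  shows "mesh_size Th \<le> diameter (closure \<Omega>)"
proof -
  have b: "bounded (closure \<Omega>)" "\<Omega> \<noteq> {}" using assms(1) unfolding lipschitz_domain_def by auto
  have Th: "finite Th" "\<Union>Th = closure \<Omega>" using assms(2) unfolding fe_mesh_def by auto
  have ne: "Th \<noteq> {}"
  proof
    assume "Th = {}"
    then have "closure \<Omega> = {}" using Th(2) by simp
    then show False using b(2) by (simp only: closure_eq_empty)
  qed
  have "diameter K \<le> diameter (closure \<Omega>)" if "K \<in> Th" for K
    using that Th(2) by (intro diameter_subset b(1)) blast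
  then show ?thesis unfolding mesh_size_def
    using Th(1) ne by (intro Max.boundedI) auto
qed

section \<open>Error estimate\<close>

text \<open>
  The right-hand side of the final estimate, with \<open>x = h powr r\<close>, \<open>y = h powr (r - 1)\<close>,
  \<open>t = \<tau> ^ \<nu>\<close>, the norms \<open>E\<close>, \<open>L0\<close>, \<open>L1\<close> of the exact solution and its derivative, and the compound norms
  \<open>N\<close> and \<open>Cs\<close>.
\<close>

definition error_majorant :: "real \<Rightarrow> real \<Rightarrow> real \<Rightarrow> real \<Rightarrow> real \<Rightarrow> real \<Rightarrow> real \<Rightarrow> real \<Rightarrow> real \<Rightarrow> real \<Rightarrow> real \<Rightarrow> real" where
  "error_majorant x y \<delta> \<tau> T t E N L0 L1 Cs =
     (x + \<delta> * y) * E + ((1 + sqrt T) * sqrt \<delta> * y + x / sqrt \<delta>) * N + (1 + sqrt T) * t * Cs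
     + sqrt \<tau> * (x + \<tau> * y) * L1 + sqrt \<tau> * y * L0 + sqrt \<tau> * t * Cs"

text \<open>
  The bound \<open>error_bound\<close> with the data of the application inserted, and the projection error at the
  final index. The bounds \<open>\<delta> \<le> 1\<close> and \<open>\<tau> \<le> q\<close> make the remaining products comparable with
  the summands of the majorant.
\<close>

lemma collect_error_terms:
  fixes x y E N L0 L1 Cs \<delta> \<tau> T t A q :: real
  assumes nn: "0 \<le> x" "0 \<le> y" "0 \<le> E" "0 \<le> L0" "0 \<le> L1" "0 \<le> Cs" "0 \<le> t" "0 \<le> A" "0 \<le> T"
    and \<delta>: "0 < \<delta>" "\<delta> \<le> 1" and \<tau>: "0 < \<tau>" "\<tau> \<le> q" and N: "L0 \<le> N" "L1 \<le> N"
  defines "R \<equiv> error_majorant x y \<delta> \<tau> T t E N L0 L1 Cs"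
  defines "a \<equiv> A * x" and "b \<equiv> A * y" and "c \<equiv> 4000 * t * Cs"
  defines "e0 \<equiv> 2 * a * (L0 + \<tau> * L1)" and "e1 \<equiv> 2 * b * (L0 + \<tau> * L1)"
  shows "sqrt \<delta> * (a * L1) + \<delta> * sqrt \<delta> * (b * L1) + e0 / sqrt \<delta> + sqrt \<delta> * e1 + sqrt \<delta> * c
      + sqrt T * (\<delta> * (b * L1) + c) + \<delta> * (b * (E + sqrt \<tau> * L1)) + sqrt \<tau> * (c + a * L1 + e1)
      \<le> (20 * A * (1 + q) + 8000) * R" (is "?B \<le> _")
    and "(a + \<delta> * b) * (E + sqrt \<tau> * L1) \<le> (20 * A * (1 + q) + 8000) * R"
proof -
  define d s u where "d = sqrt \<delta>" and "s = sqrt \<tau>" and "u = sqrt T"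
  have d: "0 < d" "d \<le> 1" "\<delta> = d * d" using \<delta> by (auto simp: d_def)
  have s: "0 < s" "\<tau> = s * s" using \<tau> by (auto simp: s_def)
  have u: "0 \<le> u" using nn by (auto simp: u_def)
  have q0: "0 \<le> q" using \<tau> by simp
  have sq: "s \<le> 1 + q"
    using zero_le_power2[of "s - 1/2"] \<tau> s by (simp add: power2_eq_square algebra_simps)
  have N0: "0 \<le> N" using N nn by linarith
  define R1 R2a R2b R2c R3 R4 R5 R6 where "R1 = (x + d * d * y) * E" and "R2a = d * y * N" and "R2b = u * (d * y * N)"
    and "R2c = x / d * N" and "R3 = (1 + u) * t * Cs" and "R4 = s * (x + s * s * y) * L1" and "R5 = s * y * L0" and "R6 = s * t * Cs"
  note Rdefs = R1_def R2a_def R2b_def R2c_def R3_def R4_def R5_def R6_def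
  have R: "R = R1 + R2a + R2b + R2c + R3 + R4 + R5 + R6"
    unfolding R_def error_majorant_def Rdefs using d s by (simp add: d_def[symmetric] s_def[symmetric] u_def[symmetric] algebra_simps)
  have Rn: "0 \<le> R1" "0 \<le> R2a" "0 \<le> R2b" "0 \<le> R2c" "0 \<le> R3" "0 \<le> R4" "0 \<le> R5" "0 \<le> R6"
    unfolding Rdefs using nn N0 d s u by (auto intro!: mult_nonneg_nonneg add_nonneg_nonneg)
  have xd: "x \<le> x / d" "d * x \<le> x / d"
  proof -
    have "x * d \<le> x * 1" using nn d by (intro mult_left_mono) auto
    then show 1: "x \<le> x / d" using d by (simp add: pos_le_divide_eq)
    have "d * x \<le> 1 * x" using nn d by (intro mult_right_mono) auto
    then show "d * x \<le> x / d" using 1 by simp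
  qed
  have dd: "d * d \<le> d" using d by (simp add: mult_left_le)
  have t1: "d * (x * L1) \<le> R2c"
  proof -
    have "(d * x) * L1 \<le> (x / d) * N" using xd nn N d by (intro mult_mono) auto
    then show ?thesis unfolding R2c_def by (simp add: mult.assoc)
  qed
  have yL: "y * L1 \<le> y * N" using nn N by (auto intro: mult_left_mono)
  have L: "L0 + \<tau> * L1 \<le> (1 + q) * N"
  proof -
    have "\<tau> * L1 \<le> q * N" using \<tau> nn N q0 by (intro mult_mono) auto
    then show ?thesis using N by (simp add: algebra_simps)
  qed
  have t2: "d * d * d * (y * L1) \<le> R2a"
  proof -
    have "d * d * d \<le> d" using mult_mono[OF dd d(2)] d by simp
    then have "d * d * d * (y * L1) \<le> d * (y * N)" by (rule mult_mono[OF _ yL]) (use nn d in auto)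
    then show ?thesis unfolding R2a_def by (simp add: mult.assoc)
  qed
  have t3: "x / d * (L0 + \<tau> * L1) \<le> (1 + q) * R2c"
  proof -
    have "x / d * (L0 + \<tau> * L1) \<le> x / d * ((1 + q) * N)" by (rule mult_left_mono[OF L]) (use nn d in simp)
    also have "\<dots> = (1 + q) * R2c" unfolding R2c_def by (simp only: mult.left_commute)
    finally show ?thesis .
  qed
  have t4: "d * y * (L0 + \<tau> * L1) \<le> (1 + q) * R2a"
    using mult_left_mono[OF L, of "d * y"] nn d unfolding R2a_def by (simp add: algebra_simps)
  have tc: "t * Cs + u * (t * Cs) = R3" unfolding R3_def by (simp add: algebra_simps)
  have tc0: "0 \<le> t * Cs" "0 \<le> u * (t * Cs)" using nn u by auto
  have t5: "d * (t * Cs) \<le> R3" using mult_right_mono[OF d(2) tc0(1)] tc tc0 by simp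
  have t6: "u * (d * d * (y * L1)) \<le> R2b"
    unfolding R2b_def mult.assoc[of d y N] by (rule mult_left_mono[OF mult_mono[OF dd yL] u]) (use nn d in auto)
  have t7: "u * (t * Cs) \<le> R3" using tc tc0 by simp
  have t8: "d * d * (y * E) \<le> R1" unfolding R1_def using nn by (simp add: algebra_simps)
  have t9: "d * d * (y * (s * L1)) \<le> (1 + q) * R2a"
  proof -
    have "(d * d) * (s * (y * L1)) \<le> d * ((1 + q) * (y * N))"
      by (rule mult_mono[OF dd mult_mono[OF sq yL]]) (use nn d s q0 in auto)
    then show ?thesis unfolding R2a_def by (simp add: algebra_simps)
  qed
  have t11: "s * (x * L1) \<le> R4" "s * (y * (s * s * L1)) \<le> R4"
    unfolding R4_def using nn s by (auto simp: algebra_simps)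
  have B: "?B = A * (d * (x * L1)) + A * (d * d * d * (y * L1)) + 2 * A * (x / d * (L0 + \<tau> * L1))
     + 2 * A * (d * y * (L0 + \<tau> * L1)) + 4000 * (d * (t * Cs)) + A * (u * (d * d * (y * L1))) + 4000 * (u * (t * Cs))
     + A * (d * d * (y * E)) + A * (d * d * (y * (s * L1))) + 4000 * R6 + A * (s * (x * L1)) + 2 * A * R5 + 2 * A * (s * (y * (s * s * L1)))"
    unfolding a_def b_def c_def e0_def e1_def d_def[symmetric] s_def[symmetric] u_def[symmetric] R6_def R5_def
    unfolding d(3) s(2) by (simp add: algebra_simps add_divide_distrib)
  have m: "A * v \<le> A * w" if "v \<le> w" for v w using that nn by (intro mult_left_mono)
  define f where "f r = A * (1 + q) * r" for r
  have fe: "A * ((1 + q) * r) = f r" for r by (simp add: f_def)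
  have k: "A * r \<le> f r" "0 \<le> f r" if "0 \<le> r" for r
    unfolding f_def using that nn q0 mult_nonneg_nonneg[OF mult_nonneg_nonneg[OF nn(8) q0] that] by (auto simp: algebra_simps)
  have R'': "(20 * A * (1 + q) + 8000) * R = 20 * f R1 + 20 * f R2a + 20 * f R2b + 20 * f R2c + 20 * f R3 + 20 * f R4 + 20 * f R5 + 20 * f R6
       + 8000 * (R1 + R2a + R2b + R2c + R3 + R4 + R5 + R6)"
    unfolding R f_def by (simp add: algebra_simps)
  have "?B \<le> A * R2c + A * R2a + 2 * (A * ((1 + q) * R2c)) + 2 * (A * ((1 + q) * R2a)) + 4000 * R3 + A * R2b + 4000 * R3
     + A * R1 + A * ((1 + q) * R2a) + 4000 * R6 + A * R4 + 2 * (A * R5) + 2 * (A * R4)"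
    unfolding B using m[OF t1] m[OF t2] m[OF t3] m[OF t4] t5 m[OF t6] t7 m[OF t8] m[OF t9] m[OF t11(1)] m[OF t11(2)] by linarith
  also have "\<dots> \<le> (20 * A * (1 + q) + 8000) * R"
  proof -
    have "A * R2c + 2 * f R2c \<le> 20 * f R2c" "A * R2a + 2 * f R2a + f R2a \<le> 20 * f R2a" "A * R2b \<le> 20 * f R2b"
      using k[OF Rn(2)] k[OF Rn(3)] k[OF Rn(4)] by linarith+
    moreover have "A * R1 \<le> 20 * f R1" "A * R4 + 2 * (A * R4) \<le> 20 * f R4" "2 * (A * R5) \<le> 20 * f R5"
      using k[OF Rn(1)] k[OF Rn(6)] k[OF Rn(7)] by linarith+
    moreover have "0 \<le> 20 * f R3" "0 \<le> 20 * f R6" using k(2)[OF Rn(5)] k(2)[OF Rn(8)] by simp_all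
    moreover have "4000 * R3 + 4000 * R3 + 4000 * R6 \<le> 8000 * (R1 + R2a + R2b + R2c + R3 + R4 + R5 + R6)"
      using Rn by simp
    ultimately show ?thesis unfolding fe R'' by linarith
  qed
  finally show "?B \<le> (20 * A * (1 + q) + 8000) * R" .
  have "(a + \<delta> * b) * (E + sqrt \<tau> * L1) = A * R1 + A * (s * (x * L1)) + A * (d * d * (y * (s * L1)))"
    unfolding a_def b_def R1_def s_def[symmetric] d(3) by (simp add: algebra_simps)
  also have "\<dots> \<le> A * R1 + A * R4 + A * ((1 + q) * R2a)" using m[OF t11(1)] m[OF t9] by linarith
  also have "\<dots> \<le> (20 * A * (1 + q) + 8000) * R"
  proof -
    have "A * R1 \<le> 20 * f R1" "A * R4 \<le> 20 * f R4" "f R2a \<le> 20 * f R2a"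
      using k[OF Rn(1)] k[OF Rn(6)] k[OF Rn(2)] by linarith+
    moreover have "0 \<le> 20 * f R3" "0 \<le> 20 * f R6" "0 \<le> 20 * f R2b" "0 \<le> 20 * f R2c" "0 \<le> 20 * f R5"
      using k(2)[OF Rn(3)] k(2)[OF Rn(4)] k(2)[OF Rn(5)] k(2)[OF Rn(7)] k(2)[OF Rn(8)] by simp_all
    moreover have "0 \<le> 8000 * (R1 + R2a + R2b + R2c + R3 + R4 + R5 + R6)"
      using Rn by simp
    ultimately show ?thesis unfolding fe R'' by linarith
  qed
  finally show "(a + \<delta> * b) * (E + sqrt \<tau> * L1) \<le> (20 * A * (1 + q) + 8000) * R" .
qed

context l2_operator
begin

lemma V_sum:
  assumes "finite I" "\<And>i. i \<in> I \<Longrightarrow> u i \<in> V"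
  shows "(\<lambda>x. \<Sum>i\<in>I. c i *\<^sub>R u i x) \<in> V"
  using assms
proof (induction I rule: finite_induct)
  case empty then show ?case using V_0 by simp
next
  case (insert i I)
  then show ?case using V_add[OF V_scaleR[of "u i" "c i"], of "\<lambda>x. \<Sum>i\<in>I. c i *\<^sub>R u i x"] by simp
qed

lemma emb_stab_test: "w \<in> V \<Longrightarrow> stab_test G \<delta> w \<in> l2_space \<Omega> \<and> E (stab_test G \<delta> w) = E w + \<delta> *\<^sub>R Gl (E w)"
  unfolding stab_test_def
  by (simp add: Gl_emb emb_add[OF \<Omega>] emb_scaleR[OF \<Omega>] l2_space_add[OF \<Omega>] l2_space_scaleR[OF \<Omega>] V_in_l2 G_l2)

lemma emb_ab_mean:
  assumes "\<And>j. j \<le> \<nu> \<Longrightarrow> v (n - j) \<in> l2_space \<Omega>"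
  shows "ab_mean \<nu> v n \<in> l2_space \<Omega> \<and> E (ab_mean \<nu> v n) = abm \<nu> (\<lambda>k. E (v k)) n"
  unfolding ab_mean_def abm_def using emb_sum[OF \<Omega>, of "{..\<nu>}" "\<lambda>j. v (n - j)" "ab_coeff \<nu>"] assms by simp

lemma emb_ab_operator:
  assumes "\<And>j. v (n - j) \<in> V"
  shows "ab_operator G \<nu> \<tau> v n \<in> l2_space \<Omega> \<and>
    E (ab_operator G \<nu> \<tau> v n) = (1/\<tau>) *\<^sub>R bdiff (\<lambda>k. E (v k)) n + Gl (abm \<nu> (\<lambda>k. E (v k)) n)"
proof -
  have m: "ab_mean \<nu> v n \<in> V" unfolding ab_mean_def using assms by (intro V_sum) auto
  have e: "E (ab_mean \<nu> v n) = abm \<nu> (\<lambda>k. E (v k)) n"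
    using emb_ab_mean[of \<nu> v n] assms V_in_l2 by blast
  have v: "v n \<in> l2_space \<Omega>" "v (n - 1) \<in> l2_space \<Omega>" using assms[of 0] assms[of 1] V_in_l2 by auto
  have d: "back_diff \<tau> v n \<in> l2_space \<Omega>" "E (back_diff \<tau> v n) = (1/\<tau>) *\<^sub>R bdiff (\<lambda>k. E (v k)) n"
    unfolding back_diff_def bdiff_def
    by (simp_all only: emb_diff[OF \<Omega>] emb_scaleR[OF \<Omega>] l2_space_diff[OF \<Omega>] l2_space_scaleR[OF \<Omega>] v)
  show ?thesis unfolding ab_operator_def
    using emb_add[OF \<Omega> d(1) G_l2[OF m]] l2_space_add[OF \<Omega> d(1) G_l2[OF m]] d(2) Gl_emb[OF m] e by simp
qed

text \<open>
  The estimate for one discretization, with the constant made explicit. The sequences of the abstract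
  error equation are cut off after index \<open>N\<close>, because the data are only known up to time \<open>T\<close>.
\<close>

lemma ab_error_estimate:
  fixes C_G C_\<delta> C_app h \<delta> \<tau> q T r :: real and N \<nu> k :: nat
  assumes \<nu>: "\<nu> \<in> {3, 4}" and fe: "conforming_fe_space V k Th Vh" and h: "0 < h"
    and inv: "\<forall>W\<in>Vh. l2_norm \<Omega> (G W) \<le> C_G * (1 / h) * l2_norm \<Omega> W"
    and C: "0 < C_G" "0 < C_\<delta>" "0 < C_app"
    and \<delta>: "0 < \<delta>" "\<delta> \<le> C_\<delta> * h" "\<delta> \<le> 1"
    and \<tau>: "0 < \<tau>" "\<tau> \<le> c_AB * (1 / C_G) * h" "\<tau> \<le> q"
    and c_AB: "c_AB * (1 + C_\<delta> * C_G)\<^sup>2 \<le> 1/100"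
    and N: "\<nu> \<le> N" "real N * \<tau> \<le> T"
    and ex: "exact_solution \<Omega> V G T F U0 U"
    and dU: "time_derivs \<Omega> T 2 U DU" and dR: "time_derivs \<Omega> T (\<nu> + 1) (rhs_minus_G G F U) DR"
    and reg: "regular_data \<Omega> T r \<nu> DU DR"
    and approx: "\<forall>j\<le>2. AE t in lebesgue_on {0<..<T}. DU j t \<in> V \<and> approx_estimate \<Omega> G Vh h r C_app (DU j t)"
    and scheme: "ab_scheme \<Omega> G Vh \<nu> \<tau> \<delta> N F U Uh"
    and n: "n \<in> {\<nu>..N}"
  shows "l2_norm \<Omega> (stab_test G \<delta> (\<lambda>x. Uh n x - U (real n * \<tau>) x))
    \<le> (600 * (1 + C_\<delta> * C_G)\<^sup>2 + 1) * (20 * C_app * (1 + q) + 8000) * error_majorant (h powr r) (h powr (r - 1)) \<delta> \<tau> T (\<tau> ^ \<nu>)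
      (Linf_time_norm T (sobolev_norm \<Omega> r) U) (norm_N2 \<Omega> T r DU) (L2_time_norm T (sobolev_norm \<Omega> r) U)
      (L2_time_norm T (sobolev_norm \<Omega> r) (DU 1)) (norm_Csharp \<Omega> T \<nu> DR)"
proof -
  define K where "K = C_\<delta> * C_G"
  define a b where "a = C_app * h powr r" and "b = C_app * h powr (r - 1)"
  have K: "0 \<le> K" unfolding K_def using C by simp
  have ab: "0 \<le> a" "0 \<le> b" unfolding a_def b_def using C by auto
  have N0: "0 < N" using N(1) \<nu> by auto
  have T: "0 < T"
  proof -
    have "0 < real N * \<tau>" using N0 \<tau>(1) by simp
    then show ?thesis using N(2) by linarith
  qed
  have VhV: "w \<in> V" if "w \<in> Vh" for w using fe that unfolding conforming_fe_space_def by blast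
  have kT: "real k * \<tau> \<in> {0..T}" if "k \<le> N" for k
  proof -
    have "real k * \<tau> \<le> real N * \<tau>" using that \<tau>(1) by (intro mult_right_mono) auto
    then have "real k * \<tau> \<le> T" using N(2) by linarith
    then show ?thesis using \<tau>(1) by simp
  qed
  have UV: "U t \<in> V" and Fl2: "F t \<in> l2_space \<Omega>" if "t \<in> {0..T}" for t
    using ex that unfolding exact_solution_def by auto
  have DU0: "DU 0 = U" using dU unfolding time_derivs_def by simp
  have dU1: "has_time_deriv \<Omega> T U (DU 1)" using dU DU0 unfolding time_derivs_def by (metis One_nat_def zero_less_numeral)
  have DR0: "DR 0 = rhs_minus_G G F U" using dR unfolding time_derivs_def by simp
  have dUR: "has_time_deriv \<Omega> T U (DR 0)" using ex DR0 unfolding exact_solution_def by simp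
  have dDR: "has_time_deriv \<Omega> T (DR j) (DR (Suc j))" if "j \<le> \<nu>" for j
    using dR that unfolding time_derivs_def by simp

  interpret sg: skew_galerkin "E ` l2_space \<Omega>" "E ` V" "E ` Vh" Gl by (rule galerkin[OF fe])

  have regU: "(\<lambda>t. sobolev_norm \<Omega> r (DU j t)) \<in> borel_measurable (lebesgue_on {0<..<T})"
    "integrable (lebesgue_on {0<..<T}) (\<lambda>t. (sobolev_norm \<Omega> r (DU j t))\<^sup>2)" if "j \<le> 2" for j
    using reg that unfolding regular_data_def L2_time_space_def by auto
  have regD: "integrable (lebesgue_on {0<..<T}) (\<lambda>t. (l2_norm \<Omega> (DR \<nu> t))\<^sup>2)"
    using reg unfolding regular_data_def L2_time_space_def by auto
  have regE: "esssup (lebesgue_on {0<..<T}) (\<lambda>t. ereal (sobolev_norm \<Omega> r (U t))) < \<infinity>"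
    using reg DU0 unfolding regular_data_def Linf_time_space_def by fastforce

  have ap: "AE t in lebesgue_on {0<..<T}. E (DU j t) \<in> E ` V \<and>
      sg.proj_error_le (E (DU j t)) (a * sobolev_norm \<Omega> r (DU j t)) (b * sobolev_norm \<Omega> r (DU j t))"
    if j: "j \<le> 2" for j
  proof -
    have "AE t in lebesgue_on {0<..<T}. DU j t \<in> V \<and> approx_estimate \<Omega> G Vh h r C_app (DU j t)"
      using approx j by blast
    then show ?thesis
    proof eventually_elim
      case (elim t)
      then show ?case using approx_emb[OF fe _ h] unfolding a_def b_def by blast
    qed
  qed

  define p where "p k = E (l2_proj \<Omega> Vh (U (real k * \<tau>)))" for k
  define pp where "pp k = (if k \<le> N then p k else 0)" for k
  define uu where "uu k = (if k \<le> N then E (U (real k * \<tau>)) else 0)" for k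
  define vv where "vv k = (if k \<le> N then E (Uh k) else 0)" for k
  define \<theta> where "\<theta> k = vv k - pp k" for k
  define \<eta> where "\<eta> k = uu k - pp k" for k
  define \<rho> where "\<rho> n = (\<Sum>j\<in>{1..\<nu>}. ab_coeff \<nu> j *\<^sub>R E (DR 0 (real (n - j) * \<tau>)))
        - (1/\<tau>) *\<^sub>R (E (U (real n * \<tau>)) - E (U (real (n - 1) * \<tau>)))" for n

  have p: "p k \<in> E ` Vh" "\<And>w. w \<in> E ` Vh \<Longrightarrow> (E (U (real k * \<tau>)) - p k) \<bullet> w = 0" if "k \<le> N" for k
    unfolding p_def using l2_proj[OF fe V_in_l2[OF UV[OF kT[OF that]]]] by auto
  have UhV: "Uh k \<in> Vh" if "k \<le> N" for k using scheme that unfolding ab_scheme_def by simp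

  interpret gg: galerkin_grid "E ` l2_space \<Omega>" "E ` V" "E ` Vh" Gl T "\<lambda>t. E (U t)" "\<lambda>t. E (DU 1 t)"
    "\<lambda>t. sobolev_norm \<Omega> r (U t)" "\<lambda>t. sobolev_norm \<Omega> r (DU 1 t)" a b \<tau> N p \<eta>
  proof unfold_locales
    show "E (U t) \<in> E ` V" if "t \<in> {0..T}" for t using UV[OF that] by simp
    show "primitive_of (E ` l2_space \<Omega>) T (\<lambda>t. E (U t)) (\<lambda>t. E (DU 1 t))" by (rule has_time_deriv_emb[OF dU1])
    show "0 \<le> sobolev_norm \<Omega> r (U \<sigma>)" "0 \<le> sobolev_norm \<Omega> r (DU 1 \<sigma>)" for \<sigma>
      by (rule sobolev_norm_nonneg)+
    show "integrable (lebesgue_on {0<..<T}) (\<lambda>\<sigma>. (sobolev_norm \<Omega> r (U \<sigma>))\<^sup>2)" using regU(2)[of 0] DU0 by simp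
    show "integrable (lebesgue_on {0<..<T}) (\<lambda>\<sigma>. (sobolev_norm \<Omega> r (DU 1 \<sigma>))\<^sup>2)" using regU(2)[of 1] by simp
    show "integrable (lebesgue_on {0<..<T}) (\<lambda>\<sigma>. sobolev_norm \<Omega> r (DU 1 \<sigma>))"
      by (rule integrable_of_square[OF regU]) simp_all
    show "AE t in lebesgue_on {0<..<T}. sg.proj_error_le (E (U t)) (a * sobolev_norm \<Omega> r (U t)) (b * sobolev_norm \<Omega> r (U t))"
      using ap[of 0] unfolding DU0 by (auto elim!: eventually_mono)
    show "AE \<sigma> in lebesgue_on {0<..<T}. E (DU 1 \<sigma>) \<in> E ` V \<and>
        sg.proj_error_le (E (DU 1 \<sigma>)) (a * sobolev_norm \<Omega> r (DU 1 \<sigma>)) (b * sobolev_norm \<Omega> r (DU 1 \<sigma>))"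
      by (rule ap) simp
    show "0 \<le> a" "0 \<le> b" by (rule ab)+
    show "0 < \<tau>" "real N * \<tau> \<le> T" by (rule \<tau> N)+
    show "p k \<in> E ` Vh" if "k \<le> N" for k by (rule p(1)[OF that])
    show "(E (U (real k * \<tau>)) - p k) \<bullet> w = 0" if "k \<le> N" "w \<in> E ` Vh" for k w by (rule p(2)[OF that])
    show "\<eta> k = E (U (real k * \<tau>)) - p k" if "k \<le> N" for k using that by (simp add: \<eta>_def uu_def pp_def)
  qed

  interpret sm: smooth_evolution "E ` l2_space \<Omega>" T \<nu> "\<lambda>t. E (U t)" "\<lambda>j t. E (DR j t)"
  proof unfold_locales
    show "subspace (E ` l2_space \<Omega>)" by (rule subspace_emb_l2)
    show "\<nu> \<in> {3, 4}" by (rule \<nu>)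
    show "E (U t) \<in> E ` l2_space \<Omega>" if "t \<in> {0..T}" for t using UV[OF that] V_in_l2 by blast
    show "E (DR j t) \<in> E ` l2_space \<Omega>" if "j \<le> \<nu>" "t \<in> {0..T}" for j t
      using dDR[OF that(1)] that(2) unfolding has_time_deriv_def by blast
    show "primitive_of (E ` l2_space \<Omega>) T (\<lambda>t. E (U t)) (\<lambda>t. E (DR 0 t))" by (rule has_time_deriv_emb[OF dUR])
    show "primitive_of (E ` l2_space \<Omega>) T (\<lambda>t. E (DR j t)) (\<lambda>t. E (DR (Suc j) t))" if "j \<le> \<nu>" for j
      by (rule has_time_deriv_emb[OF dDR[OF that]])
    show "integrable (lebesgue_on {0<..<T}) (\<lambda>\<sigma>. norm (E (DR (Suc j) \<sigma>)))" if "j \<le> \<nu>" for j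
      by (rule has_time_deriv_norm[OF dDR[OF that]])
  qed

  have ppVh: "pp k \<in> E ` Vh" for k using p(1) subspace_0[OF sg.subspace_Vh] by (simp add: pp_def)
  have vvVh: "vv k \<in> E ` Vh" for k using UhV subspace_0[OF sg.subspace_Vh] by (simp add: vv_def)
  have uuV: "uu k \<in> E ` V" for k using UV kT subspace_0[OF sg.subspace_V] by (simp add: uu_def)
  have \<theta>Vh: "\<theta> k \<in> E ` Vh" for k unfolding \<theta>_def by (intro subspace_diff sg.subspace_Vh ppVh vvVh)
  have \<eta>V: "\<eta> k \<in> E ` V" for k unfolding \<eta>_def by (intro subspace_diff sg.subspace_V uuV sg.Vh_in_V ppVh)
  have \<theta>0: "\<theta> j = 0" if j: "j < \<nu>" for j
  proof -
    have jN: "j \<le> N" using j N by simp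
    have "E (Uh j) = E (l2_proj \<Omega> Vh (U (real j * \<tau>)))"
    proof (rule emb_cong_AE[OF \<Omega>])
      show "Uh j \<in> l2_space \<Omega>" by (intro V_in_l2 VhV UhV jN)
      show "l2_proj \<Omega> Vh (U (real j * \<tau>)) \<in> l2_space \<Omega>"
        by (intro V_in_l2 VhV l2_proj(1)[OF fe] UV kT jN)
      show "AE x in lebesgue_on \<Omega>. Uh j x = l2_proj \<Omega> Vh (U (real j * \<tau>)) x"
        using scheme j unfolding ab_scheme_def by blast
    qed
    then show ?thesis using jN by (simp add: \<theta>_def vv_def pp_def p_def)
  qed

  have scheme_eq: "((1/\<tau>) *\<^sub>R bdiff \<theta> n + Gl (abm \<nu> \<theta> n)) \<bullet> (W + \<delta> *\<^sub>R Gl W)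
    = (\<rho> n + (1/\<tau>) *\<^sub>R bdiff \<eta> n + Gl (abm \<nu> \<eta> n)) \<bullet> (W + \<delta> *\<^sub>R Gl W)"
    if nn: "\<nu> \<le> n" "n \<le> N" and W: "W \<in> E ` Vh" for n W
  proof -
    obtain w where w: "w \<in> Vh" "W = E w" using W by blast
    define S where "S = W + \<delta> *\<^sub>R Gl W"
    have St: "stab_test G \<delta> w \<in> l2_space \<Omega>" "E (stab_test G \<delta> w) = S"
      using emb_stab_test[OF VhV[OF w(1)]] w(2) unfolding S_def by auto
    have op: "ab_operator G \<nu> \<tau> Uh n \<in> l2_space \<Omega>"
      "E (ab_operator G \<nu> \<tau> Uh n) = (1/\<tau>) *\<^sub>R bdiff (\<lambda>k. E (Uh k)) n + Gl (abm \<nu> (\<lambda>k. E (Uh k)) n)"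
      using emb_ab_operator[of Uh n \<nu> \<tau>] nn VhV UhV by auto
    have cong_abm: "abm \<nu> f n = abm \<nu> g n" if "\<And>k. k \<le> N \<Longrightarrow> f k = g k" for f g :: "nat \<Rightarrow> (real^'d, real^'m) l2"
      unfolding abm_def using nn that by (intro sum.cong) auto
    have cong_bd: "bdiff f n = bdiff g n" if "\<And>k. k \<le> N \<Longrightarrow> f k = g k" for f g :: "nat \<Rightarrow> (real^'d, real^'m) l2"
      unfolding bdiff_def using nn that by simp
    have opv: "E (ab_operator G \<nu> \<tau> Uh n) = (1/\<tau>) *\<^sub>R bdiff vv n + Gl (abm \<nu> vv n)"
      unfolding op(2) using cong_bd[of "\<lambda>k. E (Uh k)" vv] cong_abm[of "\<lambda>k. E (Uh k)" vv] by (simp add: vv_def)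
    have Fm: "ab_mean \<nu> (\<lambda>j. F (real j * \<tau>)) n \<in> l2_space \<Omega>"
      "E (ab_mean \<nu> (\<lambda>j. F (real j * \<tau>)) n) = abm \<nu> (\<lambda>k. E (F (real k * \<tau>))) n"
    proof -
      have "F (real (n - j) * \<tau>) \<in> l2_space \<Omega>" for j by (intro Fl2 kT) (use nn in linarith)
      then show "ab_mean \<nu> (\<lambda>j. F (real j * \<tau>)) n \<in> l2_space \<Omega>"
        "E (ab_mean \<nu> (\<lambda>j. F (real j * \<tau>)) n) = abm \<nu> (\<lambda>k. E (F (real k * \<tau>))) n"
        using emb_ab_mean[of \<nu> "\<lambda>j. F (real j * \<tau>)" n] by blast+
    qed
    have "l2_inner \<Omega> (ab_operator G \<nu> \<tau> Uh n) (stab_test G \<delta> w)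
      = l2_inner \<Omega> (ab_mean \<nu> (\<lambda>j. F (real j * \<tau>)) n) (stab_test G \<delta> w)"
      using scheme nn w(1) unfolding ab_scheme_def by simp
    then have main: "((1/\<tau>) *\<^sub>R bdiff vv n + Gl (abm \<nu> vv n)) \<bullet> S = abm \<nu> (\<lambda>k. E (F (real k * \<tau>))) n \<bullet> S"
      using inner_emb[OF \<Omega> op(1) St(1)] inner_emb[OF \<Omega> Fm(1) St(1)] unfolding opv Fm(2) St(2) by simp
    have bd: "bdiff \<theta> n = bdiff vv n - bdiff pp n" "bdiff \<eta> n = bdiff uu n - bdiff pp n"
      unfolding bdiff_def \<theta>_def \<eta>_def by simp_all
    have am: "abm \<nu> \<theta> n = abm \<nu> vv n - abm \<nu> pp n" "abm \<nu> \<eta> n = abm \<nu> uu n - abm \<nu> pp n"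
      unfolding abm_def \<theta>_def \<eta>_def by (simp_all add: scaleR_diff_right sum_subtractf)
    have inV: "abm \<nu> vv n \<in> E ` V" "abm \<nu> pp n \<in> E ` V" "abm \<nu> uu n \<in> E ` V"
      by (intro sg.abm_in sg.subspace_V uuV sg.Vh_in_V[OF vvVh] sg.Vh_in_V[OF ppVh])+
    have Gam: "Gl (abm \<nu> \<theta> n) = Gl (abm \<nu> vv n) - Gl (abm \<nu> pp n)" "Gl (abm \<nu> \<eta> n) = Gl (abm \<nu> uu n) - Gl (abm \<nu> pp n)"
      unfolding am by (intro sg.G_diff inV)+
    \<comment> \<open>Since \<open>DR 0 = F - G U\<close>, the exact solution satisfies the scheme up to \<open>\<rho>\<close>.\<close>
    have Ru: "\<rho> n + (1/\<tau>) *\<^sub>R bdiff uu n + Gl (abm \<nu> uu n) = abm \<nu> (\<lambda>k. E (F (real k * \<tau>))) n"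
    proof -
      have D0: "E (DR 0 (real k * \<tau>)) = E (F (real k * \<tau>)) - Gl (uu k)" if k: "k \<le> N" for k
      proof -
        have "DR 0 (real k * \<tau>) = (\<lambda>x. F (real k * \<tau>) x - G (U (real k * \<tau>)) x)"
          unfolding DR0 rhs_minus_G_def by simp
        then show ?thesis using k Fl2[OF kT[OF k]] UV[OF kT[OF k]] G_l2
          by (simp add: emb_diff[OF \<Omega>] Gl_emb uu_def)
      qed
      have "(\<Sum>j\<in>{1..\<nu>}. ab_coeff \<nu> j *\<^sub>R E (DR 0 (real (n - j) * \<tau>)))
        = (\<Sum>j\<in>{1..\<nu>}. ab_coeff \<nu> j *\<^sub>R (E (F (real (n - j) * \<tau>)) - Gl (uu (n - j))))"
      proof (intro sum.cong refl)
        fix j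
        have "n - j \<le> N" using nn by linarith
        then show "ab_coeff \<nu> j *\<^sub>R E (DR 0 (real (n - j) * \<tau>))
          = ab_coeff \<nu> j *\<^sub>R (E (F (real (n - j) * \<tau>)) - Gl (uu (n - j)))" by (simp only: D0)
      qed
      also have "\<dots> = abm \<nu> (\<lambda>k. E (F (real k * \<tau>))) n - Gl (abm \<nu> uu n)"
        unfolding sg.G_abm[OF uuV] unfolding abm_from_1[OF \<nu>] by (simp add: scaleR_diff_right sum_subtractf)
      finally have s: "(\<Sum>j\<in>{1..\<nu>}. ab_coeff \<nu> j *\<^sub>R E (DR 0 (real (n - j) * \<tau>)))
        = abm \<nu> (\<lambda>k. E (F (real k * \<tau>))) n - Gl (abm \<nu> uu n)" .
      have "bdiff uu n = E (U (real n * \<tau>)) - E (U (real (n - 1) * \<tau>))"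
      proof -
        have "n - 1 \<le> N" using nn by linarith
        then show ?thesis unfolding bdiff_def uu_def using nn by simp
      qed
      then show ?thesis unfolding \<rho>_def s by simp
    qed
    have "((1/\<tau>) *\<^sub>R bdiff \<theta> n + Gl (abm \<nu> \<theta> n)) - (\<rho> n + (1/\<tau>) *\<^sub>R bdiff \<eta> n + Gl (abm \<nu> \<eta> n))
      = ((1/\<tau>) *\<^sub>R bdiff vv n + Gl (abm \<nu> vv n)) - (\<rho> n + (1/\<tau>) *\<^sub>R bdiff uu n + Gl (abm \<nu> uu n))"
      unfolding bd Gam by (simp add: scaleR_diff_right)
    also have "\<dots> = ((1/\<tau>) *\<^sub>R bdiff vv n + Gl (abm \<nu> vv n)) - abm \<nu> (\<lambda>k. E (F (real k * \<tau>))) n" unfolding Ru ..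
    finally have "(((1/\<tau>) *\<^sub>R bdiff \<theta> n + Gl (abm \<nu> \<theta> n)) - (\<rho> n + (1/\<tau>) *\<^sub>R bdiff \<eta> n + Gl (abm \<nu> \<eta> n))) \<bullet> S
       = 0" using main by (simp only: inner_diff_left)
    then show ?thesis unfolding S_def by (simp only: inner_diff_left)
  qed

  have invG: "norm (Gl W) \<le> C_G * (1 / h) * norm W" if W: "W \<in> E ` Vh" for W
  proof -
    obtain w where w: "w \<in> Vh" "W = E w" using W by blast
    show ?thesis using inv w(1) VhV[OF w(1)] unfolding w(2)
      by (simp add: Gl_emb norm_emb[OF \<Omega>] V_in_l2 G_l2)
  qed

  interpret sa: stabilized_ab "E ` l2_space \<Omega>" "E ` V" "E ` Vh" Gl \<nu> N \<tau> \<delta> K \<theta> \<eta> \<rho>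
  proof unfold_locales
    show "\<nu> \<in> {3, 4}" by (rule \<nu>)
    show "0 < \<tau>" "0 < \<delta>" "0 \<le> K" by (rule \<tau> \<delta> K)+
    show "\<delta> * norm (Gl W) \<le> K * norm W" if "W \<in> E ` Vh" for W
    proof -
      have "\<delta> * norm (Gl W) \<le> (C_\<delta> * h) * (C_G * (1 / h) * norm W)"
        using invG[OF that] \<delta> C h by (intro mult_mono) auto
      also have "\<dots> = K * norm W" using h by (simp add: K_def)
      finally show ?thesis .
    qed
    show "\<tau> * (1 + K)\<^sup>2 * norm (Gl W) \<le> 1/100 * norm W" if "W \<in> E ` Vh" for W
    proof -
      have "\<tau> * (1 + K)\<^sup>2 * norm (Gl W) \<le> \<tau> * (1 + K)\<^sup>2 * (C_G * (1 / h) * norm W)"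
        using invG[OF that] \<tau>(1) by (intro mult_left_mono) auto
      also have "\<dots> \<le> (c_AB * (1 / C_G) * h) * (1 + K)\<^sup>2 * (C_G * (1 / h) * norm W)"
        using \<tau>(2) C h by (intro mult_right_mono) auto
      also have "\<dots> = c_AB * (1 + K)\<^sup>2 * norm W" using C h by simp
      also have "\<dots> \<le> 1/100 * norm W" using c_AB unfolding K_def by (intro mult_right_mono) auto
      finally show ?thesis .
    qed
    show "\<theta> n \<in> E ` Vh" for n by (rule \<theta>Vh)
    show "\<theta> j = 0" if "j < \<nu>" for j by (rule \<theta>0[OF that])
    show "\<eta> n \<in> E ` V" for n by (rule \<eta>V)
    show "\<eta> n \<bullet> W = 0" if "W \<in> E ` Vh" for n W
      using p(2)[OF _ that] by (simp add: \<eta>_def uu_def pp_def)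
    show "((1/\<tau>) *\<^sub>R bdiff \<theta> n + Gl (abm \<nu> \<theta> n)) \<bullet> (W + \<delta> *\<^sub>R Gl W)
      = (\<rho> n + (1/\<tau>) *\<^sub>R bdiff \<eta> n + Gl (abm \<nu> \<eta> n)) \<bullet> (W + \<delta> *\<^sub>R Gl W)"
      if "\<nu> \<le> n" "n \<le> N" "W \<in> E ` Vh" for n W by (rule scheme_eq[OF that])
  qed

  define L0 L1 Ei Nn Cs cR where "L0 = L2_time_norm T (sobolev_norm \<Omega> r) U" and "L1 = L2_time_norm T (sobolev_norm \<Omega> r) (DU 1)"
    and "Ei = Linf_time_norm T (sobolev_norm \<Omega> r) U" and "Nn = norm_N2 \<Omega> T r DU" and "Cs = norm_Csharp \<Omega> T \<nu> DR"
    and "cR = L2_time_norm T (l2_norm \<Omega>) (DR \<nu>)"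
  have nn: "0 \<le> L0" "0 \<le> L1" "0 \<le> Ei" "0 \<le> cR"
    unfolding L0_def L1_def Ei_def cR_def
    by (intro L2_time_norm_nonneg Linf_time_norm_nonneg T sobolev_norm_nonneg)+
  have cs: "cR \<le> Cs"
    unfolding cR_def Cs_def norm_Csharp_def
    using L2_time_norm_nonneg[of T "l2_norm \<Omega>" "DR (\<nu> + 1)"] Linf_time_norm_nonneg[where nX="l2_norm \<Omega>" and w="DR \<nu>", OF T l2_norm_nonneg] by simp
  have sums: "L0 \<le> Nn" "L1 \<le> Nn"
  proof -
    have two: "{..2::nat} = {0, 1, 2}" "{..1::nat} = {0, 1}" by auto
    have "Nn = L0 + L1 + L2_time_norm T (sobolev_norm \<Omega> r) (DU 2) + (Ei + Linf_time_norm T (sobolev_norm \<Omega> r) (DU 1))"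
      unfolding Nn_def norm_N2_def two L0_def L1_def Ei_def using DU0 by simp
    then show "L0 \<le> Nn" "L1 \<le> Nn"
      using nn L2_time_norm_nonneg[of T "sobolev_norm \<Omega> r" "DU 2"] Linf_time_norm_nonneg[where nX="sobolev_norm \<Omega> r" and w="DU 1", OF T sobolev_norm_nonneg]
      by linarith+
  qed
  have I: "gg.I0 = L0\<^sup>2" "gg.I1 = L1\<^sup>2"
    unfolding gg.I0_def gg.I1_def L0_def L1_def L2_time_norm_def
    using gg.I_nonneg unfolding gg.I0_def gg.I1_def by simp_all
  have sqI: "sqrt gg.I1 = L1" unfolding I using nn by simp
  have e_bound: "2 * m\<^sup>2 * (gg.I0 + \<tau>\<^sup>2 * gg.I1) \<le> (2 * m * (L0 + \<tau> * L1))\<^sup>2" for m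
  proof -
    have "2 * (m\<^sup>2 * (L0\<^sup>2 + \<tau>\<^sup>2 * L1\<^sup>2)) \<le> 4 * (m\<^sup>2 * (L0 + \<tau> * L1)\<^sup>2)"
    proof -
      have "L0\<^sup>2 + \<tau>\<^sup>2 * L1\<^sup>2 \<le> (L0 + \<tau> * L1)\<^sup>2"
        using nn \<tau>(1) by (simp add: power2_sum power_mult_distrib)
      then have "m\<^sup>2 * (L0\<^sup>2 + \<tau>\<^sup>2 * L1\<^sup>2) \<le> m\<^sup>2 * (L0 + \<tau> * L1)\<^sup>2" by (intro mult_left_mono) auto
      moreover have "0 \<le> m\<^sup>2 * (L0\<^sup>2 + \<tau>\<^sup>2 * L1\<^sup>2)" by simp
      ultimately show ?thesis by linarith
    qed
    then show ?thesis unfolding I by (simp add: power_mult_distrib mult.assoc)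
  qed
  have E_AE: "AE t in lebesgue_on {0<..<T}. sobolev_norm \<Omega> r (U t) \<le> Ei"
    unfolding Ei_def by (rule Linf_time_norm_AE[OF regE])
  have eta_max: "norm (\<eta> j) \<le> a * (Ei + sqrt \<tau> * L1)" "norm (Gl (\<eta> j)) \<le> b * (Ei + sqrt \<tau> * L1)" if "j \<le> N" for j
    using gg.eta_max[OF E_AE N0 that] unfolding sqI .
  have DRl2: "AE t in lebesgue_on {0<..<T}. l2_norm \<Omega> (DR \<nu> t) = norm (E (DR \<nu> t))"
  proof (rule AE_I2)
    fix t assume "t \<in> space (lebesgue_on {0<..<T})"
    then have "DR \<nu> t \<in> l2_space \<Omega>" using dDR[of \<nu>] unfolding has_time_deriv_def by simp
    then show "l2_norm \<Omega> (DR \<nu> t) = norm (E (DR \<nu> t))" by (simp add: norm_emb[OF \<Omega>])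
  qed
  have DRl2': "AE t in lebesgue_on {0<..<T}. (l2_norm \<Omega> (DR \<nu> t))\<^sup>2 = (norm (E (DR \<nu> t)))\<^sup>2"
    using DRl2 by eventually_elim simp
  have cons: "\<tau> * (\<Sum>n\<in>{\<nu>..N}. (norm (\<rho> n))\<^sup>2) \<le> (4000 * \<tau> ^ \<nu> * cR)\<^sup>2"
    using sm.consistency_sum[OF \<tau>(1) N(2) integrable_cong_AE_lebesgue[OF _ DRl2' regD], of \<rho>]
      LINT_cong_AE_lebesgue[OF _ DRl2'] unfolding cR_def L2_time_norm_def \<rho>_def by simp

  define B where "B = sqrt \<delta> * (a * L1) + \<delta> * sqrt \<delta> * (b * L1) + 2 * a * (L0 + \<tau> * L1) / sqrt \<delta> + sqrt \<delta> * (2 * b * (L0 + \<tau> * L1))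
      + sqrt \<delta> * (4000 * \<tau> ^ \<nu> * Cs) + sqrt T * (\<delta> * (b * L1) + 4000 * \<tau> ^ \<nu> * Cs) + \<delta> * (b * (Ei + sqrt \<tau> * L1))
      + sqrt \<tau> * (4000 * \<tau> ^ \<nu> * Cs + a * L1 + 2 * b * (L0 + \<tau> * L1))"
  have XB: "norm (sa.X n) \<le> 300 * (1 + K)\<^sup>2 * B"
    unfolding B_def
  proof (rule sa.error_bound[OF N(2)])
    show "\<tau> * (\<Sum>k<N. (norm (\<eta> k))\<^sup>2) \<le> (2 * a * (L0 + \<tau> * L1))\<^sup>2" by (rule order_trans[OF gg.eta_sum e_bound])
    show "\<tau> * (\<Sum>k<N. (norm (Gl (\<eta> k)))\<^sup>2) \<le> (2 * b * (L0 + \<tau> * L1))\<^sup>2" by (rule order_trans[OF gg.G_eta_sum e_bound])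
    show "(\<Sum>k\<in>{1..N}. (norm (bdiff \<eta> k))\<^sup>2) \<le> \<tau> * (a * L1)\<^sup>2"
      using gg.eta_increment_sum(1) unfolding I by (simp add: power_mult_distrib)
    show "(\<Sum>k\<in>{1..N}. (norm (Gl (bdiff \<eta> k)))\<^sup>2) \<le> \<tau> * (b * L1)\<^sup>2"
      using gg.eta_increment_sum(2) unfolding I by (simp add: power_mult_distrib)
    have "(4000 * \<tau> ^ \<nu> * cR)\<^sup>2 \<le> (4000 * \<tau> ^ \<nu> * Cs)\<^sup>2"
      using cs nn \<tau>(1) by (intro power_mono mult_left_mono) auto
    then show "\<tau> * (\<Sum>k\<in>{\<nu>..N}. (norm (\<rho> k))\<^sup>2) \<le> (4000 * \<tau> ^ \<nu> * Cs)\<^sup>2" using cons by linarith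
    show "norm (Gl (\<eta> k)) \<le> b * (Ei + sqrt \<tau> * L1)" if "k < N" for k using eta_max(2)[of k] that by simp
    show "n \<le> N" using n by simp
  qed (use T nn cs ab \<tau>(1) in auto)

  define R where "R = error_majorant (h powr r) (h powr (r - 1)) \<delta> \<tau> T (\<tau> ^ \<nu>) Ei Nn L0 L1 Cs"
  define M where "M = 20 * C_app * (1 + q) + 8000"
  have BR: "B \<le> M * R" and etaR: "(a + \<delta> * b) * (Ei + sqrt \<tau> * L1) \<le> M * R"
    unfolding B_def R_def M_def a_def b_def
    by (rule collect_error_terms; use nn cs C T \<delta> \<tau> sums in simp)+

  have nN: "n \<le> N" using n by simp
  have UhUV: "(\<lambda>x. Uh n x - U (real n * \<tau>) x) \<in> V" by (intro V_diff VhV UhV UV kT nN)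
  have e: "E (\<lambda>x. Uh n x - U (real n * \<tau>) x) = \<theta> n - \<eta> n"
    using nN V_in_l2[OF VhV[OF UhV[OF nN]]] V_in_l2[OF UV[OF kT[OF nN]]]
    by (simp add: emb_diff[OF \<Omega>] \<theta>_def \<eta>_def vv_def uu_def)
  have st: "E (stab_test G \<delta> (\<lambda>x. Uh n x - U (real n * \<tau>) x)) = (\<theta> n + \<delta> *\<^sub>R Gl (\<theta> n)) - (\<eta> n + \<delta> *\<^sub>R Gl (\<eta> n))"
    using emb_stab_test[OF UhUV, of \<delta>] sg.G_diff[OF sa.\<theta>V \<eta>V, of n n] unfolding e by (simp add: scaleR_diff_right)
  have "l2_norm \<Omega> (stab_test G \<delta> (\<lambda>x. Uh n x - U (real n * \<tau>) x)) = norm ((\<theta> n + \<delta> *\<^sub>R Gl (\<theta> n)) - (\<eta> n + \<delta> *\<^sub>R Gl (\<eta> n)))"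
    using emb_stab_test[OF UhUV, of \<delta>] st norm_emb[OF \<Omega>] by metis
  also have "\<dots> \<le> (norm (\<theta> n) + norm (\<delta> *\<^sub>R Gl (\<theta> n))) + (norm (\<eta> n) + \<delta> * norm (Gl (\<eta> n)))"
    using norm_triangle_ineq4[of "\<theta> n + \<delta> *\<^sub>R Gl (\<theta> n)" "\<eta> n + \<delta> *\<^sub>R Gl (\<eta> n)"]
      norm_triangle_ineq[of "\<theta> n" "\<delta> *\<^sub>R Gl (\<theta> n)"] norm_triangle_ineq[of "\<eta> n" "\<delta> *\<^sub>R Gl (\<eta> n)"] \<delta>(1) by simp
  also have "\<dots> \<le> 2 * norm (sa.X n) + (a * (Ei + sqrt \<tau> * L1) + \<delta> * (b * (Ei + sqrt \<tau> * L1)))"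
  proof -
    have "norm (\<theta> n) \<le> norm (sa.X n)" "norm (\<delta> *\<^sub>R Gl (\<theta> n)) \<le> norm (sa.X n)"
      using norm_fst_snd_le[of "sa.X n"] by (simp_all add: sa.X_def)
    moreover have "\<delta> * norm (Gl (\<eta> n)) \<le> \<delta> * (b * (Ei + sqrt \<tau> * L1))"
      using eta_max(2)[OF nN] \<delta>(1) by (intro mult_left_mono) auto
    ultimately show ?thesis using eta_max(1)[OF nN] by linarith
  qed
  also have "\<dots> = 2 * norm (sa.X n) + (a + \<delta> * b) * (Ei + sqrt \<tau> * L1)" by (simp add: algebra_simps)
  also have "\<dots> \<le> 2 * (300 * (1 + K)\<^sup>2 * (M * R)) + M * R"
  proof -
    have "300 * (1 + K)\<^sup>2 * B \<le> 300 * (1 + K)\<^sup>2 * (M * R)" using BR by (intro mult_left_mono) auto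
    then show ?thesis using XB etaR by linarith
  qed
  also have "\<dots> = (600 * (1 + K)\<^sup>2 + 1) * M * R" by (simp add: algebra_simps)
  finally show ?thesis unfolding K_def M_def R_def L0_def L1_def Ei_def Nn_def Cs_def .
qed

end

theorem corollary6p1:
  fixes \<Omega> :: "(real^'d) set"
    and V :: "(real^'d \<Rightarrow> real^'m) set"
    and G :: "(real^'d \<Rightarrow> real^'m) \<Rightarrow> (real^'d \<Rightarrow> real^'m)"
    and \<nu> k :: nat
    and s r \<kappa> C_G C_\<delta> C_app :: real
  assumes "lipschitz_domain \<Omega>"
    and "ae_subspace \<Omega> V" and "V \<subseteq> sobolev_space \<Omega> 1" and "l2_dense \<Omega> V"
    and "first_order_operator \<Omega> V G" and "\<forall>u\<in>V. G u \<in> l2_space \<Omega>"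
    and "\<forall>u\<in>V. \<forall>v\<in>V. l2_inner \<Omega> (G u) v = - l2_inner \<Omega> u (G v)"
    and "\<nu> \<in> {3, 4}"
    and "s \<ge> 1" and "r = min s (real (k + 1))"
    and "\<kappa> > 0" and "C_G > 0" and "C_\<delta> > 0" and "C_app > 0"
  shows "\<exists>c\<^sub>0>0. \<forall>c_AB. 0 < c_AB \<and> c_AB < c\<^sub>0 \<longrightarrow>
    (\<exists>C>0. \<forall>Th Vh h \<tau> \<delta> N T F U0 U DU DR Uh.
       fe_mesh \<Omega> Th \<longrightarrow> shape_regular \<kappa> Th \<longrightarrow> h = mesh_size Th \<longrightarrow>
       conforming_fe_space V k Th Vh \<longrightarrow>
       (\<forall>W\<in>Vh. l2_norm \<Omega> (G W) \<le> C_G * (1 / h) * l2_norm \<Omega> W) \<longrightarrow>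
       0 < \<delta> \<longrightarrow> \<delta> \<le> C_\<delta> * h \<longrightarrow> \<delta> \<le> 1 \<longrightarrow>
       0 < \<tau> \<longrightarrow> \<tau> \<le> c_AB * (1 / C_G) * h \<longrightarrow>
       \<nu> \<le> N \<longrightarrow> real N * \<tau> \<le> T \<longrightarrow>
       exact_solution \<Omega> V G T F U0 U \<longrightarrow>
       time_derivs \<Omega> T 2 U DU \<longrightarrow> time_derivs \<Omega> T (\<nu> + 1) (rhs_minus_G G F U) DR \<longrightarrow>
       regular_data \<Omega> T r \<nu> DU DR \<longrightarrow>
       (\<forall>j\<le>2. AE t in lebesgue_on {0<..<T}.
          DU j t \<in> V \<and> approx_estimate \<Omega> G Vh h r C_app (DU j t)) \<longrightarrow>
       ab_scheme \<Omega> G Vh \<nu> \<tau> \<delta> N F U Uh \<longrightarrow>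
       (MAX n\<in>{\<nu>..N}. l2_norm \<Omega> (stab_test G \<delta> (\<lambda>x. Uh n x - U (real n * \<tau>) x)))
       \<le> C * (
           (h powr r + \<delta> * h powr (r - 1)) * Linf_time_norm T (sobolev_norm \<Omega> r) U
         + ((1 + T powr (1/2)) * \<delta> powr (1/2) * h powr (r - 1) + \<delta> powr (- 1/2) * h powr r)
             * norm_N2 \<Omega> T r DU
         + (1 + T powr (1/2)) * \<tau> ^ \<nu> * norm_Csharp \<Omega> T \<nu> DR
         + \<tau> powr (1/2) * (h powr r + \<tau> * h powr (r - 1))
             * L2_time_norm T (sobolev_norm \<Omega> r) (DU 1)
         + \<tau> powr (1/2) * h powr (r - 1) * L2_time_norm T (sobolev_norm \<Omega> r) U
         + \<tau> powr (real \<nu> + 1/2) * norm_Csharp \<Omega> T \<nu> DR))"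
proof -
  define K where "K = C_\<delta> * C_G"
  define c0 where "c0 = 1 / (100 * (1 + K)\<^sup>2)"
  define diam where "diam = diameter (closure \<Omega>)"
  have K: "0 \<le> K" unfolding K_def using assms(12,13) by simp
  have K1: "0 < (1 + K)\<^sup>2" using K by simp
  have diam0: "0 \<le> diam" unfolding diam_def using assms(1) unfolding lipschitz_domain_def by (intro diameter_ge_0) auto
  have op: "l2_operator \<Omega> V G"
  proof
    have "open \<Omega>" using assms(1) unfolding lipschitz_domain_def by simp
    then show "\<Omega> \<in> sets lebesgue" by simp
    show "V \<subseteq> l2_space \<Omega>" using assms(3) unfolding sobolev_space_def by auto
  qed (use assms(2,4,6,7) in auto)
  show ?thesis
  proof (rule exI[of _ c0], intro conjI allI impI, goal_cases)
    case 1
    show ?case unfolding c0_def using K1 by simp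
  next
    case (2 c_AB)
    note c = this
    define q where "q = c_AB * (1 / C_G) * diam"
    define C where "C = (600 * (1 + K)\<^sup>2 + 1) * (20 * C_app * (1 + q) + 8000)"
    have q0: "0 \<le> q" unfolding q_def using c assms(12) diam0 by simp
    have C0: "0 < C"
      unfolding C_def using q0 assms(14) K1 by (intro mult_pos_pos add_nonneg_pos) auto
    have "c_AB * (1 + K)\<^sup>2 \<le> c0 * (1 + K)\<^sup>2" using c K1 by (intro mult_right_mono) auto
    also have "\<dots> = 1/100" unfolding c0_def using K1 by simp
    finally have cK: "c_AB * (1 + K)\<^sup>2 \<le> 1/100" .
    show ?case
    proof (rule exI[of _ C], intro conjI allI impI, goal_cases)
      case 1
      show ?case by (rule C0)
    next
      case (2 Th Vh h \<tau> \<delta> N T F U0 U DU DR Uh)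
      note mesh = 2(1) and h = 2(3) and fe = 2(4) and inv = 2(5) and \<delta> = 2(6-8) and \<tau> = 2(9,10)
        and N = 2(11,12) and data = 2(13-18)
      \<comment> \<open>The mesh size is at most the diameter of \<open>\<Omega>\<close>; hence the bound \<open>q\<close> for the time step,
        and with it \<open>C\<close>, does not depend on the discretization.\<close>
      have "0 < C_\<delta> * h" using \<delta>(1,2) by linarith
      then have h0: "0 < h" using assms(13) by (simp add: zero_less_mult_iff)
      have "h \<le> diam" unfolding h diam_def by (rule mesh_size_le[OF assms(1) mesh])
      then have "c_AB * (1 / C_G) * h \<le> q" unfolding q_def using c assms(12) by (intro mult_left_mono) auto
      then have \<tau>q: "\<tau> \<le> q" using \<tau>(2) by linarith
      have T0: "0 \<le> T" using N(2) \<tau>(1) mult_nonneg_nonneg[of "real N" \<tau>] by linarith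
      have pw: "T powr (1/2) = sqrt T" "\<delta> powr (1/2) = sqrt \<delta>" "\<tau> powr (1/2) = sqrt \<tau>"
        "\<delta> powr (- 1/2) * h powr r = h powr r / sqrt \<delta>" "\<tau> powr (real \<nu> + 1/2) = sqrt \<tau> * \<tau> ^ \<nu>"
        using T0 \<delta>(1) \<tau>(1) powr_minus_divide[of \<delta> "1/2"]
        by (simp_all add: powr_half_sqrt powr_add powr_realpow)
      have est: "l2_norm \<Omega> (stab_test G \<delta> (\<lambda>x. Uh n x - U (real n * \<tau>) x)) \<le> C * error_majorant (h powr r) (h powr (r - 1)) \<delta> \<tau> T (\<tau> ^ \<nu>)
        (Linf_time_norm T (sobolev_norm \<Omega> r) U) (norm_N2 \<Omega> T r DU) (L2_time_norm T (sobolev_norm \<Omega> r) U)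
        (L2_time_norm T (sobolev_norm \<Omega> r) (DU 1)) (norm_Csharp \<Omega> T \<nu> DR)"
        if "n \<in> {\<nu>..N}" for n
        unfolding C_def K_def
        by (rule l2_operator.ab_error_estimate[OF op assms(8) fe h0 inv assms(12,13,14) \<delta> \<tau> \<tau>q cK[unfolded K_def] N data that])
      show ?case
        unfolding pw using N(1) est by (intro Max.boundedI) (auto simp: error_majorant_def)
    qed
  qed
qed

end
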